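(* Let $n\ge3$. The set $\mathcal P_n^*$ of polygons in $\mathcal P_n$ satisfying Condition ( * ) is a residual subset of $\mathcal P_n$ (with the topology of the distance $d$) and has full measure in $\mathcal P_n$ (with respect to the measure $m$).
   Context: $\mathcal P_n$ is the moduli space of convex polygons with $n$ (labelled) sides in the plane modulo orientation-preserving similarities. It is diffeomorphic to an open semialgebraic subset of $\mathbb P^1\times(\mathbb P^2)^{n-3}\times\mathbb P^1$ (real projective spaces), a manifold of dimension $2n-4$: after normalising one side to a fixed segment, the two adjacent side lines pass through a fixed endpoint each and are given by a point of $\mathbb P^1$, and the other $n-3$ side lines are given by their projective coordinates $(a:b:c)\in\mathbb P^2$. $d$ and $m$ are the distance and measure induced on $\mathcal P_n$ by this product of projective spaces. Each element $P$ is represented by a polygon of perimeter $1$, with boundary parametrised counterclockwise by arc length and identified with $S^1=\mathbb R/\mathbb Z$. The slap map $\psi_P:S^1\to S^1$: if $s\in\partial P$ is not a vertex, $\psi_P(s)$ is the point where the ray leaving $s$ along the inner normal to $\partial P$ next meets $\partial P$; $\psi_P$ is extended to the vertices by left continuity. $S_P$ is the set of vertices of $P$ whose internal angle is not acute. $P$ satisfies Condition ( * ) if for every $s\in S_P$ the forward $\psi_P$-orbits of $\psi_P(s^+)=\lim_{t\to s^+}\psi_P(t)$ and of $\psi_P(s^-)=\lim_{t\to s^-}\psi_P(t)$ contain no element of $S_P$ and no periodic point of $\psi_P$. Residual means containing a countable intersection of open dense sets. *)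

theory Defs
  imports "HOL-Analysis.Analysis"
begin

section \<open>Real projective spaces\<close>

definition projrel :: "'a::euclidean_space \<Rightarrow> 'a \<Rightarrow> bool" where
  "projrel x y \<longleftrightarrow> x \<noteq> 0 \<and> y \<noteq> 0 \<and> (\<exists>c. y = c *\<^sub>R x)"

lemma projrel_iff:
  "projrel x y \<longleftrightarrow> x \<noteq> 0 \<and> (\<exists>c. c \<noteq> 0 \<and> y = c *\<^sub>R x)"
  by (auto simp: projrel_def)

lemma part_equivp_projrel: "part_equivp (projrel :: 'a::euclidean_space \<Rightarrow> 'a \<Rightarrow> bool)"
proof (rule part_equivpI)
  obtain b :: 'a where "b \<in> Basis" using nonempty_Basis by blast
  then have "projrel b b" by (auto simp: projrel_iff intro!: exI[of _ 1])
  then show "\<exists>x::'a. projrel x x" ..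
  show "symp (projrel :: 'a \<Rightarrow> 'a \<Rightarrow> bool)"
  proof (rule sympI)
    fix x y :: 'a assume "projrel x y"
    then obtain c where "x \<noteq> 0" "c \<noteq> 0" "y = c *\<^sub>R x" by (auto simp: projrel_iff)
    then show "projrel y x" unfolding projrel_iff by (auto intro!: exI[of _ "inverse c"])
  qed
  show "transp (projrel :: 'a \<Rightarrow> 'a \<Rightarrow> bool)"
    by (rule transpI) (auto simp: projrel_def)
qed

text \<open>The type \<open>'a proj\<close> is the set of lines through the origin of \<open>'a\<close>, of dimension
  \<open>DIM('a) - 1\<close>.\<close>

quotient_type (overloaded) 'a proj = "'a::euclidean_space" / partial: projrel
  by (rule part_equivp_projrel)

lemma abs_proj_eq_iff:
  assumes "x \<noteq> 0" "y \<noteq> 0"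
  shows "abs_proj x = abs_proj y \<longleftrightarrow> projrel x y"
proof -
  have "projrel z z" if "z \<noteq> 0" for z :: 'a
    using that by (auto simp: projrel_iff intro!: exI[of _ 1])
  then show ?thesis
    using Quotient3_rel[OF Quotient3_proj, of x y] assms by auto
qed

lemma proj_exists_rep: "\<exists>x. x \<noteq> 0 \<and> p = abs_proj x"
proof -
  have "projrel (rep_proj p) (rep_proj p)" by (rule Quotient3_rep_reflp[OF Quotient3_proj])
  then show ?thesis
    using Quotient3_abs_rep[OF Quotient3_proj, of p] by (metis projrel_iff)
qed

lift_definition proj_angle :: "'a::euclidean_space proj \<Rightarrow> 'a proj \<Rightarrow> real"
  is "\<lambda>x y. arccos (\<bar>x \<bullet> y\<bar> / (norm x * norm y))"
  by (auto simp: projrel_iff abs_mult field_simps)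

lemma proj_angle_abs:
  assumes "x \<noteq> 0" "y \<noteq> 0"
  shows "proj_angle (abs_proj x) (abs_proj y) = arccos (\<bar>x \<bullet> y\<bar> / (norm x * norm y))"
  using assms by (intro proj_angle.abs_eq) (auto simp: projrel_iff intro!: exI[of _ 1])

lemma proj_unit_reps:
  fixes p q :: "'a::euclidean_space proj" and v :: 'a
  assumes v: "norm v = 1" "p = abs_proj v"
  obtains u where "norm u = 1" "q = abs_proj u" "u \<bullet> v \<ge> 0" "proj_angle q p = arccos (u \<bullet> v)"
proof -
  obtain y where y: "y \<noteq> 0" "q = abs_proj y" using proj_exists_rep by blast
  define c where "c = (if y \<bullet> v \<ge> 0 then 1 else -1) / norm y"
  define u where "u = c *\<^sub>R y"
  have c: "c \<noteq> 0" using y by (simp add: c_def)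
  have u: "norm u = 1" using y by (simp add: u_def c_def)
  then have u0: "u \<noteq> 0" "v \<noteq> 0" using v by auto
  have q: "q = abs_proj u"
    using y u0 c by (simp add: abs_proj_eq_iff projrel_iff) (use u_def in blast)
  have pos: "u \<bullet> v \<ge> 0"
    by (auto simp: u_def c_def divide_simps)
  have "proj_angle q p = arccos (u \<bullet> v)"
    using u v pos by (simp add: q v(2) proj_angle_abs[OF u0])
  with u q pos that show thesis by blast
qed

lemma proj_unit_rep:
  fixes p :: "'a::euclidean_space proj"
  obtains v where "norm v = 1" "p = abs_proj v"
proof -
  obtain y where y: "y \<noteq> 0" "p = abs_proj y" using proj_exists_rep by blast
  have "norm (y /\<^sub>R norm y) = 1" using y by simp
  moreover from this have "y /\<^sub>R norm y \<noteq> 0" by auto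
  then have "p = abs_proj (y /\<^sub>R norm y)"
    using y by (simp add: abs_proj_eq_iff projrel_iff)
  ultimately show thesis using that by blast
qed

lemma inner_unit_bounds:
  assumes "norm u = 1" "norm v = 1"
  shows "u \<bullet> v \<le> 1" "-1 \<le> u \<bullet> v"
  using Cauchy_Schwarz_ineq2[of u v] assms by auto

lemma proj_angle_triangle:
  fixes p q r :: "'a::euclidean_space proj"
  shows "proj_angle p r \<le> proj_angle p q + proj_angle q r"
proof -
  obtain v where v: "norm v = 1" "q = abs_proj v" using proj_unit_rep by blast
  obtain u where u: "norm u = 1" "p = abs_proj u" "u \<bullet> v \<ge> 0" "proj_angle p q = arccos (u \<bullet> v)"
    using proj_unit_reps[OF v] by blast
  obtain w where w: "norm w = 1" "r = abs_proj w" "w \<bullet> v \<ge> 0" "proj_angle r q = arccos (w \<bullet> v)"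
    using proj_unit_reps[OF v] by blast
  have nz: "u \<noteq> 0" "v \<noteq> 0" "w \<noteq> 0" using u v w by auto
  define \<alpha> \<beta> where "\<alpha> = arccos (u \<bullet> v)" and "\<beta> = arccos (w \<bullet> v)"
  have qr: "proj_angle q r = \<beta>"
    using w v by (simp add: \<beta>_def proj_angle_abs[OF nz(2,3)] inner_commute)
  have b: "\<bar>u \<bullet> v\<bar> \<le> 1" "\<bar>w \<bullet> v\<bar> \<le> 1"
    using inner_unit_bounds[OF u(1) v(1)] inner_unit_bounds[OF w(1) v(1)] by auto
  have ab: "0 \<le> \<alpha>" "\<alpha> \<le> pi/2" "0 \<le> \<beta>" "\<beta> \<le> pi/2"
    using b u(3) w(3) arccos_le_pi2[of "u \<bullet> v"] arccos_le_pi2[of "w \<bullet> v"]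
    unfolding \<alpha>_def \<beta>_def by (auto intro!: arccos_lbound simp del: arccos_le_pi2)
  have cs: "cos \<alpha> = u \<bullet> v" "cos \<beta> = w \<bullet> v"
    using b by (auto simp: \<alpha>_def \<beta>_def abs_le_iff)
  have vv: "v \<bullet> v = 1" "u \<bullet> u = 1" "w \<bullet> w = 1" using u v w by (simp_all add: dot_square_norm)
  have sn: "(sin \<alpha>)\<^sup>2 = 1 - (u \<bullet> v)\<^sup>2" "(sin \<beta>)\<^sup>2 = 1 - (w \<bullet> v)\<^sup>2"
    by (simp_all add: sin_squared_eq cs)
  have n1: "(norm (u - (u \<bullet> v) *\<^sub>R v))\<^sup>2 = (sin \<alpha>)\<^sup>2" "(norm (w - (w \<bullet> v) *\<^sub>R v))\<^sup>2 = (sin \<beta>)\<^sup>2"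
    unfolding power2_norm_eq_inner sn
    by (simp_all add: inner_diff_left inner_diff_right vv inner_commute power2_eq_square)
  have n2: "norm (u - (u \<bullet> v) *\<^sub>R v) = sin \<alpha>" "norm (w - (w \<bullet> v) *\<^sub>R v) = sin \<beta>"
    using n1 ab by (auto simp: power2_eq_iff_nonneg sin_ge_zero)
  have "\<bar>(u - (u \<bullet> v) *\<^sub>R v) \<bullet> (w - (w \<bullet> v) *\<^sub>R v)\<bar> \<le> sin \<alpha> * sin \<beta>"
    using Cauchy_Schwarz_ineq2[of "u - (u \<bullet> v) *\<^sub>R v" "w - (w \<bullet> v) *\<^sub>R v"] n2 by simp
  moreover have "(u - (u \<bullet> v) *\<^sub>R v) \<bullet> (w - (w \<bullet> v) *\<^sub>R v) = u \<bullet> w - cos \<alpha> * cos \<beta>"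
    by (simp add: inner_diff_left inner_diff_right vv inner_commute cs algebra_simps)
  ultimately have le: "cos (\<alpha> + \<beta>) \<le> u \<bullet> w" by (simp add: cos_add)
  have "proj_angle p r = arccos \<bar>u \<bullet> w\<bar>"
    using u w by (simp add: proj_angle_abs[OF nz(1,3)])
  also have "\<dots> \<le> arccos (cos (\<alpha> + \<beta>))"
    using le inner_unit_bounds[OF u(1) w(1)] by (intro arccos_le_arccos) auto
  also have "\<dots> = \<alpha> + \<beta>" using ab by (intro arccos_cos) auto
  finally show ?thesis by (simp add: qr u(4) \<alpha>_def)
qed

lemma proj_angle_eq_0_iff: "proj_angle p q = 0 \<longleftrightarrow> p = q"
proof
  assume 0: "proj_angle p q = 0"
  obtain v where v: "norm v = 1" "q = abs_proj v" using proj_unit_rep by blast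
  obtain u where u: "norm u = 1" "p = abs_proj u" "u \<bullet> v \<ge> 0" "proj_angle p q = arccos (u \<bullet> v)"
    using proj_unit_reps[OF v] by blast
  have "u \<bullet> v = 1" using 0 u inner_unit_bounds[OF u(1) v(1)] by (metis arccos_cos_eq_abs cos_arccos cos_zero)
  then have "(norm (u - v))\<^sup>2 = 0"
    using u(1) v(1) unfolding power2_norm_eq_inner inner_diff_left inner_diff_right
    by (simp add: inner_commute dot_square_norm)
  then show "p = q" using u v by simp
next
  assume "p = q"
  obtain v where v: "norm v = 1" "q = abs_proj v" using proj_unit_rep by blast
  then have "v \<noteq> 0" by auto
  with v \<open>p = q\<close> show "proj_angle p q = 0"
    using proj_angle_abs[of v v] by (simp add: dot_square_norm)
qed

instantiation proj :: (euclidean_space) metric_space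
begin

definition dist_proj :: "'a proj \<Rightarrow> 'a proj \<Rightarrow> real" where
  "dist_proj = proj_angle"

definition uniformity_proj :: "('a proj \<times> 'a proj) filter" where
  "uniformity_proj = (INF e\<in>{0<..}. principal {(x, y). dist x y < e})"

definition open_proj :: "'a proj set \<Rightarrow> bool" where
  "open_proj U \<longleftrightarrow> (\<forall>x\<in>U. \<forall>\<^sub>F (x', y) in uniformity. x' = x \<longrightarrow> y \<in> U)"

instance
proof
  fix x y z :: "'a proj"
  have sym: "proj_angle a b = proj_angle b a" for a b :: "'a proj"
    by transfer (simp add: inner_commute mult.commute)
  show "dist x y = 0 \<longleftrightarrow> x = y" by (simp add: dist_proj_def proj_angle_eq_0_iff)
  show "dist x y \<le> dist x z + dist y z"
    unfolding dist_proj_def using proj_angle_triangle[of x y z] sym[of z y] by simp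
qed (simp_all add: uniformity_proj_def open_proj_def)

end

lemma dist_proj_abs:
  assumes "x \<noteq> 0" "y \<noteq> 0"
  shows "dist (abs_proj x) (abs_proj y) = arccos (\<bar>x \<bullet> y\<bar> / (norm x * norm y))"
  using proj_angle_abs[OF assms] by (simp add: dist_proj_def)

lemma continuous_on_abs_proj: "continuous_on (- {0}) (abs_proj :: 'a::euclidean_space \<Rightarrow> 'a proj)"
proof (unfold continuous_on_def, intro ballI)
  fix x :: 'a assume "x \<in> - {0}"
  then have x: "x \<noteq> 0" by simp
  have ev: "\<forall>\<^sub>F y in at x within - {0}. y \<noteq> 0"
    by (simp add: eventually_at_filter)
  have *: "((\<lambda>y. \<bar>y \<bullet> x\<bar> / (norm y * norm x)) \<longlongrightarrow> \<bar>x \<bullet> x\<bar> / (norm x * norm x)) (at x within - {0})"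
    using x by (intro tendsto_intros) auto
  have "\<bar>x \<bullet> x\<bar> / (norm x * norm x) = 1"
    using x by (simp add: dot_square_norm power2_eq_square)
  note * = *[unfolded this]
  have "((\<lambda>y. arccos (\<bar>y \<bullet> x\<bar> / (norm y * norm x))) \<longlongrightarrow> arccos 1) (at x within - {0})"
  proof (rule continuous_on_tendsto_compose[OF continuous_on_arccos' *])
    show "\<forall>\<^sub>F y in at x within - {0}. \<bar>y \<bullet> x\<bar> / (norm y * norm x) \<in> {-1..1}"
      using ev
    proof eventually_elim
      case (elim y)
      have "\<bar>y \<bullet> x\<bar> / (norm y * norm x) \<le> 1"
        using Cauchy_Schwarz_ineq2[of y x] elim x by (simp add: divide_le_eq_1)
      moreover have "0 \<le> \<bar>y \<bullet> x\<bar> / (norm y * norm x)" by simp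
      ultimately show ?case by (auto intro: order.trans[of _ 0])
    qed
  qed auto
  then have "((\<lambda>y. dist (abs_proj y) (abs_proj x)) \<longlongrightarrow> 0) (at x within - {0})"
    unfolding arccos_1
    by (rule Lim_transform_eventually) (use ev x in \<open>auto elim!: eventually_mono simp: dist_proj_abs\<close>)
  then show "(abs_proj \<longlongrightarrow> abs_proj x) (at x within - {0})"
    by (rule tendsto_dist_iff[THEN iffD2])
qed

text \<open>The Riemannian volume of the angle metric: the volume of a set of lines is \<open>DIM('a) / 2\<close> times
  the Lebesgue measure of the part of the unit ball that the lines fill.\<close>

definition proj_measure :: "'a::euclidean_space proj measure" where
  "proj_measure = scale_measure (ennreal (real DIM('a) / 2))
     (distr (restrict_space lborel (ball 0 1 - {0})) borel abs_proj)"


section \<open>Convex polygons\<close>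

text \<open>A polygon is the list of its vertices; side \<open>i\<close> joins vertex \<open>i\<close> to vertex \<open>i + 1\<close>,
  indices being read modulo the length of the list.\<close>

definition vtx :: "complex list \<Rightarrow> nat \<Rightarrow> complex" where
  "vtx vs i = vs ! (i mod length vs)"

definition side :: "complex list \<Rightarrow> nat \<Rightarrow> complex" where
  "side vs i = vtx vs (Suc i) - vtx vs i"

text \<open>\<open>Im (cnj u * w)\<close> is the determinant of \<open>u\<close> and \<open>w\<close>: every side has all the other vertices
  strictly to its left. So the vertices are in convex position, no internal angle is \<open>pi\<close>,
  and they are listed once around in counterclockwise order.\<close>

definition convex_polygon :: "complex list \<Rightarrow> bool" where
  "convex_polygon vs \<longleftrightarrow> 3 \<le> length vs \<and>
     (\<forall>i<length vs. \<forall>j<length vs. j \<noteq> i \<and> j \<noteq> Suc i mod length vs \<longrightarrow>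
        0 < Im (cnj (side vs i) * (vtx vs j - vtx vs i)))"

definition polygons :: "nat \<Rightarrow> complex list set" where
  "polygons n = {vs. convex_polygon vs \<and> length vs = n}"

section \<open>The moduli space\<close>

text \<open>The orientation-preserving similarities of the plane are the maps \<open>z \<mapsto> a * z + b\<close> with
  \<open>a \<noteq> 0\<close>.\<close>

definition similar_polygons :: "nat \<Rightarrow> (complex list \<times> complex list) set" where
  "similar_polygons n = {(vs, ws). vs \<in> polygons n \<and> ws \<in> polygons n \<and>
     (\<exists>a b. a \<noteq> 0 \<and> ws = map (\<lambda>z. a * z + b) vs)}"

definition moduli :: "nat \<Rightarrow> complex list set set" where
  "moduli n = polygons n // similar_polygons n"

text \<open>The fixed segment to which side \<open>0\<close> is normalised is the one from \<open>0\<close> to \<open>1\<close>.\<close>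

definition normalise :: "complex list \<Rightarrow> complex list" where
  "normalise vs = map (\<lambda>z. (z - vs ! 0) / (vs ! 1 - vs ! 0)) vs"

text \<open>Coordinates \<open>(a : b : c)\<close> of the line \<open>a * x + b * y + c = 0\<close> through two points; for a line
  through a known point \<open>(a : b)\<close> suffices.\<close>

definition line_normal :: "complex \<Rightarrow> complex \<Rightarrow> real \<times> real" where
  "line_normal p q = (- Im (q - p), Re (q - p))"

definition line_coords :: "complex \<Rightarrow> complex \<Rightarrow> real \<times> real \<times> real" where
  "line_coords p q = (- Im (q - p), Re (q - p), Im (q - p) * Re p - Re (q - p) * Im p)"

type_synonym chart_point =
  "(real \<times> real) proj \<times> (nat \<Rightarrow> (real \<times> real \<times> real) proj) \<times> (real \<times> real) proj"

text \<open>The lines of the sides \<open>1\<close> (through \<open>1\<close>), \<open>2, \<dots>, n - 2\<close>, and \<open>n - 1\<close> (through \<open>0\<close>).\<close>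

definition side_lines :: "complex list \<Rightarrow> chart_point" where
  "side_lines vs = (let n = length vs; w = vtx (normalise vs) in
     (abs_proj (line_normal (w 1) (w 2)),
      (\<lambda>i\<in>{2..<n - 1}. abs_proj (line_coords (w i) (w (Suc i)))),
      abs_proj (line_normal (w (n - 1)) (w 0))))"

text \<open>\<open>side_lines\<close> is constant on each class (\<open>moduli_chart_eq\<close> below).\<close>

definition moduli_chart :: "complex list set \<Rightarrow> chart_point" where
  "moduli_chart C = the_elem (side_lines ` C)"

definition chart_dist :: "nat \<Rightarrow> chart_point \<Rightarrow> chart_point \<Rightarrow> real" where
  "chart_dist n = (\<lambda>(p, f, q) (p', f', q').
     sqrt ((dist p p')\<^sup>2 + (\<Sum>i\<in>{2..<n - 1}. (dist (f i) (f' i))\<^sup>2) + (dist q q')\<^sup>2))"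

definition moduli_dist :: "nat \<Rightarrow> complex list set \<Rightarrow> complex list set \<Rightarrow> real" where
  "moduli_dist n C D = chart_dist n (moduli_chart C) (moduli_chart D)"

text \<open>Justified by \<open>Metric_space_moduli\<close> below.\<close>

definition moduli_topology :: "nat \<Rightarrow> complex list set topology" where
  "moduli_topology n = Metric_space.mtopology (moduli n) (moduli_dist n)"

definition chart_measure :: "nat \<Rightarrow> chart_point measure" where
  "chart_measure n = proj_measure \<Otimes>\<^sub>M (\<Pi>\<^sub>M i\<in>{2..<n - 1}. proj_measure) \<Otimes>\<^sub>M proj_measure"

text \<open>The measure of \<open>S\<close> is that of its image under the chart (\<open>emeasure_moduli_measure\<close> below).\<close>

definition moduli_measure :: "nat \<Rightarrow> complex list set measure" where
  "moduli_measure n = measure_of (moduli n)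
     {moduli_chart -` A \<inter> moduli n | A. A \<in> sets (chart_measure n)}
     (\<lambda>S. emeasure (chart_measure n) (moduli_chart ` S))"

section \<open>The slap map\<close>

definition perimeter :: "complex list \<Rightarrow> real" where
  "perimeter vs = (\<Sum>i<length vs. norm (side vs i))"

definition arc_pos :: "complex list \<Rightarrow> nat \<Rightarrow> real" where
  "arc_pos vs i = (\<Sum>j<i. norm (side vs j))"

text \<open>Counterclockwise arc length parametrisation of the boundary, of period \<open>1\<close>, for a polygon
  of perimeter \<open>1\<close>. It identifies \<open>\<real>/\<int>\<close> with the boundary, and the slap map is written below as a
  self-map of the boundary.\<close>

definition bdry_point :: "complex list \<Rightarrow> real \<Rightarrow> complex" where
  "bdry_point vs t = (let i = (LEAST i. frac t < arc_pos vs (Suc i)) in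
     vtx vs i + of_real (frac t - arc_pos vs i) * sgn (side vs i))"

definition bdry :: "complex list \<Rightarrow> complex set" where
  "bdry vs = (\<Union>i<length vs. closed_segment (vtx vs i) (vtx vs (Suc i)))"

text \<open>The inner normal to side \<open>i\<close> is \<open>\<i> * side vs i\<close>, the interior being on the left.\<close>

definition slap_hit :: "complex list \<Rightarrow> complex \<Rightarrow> complex" where
  "slap_hit vs p = (THE q. \<exists>i<length vs. p \<in> open_segment (vtx vs i) (vtx vs (Suc i)) \<and>
     (\<exists>r>0. q = p + of_real r * (\<i> * side vs i) \<and> q \<in> bdry vs \<and>
        (\<forall>r'. 0 < r' \<and> r' < r \<longrightarrow> p + of_real r' * (\<i> * side vs i) \<notin> bdry vs)))"

definition slap :: "complex list \<Rightarrow> complex \<Rightarrow> complex" where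
  "slap vs p =
     (if p \<in> set vs
      then Lim (at_left (inv_into {0..<1} (bdry_point vs) p)) (\<lambda>t. slap_hit vs (bdry_point vs t))
      else slap_hit vs p)"

text \<open>The argument of the quotient is the angle in the counterclockwise sense from the outgoing to the
  incoming side, which lies in \<open>(0, pi)\<close>.\<close>

definition internal_angle :: "complex list \<Rightarrow> nat \<Rightarrow> real" where
  "internal_angle vs i = Arg ((vtx vs (i + length vs - 1) - vtx vs i) / (vtx vs (i + 1) - vtx vs i))"

definition nonacute_vertices :: "complex list \<Rightarrow> complex set" where
  "nonacute_vertices vs = {vtx vs i | i. i < length vs \<and> pi / 2 \<le> internal_angle vs i}"

definition forward_orbit :: "('a \<Rightarrow> 'a) \<Rightarrow> 'a \<Rightarrow> 'a set" where
  "forward_orbit f x = {(f ^^ k) x | k. True}"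

definition periodic_point :: "('a \<Rightarrow> 'a) \<Rightarrow> 'a \<Rightarrow> bool" where
  "periodic_point f x \<longleftrightarrow> (\<exists>k>0. (f ^^ k) x = x)"

definition condition_star :: "complex list \<Rightarrow> bool" where
  "condition_star vs \<longleftrightarrow>
     (\<forall>t. bdry_point vs t \<in> nonacute_vertices vs \<longrightarrow>
        (\<forall>x \<in> {Lim (at_right t) (\<lambda>u. slap vs (bdry_point vs u)),
               Lim (at_left t) (\<lambda>u. slap vs (bdry_point vs u))}.
           \<forall>y \<in> forward_orbit (slap vs) x.
             y \<notin> nonacute_vertices vs \<and> \<not> periodic_point (slap vs) y))"

text \<open>Any two representatives of perimeter \<open>1\<close> differ by a rigid motion, so it does not matter that
  all of them are considered.\<close>

definition moduli_star :: "nat \<Rightarrow> complex list set set" where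
  "moduli_star n = {C \<in> moduli n. \<forall>vs\<in>C. perimeter vs = 1 \<longrightarrow> condition_star vs}"

section \<open>Residual sets\<close>

definition residual_in :: "'a topology \<Rightarrow> 'a set \<Rightarrow> bool" where
  "residual_in X S \<longleftrightarrow> S \<subseteq> topspace X \<and>
     (\<exists>\<G>. countable \<G> \<and> (\<forall>U\<in>\<G>. openin X U \<and> X closure_of U = topspace X) \<and>
        topspace X \<inter> \<Inter>\<G> \<subseteq> S)"

section \<open>The distance and the measure are well defined\<close>

lemma vtx_lt: "i < length vs \<Longrightarrow> vtx vs i = vs ! i"
  by (simp add: vtx_def)

lemma vtx_map: "vs \<noteq> [] \<Longrightarrow> vtx (map f vs) i = f (vtx vs i)"
  by (simp add: vtx_def)

lemma convex_polygon_side_cross: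
  assumes "convex_polygon vs"
  shows "0 < Im (cnj (side vs i) * side vs (Suc i))"
proof -
  define n where "n = length vs"
  have n: "3 \<le> n" using assms by (simp add: convex_polygon_def n_def)
  have m: "side vs i = side vs (i mod n)" "side vs (Suc i) = side vs (Suc (i mod n))"
    by (simp_all add: side_def vtx_def n_def mod_Suc_eq mod_Suc_Suc_eq)
  define k where "k = i mod n"
  have k: "k < n" using n by (simp add: k_def)
  define j where "j = Suc (Suc k) mod n"
  have j: "j < n" "j \<noteq> k" "j \<noteq> Suc k mod n"
    using k n unfolding j_def by (auto simp: mod_if)
  have "0 < Im (cnj (side vs k) * (vtx vs j - vtx vs k))"
    using assms k j by (simp add: convex_polygon_def n_def)
  also have "vtx vs j = vtx vs (Suc (Suc k))" by (simp add: vtx_def j_def n_def)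
  also have "vtx vs (Suc (Suc k)) - vtx vs k = side vs k + side vs (Suc k)" by (simp add: side_def)
  finally show ?thesis by (simp add: m k_def algebra_simps)
qed

lemma convex_polygon_side_nz: "convex_polygon vs \<Longrightarrow> side vs i \<noteq> 0"
  using convex_polygon_side_cross[of vs i] by auto

lemma convex_polygon_nz01:
  assumes "convex_polygon vs"
  shows "vs ! 1 \<noteq> vs ! 0" "vs \<noteq> []"
  using convex_polygon_side_nz[OF assms, of 0] assms
  by (auto simp: side_def vtx_def convex_polygon_def)

lemma convex_polygon_similar:
  assumes "convex_polygon vs" "a \<noteq> 0"
  shows "convex_polygon (map (\<lambda>z. a * z + b) vs)"
proof -
  have ne: "vs \<noteq> []" using assms convex_polygon_nz01 by blast
  have scale: "Im (cnj (a * u) * (a * w)) = (norm a)\<^sup>2 * Im (cnj u * w)" for u w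
  proof -
    have "cnj (a * u) * (a * w) = of_real ((norm a)\<^sup>2) * (cnj u * w)"
      by (simp only: complex_norm_square complex_cnj_mult mult_ac)
    then show ?thesis by (metis Im_complex_of_real Re_complex_of_real add.right_neutral mult_zero_left times_complex.sel(2))
  qed
  have side: "side (map (\<lambda>z. a * z + b) vs) i = a * side vs i" for i
    using ne by (simp add: side_def vtx_map algebra_simps)
  have diff: "vtx (map (\<lambda>z. a * z + b) vs) j - vtx (map (\<lambda>z. a * z + b) vs) i = a * (vtx vs j - vtx vs i)" for i j
    using ne by (simp add: vtx_map algebra_simps)
  show ?thesis
    using assms unfolding convex_polygon_def side diff scale length_map
    by (simp only: zero_less_mult_iff zero_less_power2 norm_eq_zero) simp
qed

lemma equiv_similar_polygons: "equiv (polygons n) (similar_polygons n)"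
proof (rule equivI)
  show "similar_polygons n \<subseteq> polygons n \<times> polygons n" by (auto simp: similar_polygons_def)
  show "refl_on (polygons n) (similar_polygons n)"
  proof (rule refl_onI)
    fix vs assume "vs \<in> polygons n"
    moreover have "vs = map (\<lambda>z. 1 * z + 0) vs" by simp
    ultimately show "(vs, vs) \<in> similar_polygons n"
      unfolding similar_polygons_def using one_neq_zero by blast
  qed
  show "sym (similar_polygons n)"
  proof (rule symI)
    fix vs ws assume "(vs, ws) \<in> similar_polygons n"
    then obtain a b where 1: "vs \<in> polygons n" "ws \<in> polygons n" "a \<noteq> 0" "ws = map (\<lambda>z. a * z + b) vs"
      by (auto simp: similar_polygons_def)
    have "vs = map (\<lambda>z. inverse a * z + (- b / a)) ws"
      using 1(3) unfolding 1(4) by (simp add: o_def field_simps)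
    moreover have "inverse a \<noteq> 0" using 1 by simp
    ultimately show "(ws, vs) \<in> similar_polygons n" using 1(1,2) unfolding similar_polygons_def by blast
  qed
  show "trans (similar_polygons n)"
  proof (rule transI)
    fix us vs ws assume "(us, vs) \<in> similar_polygons n" "(vs, ws) \<in> similar_polygons n"
    then obtain a b c d where 1: "us \<in> polygons n" "ws \<in> polygons n" "a \<noteq> 0" "c \<noteq> 0"
        "vs = map (\<lambda>z. a * z + b) us" "ws = map (\<lambda>z. c * z + d) vs"
      by (auto simp: similar_polygons_def)
    have "ws = map (\<lambda>z. (c * a) * z + (c * b + d)) us"
      unfolding 1(5,6) by (simp add: o_def algebra_simps)
    moreover have "c * a \<noteq> 0" using 1 by simp
    ultimately show "(us, ws) \<in> similar_polygons n" using 1(1,2) unfolding similar_polygons_def by blast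
  qed
qed

lemma normalise_similar:
  assumes "3 \<le> length vs" "a \<noteq> 0"
  shows "normalise (map (\<lambda>z. a * z + b) vs) = normalise vs"
proof -
  have *: "0 < length vs" "1 < length vs" using assms by linarith+
  have "(a * z + b - (a * vs ! 0 + b)) / (a * vs ! 1 + b - (a * vs ! 0 + b)) = (z - vs ! 0) / (vs ! 1 - vs ! 0)" for z
    using assms by (simp flip: right_diff_distrib)
  then show ?thesis using * by (simp add: normalise_def)
qed

lemma similar_normalise:
  assumes "vs \<in> polygons n"
  shows "(vs, normalise vs) \<in> similar_polygons n"
proof -
  have nz: "vs ! 1 - vs ! 0 \<noteq> 0" using assms convex_polygon_nz01 by (auto simp: polygons_def)
  have e: "normalise vs = map (\<lambda>z. inverse (vs ! 1 - vs ! 0) * z + (- vs ! 0 / (vs ! 1 - vs ! 0))) vs"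
    by (simp add: normalise_def diff_divide_distrib divide_inverse algebra_simps)
  have nz': "inverse (vs ! 1 - vs ! 0) \<noteq> 0" using nz by simp
  then have "normalise vs \<in> polygons n"
    using assms convex_polygon_similar[of vs "inverse (vs ! 1 - vs ! 0)" "- vs ! 0 / (vs ! 1 - vs ! 0)"]
    unfolding polygons_def e by simp
  with e nz' assms show ?thesis unfolding similar_polygons_def by blast
qed

lemma side_lines_similar:
  assumes "(vs, ws) \<in> similar_polygons n"
  shows "side_lines vs = side_lines ws"
proof -
  obtain a b where 1: "convex_polygon vs" "a \<noteq> 0" "ws = map (\<lambda>z. a * z + b) vs"
    using assms by (auto simp: similar_polygons_def polygons_def)
  then have "normalise ws = normalise vs" "length ws = length vs"
    using normalise_similar[of vs a b] by (simp_all add: convex_polygon_def)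
  then show ?thesis by (simp add: side_lines_def)
qed

lemma moduli_chart_eq:
  assumes "C \<in> moduli n" "vs \<in> C"
  shows "moduli_chart C = side_lines vs"
proof -
  have "side_lines ws = side_lines vs" if "ws \<in> C" for ws
    using assms that quotient_eq_iff[OF equiv_similar_polygons, of C n C ws vs] side_lines_similar
    unfolding moduli_def by blast
  then have "side_lines ` C = {side_lines vs}" using assms by blast
  then show ?thesis by (simp add: moduli_chart_def)
qed


text \<open>The auxiliary functions below recover the normalised polygon from its lines, through representatives
  of projective points that depend measurably on the point. They show that \<open>moduli_chart\<close> is injective
  with measurable image, so that \<open>moduli_dist\<close> is a metric and \<open>moduli_measure\<close> is a measure.\<close>

lemma moduli_nonempty_class: "C \<in> moduli n \<Longrightarrow> \<exists>vs\<in>C. vs \<in> polygons n"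
  unfolding moduli_def by (metis equiv_similar_polygons in_quotient_imp_non_empty in_quotient_imp_subset subsetD ex_in_conv)

lift_definition proj_col :: "'a::euclidean_space \<Rightarrow> 'a proj \<Rightarrow> 'a"
  is "\<lambda>b y. ((y \<bullet> b) / (y \<bullet> y)) *\<^sub>R y"
  by (auto simp: projrel_iff)

lemma proj_col_abs:
  assumes "y \<noteq> 0"
  shows "proj_col b (abs_proj y) = ((y \<bullet> b) / (y \<bullet> y)) *\<^sub>R y"
  using assms by (intro proj_col.abs_eq) (auto simp: projrel_iff intro!: exI[of _ 1])

lemma dist_proj_col: "dist (proj_col b p) (proj_col b q) \<le> (2 * norm b) * dist p q"
proof -
  obtain v where v: "norm v = 1" "q = abs_proj v" using proj_unit_rep by blast
  obtain u where u: "norm u = 1" "p = abs_proj u" "u \<bullet> v \<ge> 0" "proj_angle p q = arccos (u \<bullet> v)"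
    using proj_unit_reps[OF v] by blast
  have nz: "u \<noteq> 0" "v \<noteq> 0" using u v by auto
  define d where "d = dist p q"
  have d: "u \<bullet> v = cos d"
    using u inner_unit_bounds[OF u(1) v(1)] by (simp add: d_def dist_proj_def)
  have d0: "d \<ge> 0" by (simp add: d_def)
  have vv: "v \<bullet> v = 1" "u \<bullet> u = 1" using u v by (simp_all add: dot_square_norm)
  have "(norm (u - v))\<^sup>2 = 2 - 2 * cos d"
    unfolding power2_norm_eq_inner inner_diff_left inner_diff_right
    by (simp add: vv inner_commute d[symmetric])
  also have "\<dots> = (2 * sin (d / 2))\<^sup>2"
    using cos_double_sin[of "d / 2"] by (simp add: power2_eq_square)
  also have "\<dots> \<le> d\<^sup>2"
  proof -
    have "\<bar>2 * sin (d / 2)\<bar> \<le> \<bar>d\<bar>" using abs_sin_le_one abs_sin_x_le_abs_x[of "d / 2"] by simp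
    then show ?thesis by (rule abs_le_square_iff[THEN iffD1])
  qed
  finally have uv: "norm (u - v) \<le> d" using d0 by (rule power2_le_imp_le)
  have "dist (proj_col b p) (proj_col b q) = norm ((u \<bullet> b) *\<^sub>R u - (v \<bullet> b) *\<^sub>R v)"
    by (simp add: u v proj_col_abs nz vv dist_norm)
  also have "(u \<bullet> b) *\<^sub>R u - (v \<bullet> b) *\<^sub>R v = (u \<bullet> b) *\<^sub>R (u - v) + ((u - v) \<bullet> b) *\<^sub>R v"
    by (simp add: algebra_simps inner_diff_left)
  also have "norm \<dots> \<le> \<bar>u \<bullet> b\<bar> * norm (u - v) + \<bar>(u - v) \<bullet> b\<bar> * norm v"
    by (rule order.trans[OF norm_triangle_ineq]) simp
  also have "\<dots> \<le> norm b * norm (u - v) + (norm (u - v) * norm b) * 1"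
    using Cauchy_Schwarz_ineq2[of u b] Cauchy_Schwarz_ineq2[of "u - v" b] u(1) v(1)
    by (intro add_mono mult_mono) auto
  also have "\<dots> = (2 * norm b) * norm (u - v)" by simp
  also have "\<dots> \<le> (2 * norm b) * d" using uv by (intro mult_left_mono) auto
  finally show ?thesis by (simp add: d_def)
qed

lemma borel_measurable_proj_col [measurable]: "proj_col b \<in> borel_measurable borel"
proof (rule borel_measurable_continuous_onI)
  have "(2 * norm b)-lipschitz_on UNIV (proj_col b)"
    by (rule lipschitz_onI) (auto intro: dist_proj_col)
  then show "continuous_on UNIV (proj_col b)" by (rule lipschitz_on_continuous_on)
qed

fun pivot_rep :: "'a::euclidean_space list \<Rightarrow> 'a proj \<Rightarrow> 'a" where
  "pivot_rep [] q = 0"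
| "pivot_rep (b # bs) q = (if proj_col b q \<bullet> b \<noteq> 0 then proj_col b q else pivot_rep bs q)"

definition proj_rep :: "'a::euclidean_space proj \<Rightarrow> 'a" where
  "proj_rep = pivot_rep (SOME bs. set bs = Basis)"

lemma borel_measurable_proj_rep [measurable]: "proj_rep \<in> borel_measurable borel"
proof -
  have "pivot_rep bs \<in> borel_measurable borel" for bs :: "'a list"
  proof (induction bs)
    case Nil
    have "pivot_rep [] = (\<lambda>q::'a proj. 0)" by auto
    then show ?case by simp
  next
    case (Cons b bs)
    note [measurable] = Cons
    have "pivot_rep (b # bs) = (\<lambda>q. if proj_col b q \<bullet> b \<noteq> 0 then proj_col b q else pivot_rep bs q)"
      by auto
    then show ?case by simp
  qed
  then show ?thesis by (simp add: proj_rep_def)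
qed

lemma proj_rep_abs:
  fixes y :: "'a::euclidean_space"
  assumes "y \<noteq> 0"
  shows "\<exists>c. c \<noteq> 0 \<and> proj_rep (abs_proj y) = c *\<^sub>R y"
proof -
  have *: "\<exists>c. c \<noteq> 0 \<and> pivot_rep bs (abs_proj y) = c *\<^sub>R y" if "\<exists>b\<in>set bs. y \<bullet> b \<noteq> 0" for bs :: "'a list"
    using that
  proof (induction bs)
    case (Cons b bs)
    have e: "proj_col b (abs_proj y) \<bullet> b \<noteq> 0 \<longleftrightarrow> y \<bullet> b \<noteq> 0"
      using assms by (simp add: proj_col_abs)
    show ?case
    proof (cases "y \<bullet> b = 0")
      case True
      then show ?thesis using Cons e by auto
    next
      case False
      then show ?thesis using assms e
        by (auto simp: proj_col_abs intro!: exI[of _ "(y \<bullet> b) / (y \<bullet> y)"])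
    qed
  qed simp
  have "set (SOME bs. set bs = (Basis :: 'a set)) = Basis"
    using finite_list[OF finite_Basis] by (rule someI_ex)
  moreover have "\<exists>b\<in>Basis. y \<bullet> b \<noteq> 0" using assms euclidean_all_zero_iff[of y] by blast
  ultimately show ?thesis unfolding proj_rep_def by (intro *) auto
qed

lemma proj_rep_nz: "proj_rep q \<noteq> 0" and abs_proj_rep: "abs_proj (proj_rep q) = q"
proof -
  obtain y where y: "y \<noteq> 0" "q = abs_proj y" using proj_exists_rep by blast
  then obtain c where c: "c \<noteq> 0" "proj_rep q = c *\<^sub>R y" using proj_rep_abs by blast
  then show *: "proj_rep q \<noteq> 0" using y by simp
  have "projrel y (proj_rep q)" using y c by (auto simp: projrel_iff)
  then show "abs_proj (proj_rep q) = q" using y * by (metis abs_proj_eq_iff)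
qed

lemma abs_proj_eq_rep_iff:
  assumes "y \<noteq> 0"
  shows "abs_proj y = q \<longleftrightarrow> \<bar>y \<bullet> proj_rep q\<bar> = norm y * norm (proj_rep q)"
proof -
  have "abs_proj y = q \<longleftrightarrow> abs_proj y = abs_proj (proj_rep q)" by (simp add: abs_proj_rep)
  also have "\<dots> \<longleftrightarrow> proj_angle (abs_proj y) (abs_proj (proj_rep q)) = 0"
    by (simp add: proj_angle_eq_0_iff)
  also have "\<dots> \<longleftrightarrow> \<bar>y \<bullet> proj_rep q\<bar> / (norm y * norm (proj_rep q)) = 1"
  proof -
    let ?x = "\<bar>y \<bullet> proj_rep q\<bar> / (norm y * norm (proj_rep q))"
    have "?x \<le> 1" "0 \<le> ?x"
      using Cauchy_Schwarz_ineq2[of y "proj_rep q"] assms proj_rep_nz[of q] by (auto simp: divide_le_eq_1)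
    then have "arccos ?x = 0 \<longleftrightarrow> ?x = 1"
      by (metis arccos_1 cos_arccos cos_zero dual_order.trans neg_le_0_iff_le zero_le_one)
    then show ?thesis using proj_angle_abs[OF assms proj_rep_nz[of q]] by simp
  qed
  also have "\<dots> \<longleftrightarrow> \<bar>y \<bullet> proj_rep q\<bar> = norm y * norm (proj_rep q)"
    using assms proj_rep_nz[of q] by (auto simp: field_simps)
  finally show ?thesis .
qed

definition meet :: "real \<times> real \<times> real \<Rightarrow> real \<times> real \<times> real \<Rightarrow> complex" where
  "meet = (\<lambda>(a, b, c) (a', b', c').
     Complex ((b * c' - b' * c) / (a * b' - a' * b)) ((c * a' - c' * a) / (a * b' - a' * b)))"

definition chart_line :: "nat \<Rightarrow> chart_point \<Rightarrow> nat \<Rightarrow> real \<times> real \<times> real" where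
  "chart_line n = (\<lambda>(p, f, q) i.
     if i = 1 then (fst (proj_rep p), snd (proj_rep p), - fst (proj_rep p))
     else if i = n - 1 then (fst (proj_rep q), snd (proj_rep q), 0)
     else proj_rep (f i))"

definition chart_vtx :: "nat \<Rightarrow> chart_point \<Rightarrow> nat \<Rightarrow> complex" where
  "chart_vtx n x i = (if i = 0 then 0 else if i = 1 then 1
     else meet (chart_line n x (i - 1)) (chart_line n x i))"

definition chart_polygon :: "nat \<Rightarrow> chart_point \<Rightarrow> complex list" where
  "chart_polygon n x = map (chart_vtx n x) [0..<n]"

lemma meet_line_coords:
  assumes "c \<noteq> 0" "d \<noteq> 0" "Im (cnj (q - p) * (r - q)) \<noteq> 0"
  shows "meet (c *\<^sub>R line_coords p q) (d *\<^sub>R line_coords q r) = q"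
proof -
  define a b a' b' where "a = Re (q - p)" "b = Im (q - p)" "a' = Re (r - q)" "b' = Im (r - q)"
  have D: "a * b' - a' * b \<noteq> 0" using assms(3) by (simp add: a_b_a'_b'_def algebra_simps)
  have p: "Re p = Re q - a" "Im p = Im q - b" by (simp_all add: a_b_a'_b'_def)
  have D': "- (c * b) * (d * a') - - (d * b') * (c * a) = (c * d) * (a * b' - a' * b)"
    by (simp add: algebra_simps)
  have 1: "c * a * (d * (b' * Re q - a' * Im q)) - d * a' * (c * (b * Re p - a * Im p))
      = Re q * ((c * d) * (a * b' - a' * b))"
    by (simp add: p algebra_simps)
  have 2: "c * (b * Re p - a * Im p) * - (d * b') - d * (b' * Re q - a' * Im q) * - (c * b)
      = Im q * ((c * d) * (a * b' - a' * b))"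
    by (simp add: p algebra_simps)
  have l: "c *\<^sub>R line_coords p q = (- (c * b), c * a, c * (b * Re p - a * Im p))"
    "d *\<^sub>R line_coords q r = (- (d * b'), d * a', d * (b' * Re q - a' * Im q))"
    by (simp_all add: line_coords_def a_b_a'_b'_def right_diff_distrib)
  show ?thesis
    unfolding l meet_def prod.case D' 1 2 using D assms(1,2) by (simp add: complex_eq_iff)
qed

lemma line_normal_nz: "p \<noteq> q \<Longrightarrow> line_normal p q \<noteq> 0"
  and line_coords_nz: "p \<noteq> q \<Longrightarrow> line_coords p q \<noteq> 0"
  by (auto simp: line_normal_def line_coords_def complex_eq_iff zero_prod_def)

lemma normalise_nth:
  assumes "vs \<in> polygons n"
  shows "vtx (normalise vs) 0 = 0" "vtx (normalise vs) 1 = 1" "length (normalise vs) = n"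
    "normalise vs \<in> polygons n"
proof -
  have n: "length vs = n" "3 \<le> n" "vs ! 1 \<noteq> vs ! 0"
    using assms convex_polygon_nz01[of vs] by (auto simp: polygons_def convex_polygon_def)
  then have *: "0 < length vs" "1 < length vs" by auto
  show "vtx (normalise vs) 0 = 0" "vtx (normalise vs) 1 = 1" "length (normalise vs) = n"
    using n * by (simp_all add: normalise_def vtx_def)
  show "normalise vs \<in> polygons n"
    using similar_normalise[OF assms] by (simp add: similar_polygons_def)
qed

lemma chart_polygon_side_lines:
  assumes "vs \<in> polygons n"
  shows "chart_polygon n (side_lines vs) = normalise vs"
proof -
  define ws W x where "ws = normalise vs" and "W = vtx ws" and "x = side_lines vs"
  note ws = normalise_nth[OF assms, folded ws_def]
  have n: "3 \<le> n" "length vs = n" using assms by (auto simp: polygons_def convex_polygon_def)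
  have cross: "Im (cnj (W (Suc i) - W i) * (W (Suc (Suc i)) - W (Suc i))) \<noteq> 0" for i
    using convex_polygon_side_cross[of ws i] ws(4) by (simp add: polygons_def side_def W_def)
  have ne: "W i \<noteq> W (Suc i)" for i
    using convex_polygon_side_nz[of ws i] ws(4) by (simp add: polygons_def side_def W_def)
  have W01: "W 0 = 0" "W 1 = 1" "W n = 0"
    using ws by (simp_all add: W_def vtx_def)
  have line: "\<exists>c. c \<noteq> 0 \<and> chart_line n x i = c *\<^sub>R line_coords (W i) (W (Suc i))"
    if i: "1 \<le> i" "i < n" for i
  proof -
    consider "i = 1" | "i = n - 1" "i \<noteq> 1" | "i \<in> {2..<n - 1}" using i n by force
    then show ?thesis
    proof cases
      case 1
      obtain c where "c \<noteq> 0" "proj_rep (abs_proj (line_normal (W 1) (W 2))) = c *\<^sub>R line_normal (W 1) (W 2)"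
        using proj_rep_abs line_normal_nz ne[of 1] by (metis Suc_1)
      then show ?thesis using 1 W01
        by (auto simp: x_def side_lines_def chart_line_def Let_def line_normal_def line_coords_def
            W_def ws_def n numeral_2_eq_2 intro!: exI[of _ c])
    next
      case 2
      have nn: "Suc (n - 1) = n" using n by simp
      have "W (n - 1) \<noteq> W 0" using ne[of "n - 1"] nn W01 by simp
      then obtain c where "c \<noteq> 0" "proj_rep (abs_proj (line_normal (W (n - 1)) (W 0))) = c *\<^sub>R line_normal (W (n - 1)) (W 0)"
        using proj_rep_abs line_normal_nz by blast
      moreover have "Im (0 - W (n - 1)) * Re (W (n - 1)) - Re (0 - W (n - 1)) * Im (W (n - 1)) = 0" by simp
      ultimately show ?thesis using 2 W01 nn unfolding 2(1) nn W01
        by (auto simp: x_def side_lines_def chart_line_def Let_def line_normal_def line_coords_def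
            W_def[symmetric] ws_def[symmetric] n(2) W01(1) intro!: exI[of _ c])
    next
      case 3
      obtain c where "c \<noteq> 0" "proj_rep (abs_proj (line_coords (W i) (W (Suc i)))) = c *\<^sub>R line_coords (W i) (W (Suc i))"
        using proj_rep_abs line_coords_nz ne by blast
      moreover have "i \<noteq> 1" "i \<noteq> n - 1" using 3 by auto
      ultimately show ?thesis using 3
        by (auto simp: x_def side_lines_def chart_line_def Let_def W_def ws_def n(2) intro!: exI[of _ c])
    qed
  qed
  have "chart_vtx n x i = W i" if i: "i < n" for i
  proof (cases "i \<le> 1")
    case True
    then show ?thesis using W01 by (auto simp: chart_vtx_def le_Suc_eq)
  next
    case False
    then obtain k where k: "i = Suc k" "1 \<le> k" by (cases i) auto
    obtain c d where "c \<noteq> 0" "chart_line n x k = c *\<^sub>R line_coords (W k) (W (Suc k))"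
      "d \<noteq> 0" "chart_line n x i = d *\<^sub>R line_coords (W i) (W (Suc i))"
      using line[of k] line[of i] k i by auto
    then show ?thesis using k meet_line_coords[of c d "W i" "W k" "W (Suc i)"] cross[of k]
      by (simp add: chart_vtx_def)
  qed
  then show ?thesis unfolding chart_polygon_def x_def[symmetric] ws_def[symmetric]
    using ws(3) by (intro nth_equalityI) (auto simp: W_def vtx_lt)
qed

lemma inj_on_moduli_chart: "inj_on moduli_chart (moduli n)"
proof (rule inj_onI)
  fix C D assume CD: "C \<in> moduli n" "D \<in> moduli n" and eq: "moduli_chart C = moduli_chart D"
  obtain vs where vs: "vs \<in> C" "vs \<in> polygons n" using moduli_nonempty_class[OF CD(1)] by blast
  obtain ws where ws: "ws \<in> D" "ws \<in> polygons n" using moduli_nonempty_class[OF CD(2)] by blast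
  have "normalise vs = normalise ws"
    using eq chart_polygon_side_lines[OF vs(2)] chart_polygon_side_lines[OF ws(2)]
    by (simp add: moduli_chart_eq[OF CD(1) vs(1)] moduli_chart_eq[OF CD(2) ws(1)])
  then have "(vs, ws) \<in> similar_polygons n"
    using similar_normalise[OF vs(2)] similar_normalise[OF ws(2)] equiv_similar_polygons[of n]
    by (metis equivE symE transE)
  then show "C = D"
    using CD vs ws quotient_eq_iff[OF equiv_similar_polygons] unfolding moduli_def by blast
qed


lemma space_proj_measure [simp]: "space proj_measure = UNIV"
  and sets_proj_measure [measurable_cong, simp]: "sets proj_measure = sets borel"
  by (simp_all add: proj_measure_def space_scale_measure)

lemma measurable_abs_proj:
  "abs_proj \<in> borel_measurable (restrict_space lborel (ball 0 1 - {0}))"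
proof -
  have "continuous_on (ball 0 1 - {0}) (abs_proj :: 'a \<Rightarrow> 'a proj)"
    by (rule continuous_on_subset[OF continuous_on_abs_proj]) auto
  then have "(abs_proj :: 'a \<Rightarrow> 'a proj) \<in> borel_measurable (restrict_space borel (ball 0 1 - {0}))"
    by (rule borel_measurable_continuous_on_restrict)
  then show ?thesis
    by (simp cong: measurable_cong_sets add: sets_restrict_space_cong[of lborel borel])
qed

lemma emeasure_proj_measure:
  assumes "A \<in> sets borel"
  shows "emeasure (proj_measure :: 'a::euclidean_space proj measure) A =
    ennreal (real DIM('a) / 2) * emeasure lborel {x \<in> ball 0 1 - {0}. abs_proj x \<in> A}"
proof -
  have "emeasure (proj_measure :: 'a proj measure) A = ennreal (real DIM('a) / 2) *
      emeasure (restrict_space lborel (ball 0 1 - {0})) (abs_proj -` A \<inter> (ball 0 1 - {0}))"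
    using assms by (simp add: proj_measure_def emeasure_distr[OF measurable_abs_proj] space_restrict_space)
  also have "emeasure (restrict_space lborel (ball 0 1 - {0 :: 'a})) (abs_proj -` A \<inter> (ball 0 1 - {0}))
      = emeasure lborel (abs_proj -` A \<inter> (ball 0 1 - {0}))"
    by (rule emeasure_restrict_space) auto
  also have "abs_proj -` A \<inter> (ball 0 1 - {0 :: 'a}) = {x \<in> ball 0 1 - {0}. abs_proj x \<in> A}" by auto
  finally show ?thesis .
qed

lemma finite_measure_proj_measure:
  "finite_measure (proj_measure :: 'a::euclidean_space proj measure)"
proof
  have "emeasure lborel (ball 0 1 - {0 :: 'a}) \<le> emeasure lborel (ball (0 :: 'a) 1)"
    by (rule emeasure_mono) auto
  also have "\<dots> < \<infinity>" by (rule emeasure_lborel_ball_finite)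
  finally have "emeasure lborel (ball 0 1 - {0 :: 'a}) < \<infinity>" .
  then show "emeasure (proj_measure :: 'a proj measure) (space proj_measure) \<noteq> \<infinity>"
    by (auto simp: emeasure_proj_measure ennreal_mult_eq_top_iff set_diff_eq conj_ac)
qed

lemma measurable_chart_line_components:
  assumes "3 \<le> n" "1 \<le> i" "i < n"
  shows "(\<lambda>x. fst (chart_line n x i)) \<in> borel_measurable (chart_measure n)"
    and "(\<lambda>x. fst (snd (chart_line n x i))) \<in> borel_measurable (chart_measure n)"
    and "(\<lambda>x. snd (snd (chart_line n x i))) \<in> borel_measurable (chart_measure n)"
proof -
  have fs [measurable]: "(fst :: real \<times> real \<Rightarrow> real) \<in> borel_measurable borel"
    "(snd :: real \<times> real \<Rightarrow> real) \<in> borel_measurable borel"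
    "(fst :: real \<times> real \<times> real \<Rightarrow> real) \<in> borel_measurable borel"
    "(snd :: real \<times> real \<times> real \<Rightarrow> real \<times> real) \<in> borel_measurable borel"
    by (intro borel_measurable_continuous_onI continuous_intros)+
  have f1 [measurable]: "(\<lambda>x. fst x) \<in> borel_measurable (chart_measure n)"
    and f3 [measurable]: "(\<lambda>x. snd (snd x)) \<in> borel_measurable (chart_measure n)"
    unfolding chart_measure_def by measurable
  consider "i = 1" | "i = n - 1" "i \<noteq> 1" | "i \<in> {2..<n - 1}" using assms by force
  then have "(\<lambda>x. fst (chart_line n x i)) \<in> borel_measurable (chart_measure n) \<and>
    (\<lambda>x. fst (snd (chart_line n x i))) \<in> borel_measurable (chart_measure n) \<and>
    (\<lambda>x. snd (snd (chart_line n x i))) \<in> borel_measurable (chart_measure n)"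
  proof cases
    case 1
    then show ?thesis by (auto simp: chart_line_def case_prod_beta)
  next
    case 2
    then show ?thesis by (auto simp: chart_line_def case_prod_beta)
  next
    case 3
    then have [measurable]: "(\<lambda>x. fst (snd x) i) \<in> borel_measurable (chart_measure n)"
      unfolding chart_measure_def by measurable
    have "i \<noteq> 1" "i \<noteq> n - 1" using 3 by auto
    then show ?thesis by (auto simp: chart_line_def case_prod_beta)
  qed
  then show "(\<lambda>x. fst (chart_line n x i)) \<in> borel_measurable (chart_measure n)"
    and "(\<lambda>x. fst (snd (chart_line n x i))) \<in> borel_measurable (chart_measure n)"
    and "(\<lambda>x. snd (snd (chart_line n x i))) \<in> borel_measurable (chart_measure n)" by auto
qed

lemma measurable_chart_vtx:
  assumes "3 \<le> n" "i < n"
  shows "(\<lambda>x. Re (chart_vtx n x i)) \<in> borel_measurable (chart_measure n)"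
    and "(\<lambda>x. Im (chart_vtx n x i)) \<in> borel_measurable (chart_measure n)"
proof -
  have "(\<lambda>x. Re (chart_vtx n x i)) \<in> borel_measurable (chart_measure n) \<and>
    (\<lambda>x. Im (chart_vtx n x i)) \<in> borel_measurable (chart_measure n)"
  proof (cases "i \<le> 1")
    case True
    then show ?thesis by (auto simp: chart_vtx_def le_Suc_eq)
  next
    case False
    then have i: "1 \<le> i - 1" "i - 1 < n" "1 \<le> i" "i < n" "i \<noteq> 0" "i \<noteq> 1" using assms by auto
    note [measurable] = measurable_chart_line_components[OF assms(1) i(1,2)]
      measurable_chart_line_components[OF assms(1) i(3,4)]
    have e: "chart_vtx n x i = meet (chart_line n x (i - 1)) (chart_line n x i)" for x
      using i(5,6) by (simp add: chart_vtx_def)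
    show ?thesis unfolding e meet_def case_prod_beta complex.sel by (intro conjI) measurable
  qed
  then show "(\<lambda>x. Re (chart_vtx n x i)) \<in> borel_measurable (chart_measure n)"
    and "(\<lambda>x. Im (chart_vtx n x i)) \<in> borel_measurable (chart_measure n)" by auto
qed

lemma vtx_chart_polygon: "0 < n \<Longrightarrow> vtx (chart_polygon n x) i = chart_vtx n x (i mod n)"
  by (simp add: vtx_def chart_polygon_def)

lemma moduli_chart_image:
  assumes "3 \<le> n"
  shows "moduli_chart ` moduli n = {x \<in> space (chart_measure n).
     chart_polygon n x \<in> polygons n \<and> side_lines (chart_polygon n x) = x}"
proof (intro equalityI subsetI)
  fix x assume "x \<in> moduli_chart ` moduli n"
  then obtain C where C: "C \<in> moduli n" "x = moduli_chart C" by blast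
  obtain vs where vs: "vs \<in> C" "vs \<in> polygons n" using moduli_nonempty_class[OF C(1)] by blast
  have x: "x = side_lines vs" using C vs moduli_chart_eq by blast
  have "chart_polygon n x = normalise vs" using x chart_polygon_side_lines[OF vs(2)] by simp
  moreover have "side_lines (normalise vs) = x"
    using side_lines_similar[OF similar_normalise[OF vs(2)]] x by simp
  moreover have "length vs = n" using vs by (simp add: polygons_def)
  then have "x \<in> space (chart_measure n)"
    by (simp add: x side_lines_def Let_def chart_measure_def space_pair_measure space_PiM)
  ultimately show "x \<in> {x \<in> space (chart_measure n).
     chart_polygon n x \<in> polygons n \<and> side_lines (chart_polygon n x) = x}"
    using normalise_nth(4)[OF vs(2)] by simp
next
  fix x assume "x \<in> {x \<in> space (chart_measure n).
     chart_polygon n x \<in> polygons n \<and> side_lines (chart_polygon n x) = x}"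
  then have x: "chart_polygon n x \<in> polygons n" "side_lines (chart_polygon n x) = x" by auto
  define C where "C = similar_polygons n `` {chart_polygon n x}"
  have C: "C \<in> moduli n" using x(1) by (simp add: C_def moduli_def quotientI)
  moreover have "chart_polygon n x \<in> C"
    using equiv_class_self[OF equiv_similar_polygons x(1)] by (simp add: C_def)
  ultimately have "moduli_chart C = x" using moduli_chart_eq x(2) by metis
  with C show "x \<in> moduli_chart ` moduli n" by blast
qed

lemma sets_moduli_chart_image:
  assumes n: "3 \<le> n"
  shows "moduli_chart ` moduli n \<in> sets (chart_measure n)"
proof -
  let ?M = "chart_measure n"
  define V where "V x i = chart_vtx n x (i mod n)" for x i
  have VR [measurable]: "(\<lambda>x. Re (V x i)) \<in> borel_measurable ?M"
    and VI [measurable]: "(\<lambda>x. Im (V x i)) \<in> borel_measurable ?M" for i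
    unfolding V_def using n by (auto intro!: measurable_chart_vtx)
  have Vn: "vtx (chart_polygon n x) i = V x i" for x i
    using n by (simp add: vtx_chart_polygon V_def)
  have len: "length (chart_polygon n x) = n" for x by (simp add: chart_polygon_def)
  define P where "P x \<longleftrightarrow> (\<forall>i<n. \<forall>j<n. j \<noteq> i \<and> j \<noteq> Suc i mod n \<longrightarrow>
        0 < Re (V x (Suc i)) * Im (V x j) - Re (V x (Suc i)) * Im (V x i) - Re (V x i) * Im (V x j)
          - Im (V x (Suc i)) * Re (V x j) + Im (V x (Suc i)) * Re (V x i) + Im (V x i) * Re (V x j))" for x
  have P: "chart_polygon n x \<in> polygons n \<longleftrightarrow> P x" for x
    unfolding polygons_def convex_polygon_def P_def mem_Collect_eq len side_def Vn
    using n by (simp add: algebra_simps)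
  have P_meas [measurable]: "Measurable.pred ?M P" unfolding P_def by measurable
  define Q where "Q x \<longleftrightarrow>
     \<bar>line_normal (V x 1) (V x 2) \<bullet> proj_rep (fst x)\<bar> = norm (line_normal (V x 1) (V x 2)) * norm (proj_rep (fst x)) \<and>
     (\<forall>i\<in>{2..<n - 1}. \<bar>line_coords (V x i) (V x (Suc i)) \<bullet> proj_rep (fst (snd x) i)\<bar> =
        norm (line_coords (V x i) (V x (Suc i))) * norm (proj_rep (fst (snd x) i))) \<and>
     \<bar>line_normal (V x (n - 1)) (V x 0) \<bullet> proj_rep (snd (snd x))\<bar> =
        norm (line_normal (V x (n - 1)) (V x 0)) * norm (proj_rep (snd (snd x)))" for x
  have Q: "side_lines (chart_polygon n x) = x \<longleftrightarrow> Q x" if x: "x \<in> space ?M" "P x" for x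
  proof -
    obtain p f q where x3: "x = (p, f, q)" by (cases x)
    have c: "convex_polygon (chart_polygon n x)" using P[of x] x(2) by (simp add: polygons_def)
    have ne: "V x i \<noteq> V x (Suc i)" for i
      using convex_polygon_side_nz[OF c, of i] by (simp add: side_def Vn)
    have ne': "V x 1 \<noteq> V x 2" "V x (n - 1) \<noteq> V x 0"
      using ne[of 1] ne[of "n - 1"] n by (auto simp: numeral_2_eq_2 V_def)
    have "chart_polygon n x ! 0 = 0" "chart_polygon n x ! 1 = 1"
      using n by (auto simp: chart_polygon_def chart_vtx_def)
    then have norm: "normalise (chart_polygon n x) = chart_polygon n x" by (simp add: normalise_def)
    have f: "f \<in> extensional {2..<n - 1}"
      using x by (simp add: x3 chart_measure_def space_pair_measure space_PiM PiE_def)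
    have "side_lines (chart_polygon n x) = x \<longleftrightarrow>
       abs_proj (line_normal (V x 1) (V x 2)) = p \<and>
       (\<lambda>i\<in>{2..<n - 1}. abs_proj (line_coords (V x i) (V x (Suc i)))) = f \<and>
       abs_proj (line_normal (V x (n - 1)) (V x 0)) = q"
      unfolding side_lines_def Let_def norm len Vn unfolding x3 by simp
    also have "(\<lambda>i\<in>{2..<n - 1}. abs_proj (line_coords (V x i) (V x (Suc i)))) = f \<longleftrightarrow>
       (\<forall>i\<in>{2..<n - 1}. abs_proj (line_coords (V x i) (V x (Suc i))) = f i)"
      using f by (auto simp: fun_eq_iff restrict_def extensional_def)
    finally show ?thesis
      unfolding abs_proj_eq_rep_iff[OF line_normal_nz[OF ne'(1)]] abs_proj_eq_rep_iff[OF line_normal_nz[OF ne'(2)]]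
        abs_proj_eq_rep_iff[OF line_coords_nz[OF ne]] Q_def
      by (simp add: x3)
  qed
  have fs: "(fst :: real \<times> real \<Rightarrow> real) \<in> borel_measurable borel"
    "(snd :: real \<times> real \<Rightarrow> real) \<in> borel_measurable borel"
    "(fst :: real \<times> real \<times> real \<Rightarrow> real) \<in> borel_measurable borel"
    "(snd :: real \<times> real \<times> real \<Rightarrow> real \<times> real) \<in> borel_measurable borel"
    by (intro borel_measurable_continuous_onI continuous_intros)+
  have f1 [measurable]: "(\<lambda>x. fst x) \<in> borel_measurable ?M"
    and f3 [measurable]: "(\<lambda>x. snd (snd x)) \<in> borel_measurable ?M"
    unfolding chart_measure_def by measurable
  have f2 [measurable]: "(\<lambda>x. fst (snd x) i) \<in> borel_measurable ?M" if "i \<in> {2..<n - 1}" for i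
    using that unfolding chart_measure_def by measurable
  have m2: "Measurable.pred ?M (\<lambda>x. \<bar>line_normal (V x i) (V x j) \<bullet> proj_rep (g x)\<bar>
      = norm (line_normal (V x i) (V x j)) * norm (proj_rep (g x)))"
    if g: "g \<in> borel_measurable ?M" for g i j
  proof -
    have r: "(\<lambda>x. proj_rep (g x)) \<in> borel_measurable ?M"
      using measurable_compose[OF g borel_measurable_proj_rep] .
    note comps = measurable_compose[OF r borel_measurable_norm] measurable_compose[OF r fs(1)] measurable_compose[OF r fs(2)]
    show ?thesis
      unfolding line_normal_def inner_prod_def norm_Pair inner_real_def fst_conv snd_conv minus_complex.sel
        uminus_complex.sel real_norm_def
        pred_def
      by (intro borel_measurable_eq borel_measurable_abs borel_measurable_add borel_measurable_diff
          borel_measurable_times borel_measurable_uminus borel_measurable_power VR VI comps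
          measurable_compose[OF _ borel_measurable_sqrt])
  qed
  have m3: "Measurable.pred ?M (\<lambda>x. \<bar>line_coords (V x i) (V x j) \<bullet> proj_rep (g x)\<bar>
      = norm (line_coords (V x i) (V x j)) * norm (proj_rep (g x)))"
    if g: "g \<in> borel_measurable ?M" for g i j
  proof -
    have r: "(\<lambda>x. proj_rep (g x)) \<in> borel_measurable ?M"
      using measurable_compose[OF g borel_measurable_proj_rep] .
    note r' = measurable_compose[OF r fs(4)]
    note comps = measurable_compose[OF r borel_measurable_norm] measurable_compose[OF r fs(3)]
      measurable_compose[OF r' fs(1)] measurable_compose[OF r' fs(2)]
    show ?thesis
      unfolding line_coords_def inner_prod_def norm_Pair inner_real_def fst_conv snd_conv minus_complex.sel
        uminus_complex.sel real_norm_def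
        pred_def
      by (intro borel_measurable_eq borel_measurable_abs borel_measurable_add borel_measurable_diff
          borel_measurable_times borel_measurable_uminus borel_measurable_power VR VI comps
          measurable_compose[OF _ borel_measurable_sqrt])
  qed
  have Q_meas [measurable]: "Measurable.pred ?M Q"
    unfolding Q_def
    by (intro pred_intros_logic pred_intros_finite m2 m3 f1 f2 f3 finite_atLeastLessThan) auto
  have "moduli_chart ` moduli n = {x \<in> space ?M. P x \<and> Q x}"
    unfolding moduli_chart_image[OF n] using P Q by blast
  also have "\<dots> \<in> sets ?M" by measurable
  finally show ?thesis .
qed

lemma Metric_space_moduli: "Metric_space (moduli n) (moduli_dist n)"
proof
  fix C D E assume CD: "C \<in> moduli n" "D \<in> moduli n"
  obtain p f q where x: "moduli_chart C = (p, f, q)" by (cases "moduli_chart C")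
  obtain p' f' q' where y: "moduli_chart D = (p', f', q')" by (cases "moduli_chart D")
  have ext: "snd' \<in> extensional {2..<n - 1}" if D: "D \<in> moduli n" "moduli_chart D = (a, snd', b)" for D a b snd'
  proof -
    obtain vs where "vs \<in> D" "vs \<in> polygons n" using moduli_nonempty_class[OF D(1)] by blast
    then show ?thesis using moduli_chart_eq[OF D(1)] D(2)
      by (auto simp: side_lines_def Let_def polygons_def)
  qed
  have "moduli_dist n C D = 0 \<longleftrightarrow> p = p' \<and> (\<forall>i\<in>{2..<n - 1}. f i = f' i) \<and> q = q'"
    by (simp add: moduli_dist_def chart_dist_def x y add_nonneg_eq_0_iff sum_nonneg sum_nonneg_eq_0_iff conj_assoc)
  also have "\<dots> \<longleftrightarrow> moduli_chart C = moduli_chart D"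
    using ext[OF CD(1) x] ext[OF CD(2) y] by (auto simp: x y intro: extensionalityI)
  also have "\<dots> \<longleftrightarrow> C = D" using inj_on_moduli_chart CD by (auto dest: inj_onD)
  finally show "moduli_dist n C D = 0 \<longleftrightarrow> C = D" .
next
  fix C D E
  have eq: "chart_dist n (p, f, q) (p', f', q') =
      sqrt ((dist p p')\<^sup>2 + (sqrt ((L2_set (\<lambda>i. dist (f i) (f' i)) {2..<n - 1})\<^sup>2 + (dist q q')\<^sup>2))\<^sup>2)"
    for p f q p' f' q'
    by (simp add: chart_dist_def L2_set_def sum_nonneg add.assoc)
  have mono: "sqrt (a\<^sup>2 + b\<^sup>2) \<le> sqrt (c\<^sup>2 + d\<^sup>2)" if "0 \<le> a" "a \<le> c" "0 \<le> b" "b \<le> d" for a b c d :: real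
    using that by (intro real_sqrt_le_mono add_mono power_mono) auto
  have "chart_dist n x z \<le> chart_dist n x y + chart_dist n y z" for x y z
  proof -
    obtain p f q p' f' q' p'' f'' q'' where
      e: "x = (p, f, q)" "y = (p', f', q')" "z = (p'', f'', q'')" by (cases x; cases y; cases z)
    let ?S = "\<lambda>f g. L2_set (\<lambda>i. dist (f i) (g i)) {2..<n - 1}"
    have S: "?S f f'' \<le> ?S f f' + ?S f' f''"
      by (rule order.trans[OF L2_set_mono L2_set_triangle_ineq]) (auto intro: dist_triangle)
    have "sqrt ((?S f f'')\<^sup>2 + (dist q q'')\<^sup>2) \<le> sqrt ((?S f f' + ?S f' f'')\<^sup>2 + (dist q q' + dist q' q'')\<^sup>2)"
      by (intro mono S dist_triangle) (auto simp: L2_set_nonneg)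
    also have "\<dots> \<le> sqrt ((?S f f')\<^sup>2 + (dist q q')\<^sup>2) + sqrt ((?S f' f'')\<^sup>2 + (dist q' q'')\<^sup>2)"
      by (rule real_sqrt_sum_squares_triangle_ineq)
    finally have "chart_dist n x z \<le> sqrt ((dist p p' + dist p' p'')\<^sup>2 +
        (sqrt ((?S f f')\<^sup>2 + (dist q q')\<^sup>2) + sqrt ((?S f' f'')\<^sup>2 + (dist q' q'')\<^sup>2))\<^sup>2)"
      unfolding e eq by (intro mono dist_triangle) auto
    also have "\<dots> \<le> chart_dist n x y + chart_dist n y z"
      unfolding e eq by (rule real_sqrt_sum_squares_triangle_ineq)
    finally show ?thesis .
  qed
  then show "moduli_dist n C E \<le> moduli_dist n C D + moduli_dist n D E" by (simp add: moduli_dist_def)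
qed (auto simp: moduli_dist_def chart_dist_def case_prod_beta dist_commute intro!: real_sqrt_ge_zero add_nonneg_nonneg sum_nonneg)

lemma sets_moduli_measure:
  "sets (moduli_measure n) = {moduli_chart -` A \<inter> moduli n | A. A \<in> sets (chart_measure n)}"
  and space_moduli_measure: "space (moduli_measure n) = moduli n"
proof -
  let ?S = "{moduli_chart -` A \<inter> moduli n | A. A \<in> sets (chart_measure n)}"
  have chart: "moduli_chart \<in> moduli n \<rightarrow> space (chart_measure n)"
  proof
    fix C assume C: "C \<in> moduli n"
    then obtain vs where vs: "vs \<in> C" "vs \<in> polygons n" using moduli_nonempty_class by blast
    then show "moduli_chart C \<in> space (chart_measure n)"
      unfolding moduli_chart_eq[OF C vs(1)]
      by (simp add: side_lines_def Let_def chart_measure_def space_pair_measure space_PiM polygons_def)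
  qed
  have S: "?S = sets (vimage_algebra (moduli n) moduli_chart (chart_measure n))"
    using sets_vimage_algebra2[OF chart] by simp
  have sub: "?S \<subseteq> Pow (moduli n)" by auto
  show "sets (moduli_measure n) = ?S"
    unfolding moduli_measure_def sets_measure_of[OF sub] unfolding S
    by (metis sets.sigma_sets_eq space_vimage_algebra)
  show "space (moduli_measure n) = moduli n"
    unfolding moduli_measure_def by (rule space_measure_of[OF sub])
qed

lemma emeasure_moduli_measure:
  assumes n: "3 \<le> n" and S: "S \<in> sets (moduli_measure n)"
  shows "emeasure (moduli_measure n) S = emeasure (chart_measure n) (moduli_chart ` S)"
proof (rule emeasure_measure_of[OF moduli_measure_def _ _ _ S])
  have im: "moduli_chart ` T \<in> sets (chart_measure n)" if T: "T \<in> sets (moduli_measure n)" for T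
  proof -
    obtain A where A: "A \<in> sets (chart_measure n)" "T = moduli_chart -` A \<inter> moduli n"
      using T unfolding sets_moduli_measure by blast
    then have "moduli_chart ` T = A \<inter> moduli_chart ` moduli n" by auto
    then show ?thesis using A sets_moduli_chart_image[OF n] by auto
  qed
  show "positive (sets (moduli_measure n)) (\<lambda>S. emeasure (chart_measure n) (moduli_chart ` S))"
    by (simp add: positive_def)
  show "countably_additive (sets (moduli_measure n)) (\<lambda>S. emeasure (chart_measure n) (moduli_chart ` S))"
  proof (rule countably_additiveI)
    fix F :: "nat \<Rightarrow> _" assume F: "range F \<subseteq> sets (moduli_measure n)" "disjoint_family F"
    have sub: "F i \<subseteq> moduli n" for i using F(1) unfolding sets_moduli_measure by blast
    have "disjoint_family (\<lambda>i. moduli_chart ` F i)"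
      unfolding disjoint_family_on_def
    proof (intro ballI impI)
      fix i j :: nat assume "i \<noteq> j"
      then have "F i \<inter> F j = {}" using F(2) by (auto simp: disjoint_family_on_def)
      then show "moduli_chart ` F i \<inter> moduli_chart ` F j = {}"
        using inj_on_image_Int[OF inj_on_moduli_chart sub sub, of i j] by simp
    qed
    then have "(\<Sum>i. emeasure (chart_measure n) (moduli_chart ` F i)) =
        emeasure (chart_measure n) (\<Union>i. moduli_chart ` F i)"
      using im F(1) by (intro suminf_emeasure) auto
    then show "(\<Sum>i. emeasure (chart_measure n) (moduli_chart ` F i)) =
        emeasure (chart_measure n) (moduli_chart ` \<Union> (range F))"
      by (simp add: image_UN)
  qed
qed auto

end

(* A point of the orbit of a vertex is obtained by following an itinerary of sides: in homogeneous
   coordinates it is a polynomial in the coordinates of the side lines, homogeneous in each line. As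
   long as such a point lies on no third side line, and no two points reached from different sides coincide,
   Condition (star) holds: the orbit never meets a vertex, and a first coincidence of two points
   could be traced back to the starting vertex. So one has to avoid the zeros of countably many polynomials.

   None of them vanishes identically. The dynamics only involves 1 / cos and tan of the angles
   between lines; for imaginary angles these become 1 / cosh and tanh, so that for widely separated
   lines tangent to a conic every slap is a strong contraction, and the sign of the position reached on a
   line depends only on which of the last two lines is larger. Choosing the order of the lines suitably gives
   opposite signs to the two positions that are to be distinguished. Such a complex configuration can be
   moved into normalised position.

   Hence each zero set is closed, is null by Fubini, and has dense complement because
   a polynomial restricted to a line has finitely many zeros. *)
theory Submission
  imports Defs "HOL-Computational_Algebra.Polynomial"
begin

section \<open>Polynomial functions of line configurations\<close>

text \<open>The polynomials make sense for arbitrary complex lines and for every combinatorial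
  itinerary, realised by a polygon or not. So a witness of nonvanishing need be neither real nor
  convex, and this freedom is what makes long itineraries tractable. For real lines tangent to the
  unit circle, let r be the signed distance from the point of tangency. A slap to the tangent turned
  by an angle \<alpha> replaces r by r / cos \<alpha> + tan \<alpha>. The factor 1 / cos \<alpha>
  expands, so the result depends on the whole past. For \<alpha> = \<i> \<delta> and r replaced by -
  \<i> r the rule is r / cosh \<delta> - tanh \<delta>, and for large \<delta> only the last step
  counts. The parameter h = exp y turns these formulas into rational ones. Orthogonal pairs of sides
  are avoided as well, so that no slap divides by 0. Two coincidences are left to geometry. A point
  is off the line that it has just left, having moved a positive distance along the normal. Equal
  points that came from the same side were already equal one step earlier.\<close>

type_synonym ctriple = "complex \<times> complex \<times> complex"

text \<open>Each property of polynomials that is used is an induction over these rules: the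
  restriction to a line is a univariate polynomial, limits and measurability pass through, and
  polynomial maps may be substituted.\<close>

inductive polyfun :: "((nat \<Rightarrow> ctriple) \<Rightarrow> complex) \<Rightarrow> bool" where
  const: "polyfun (\<lambda>l. c)"
| c1: "polyfun (\<lambda>l. fst (l i))"
| c2: "polyfun (\<lambda>l. fst (snd (l i)))"
| c3: "polyfun (\<lambda>l. snd (snd (l i)))"
| add: "polyfun F \<Longrightarrow> polyfun G \<Longrightarrow> polyfun (\<lambda>l. F l + G l)"
| mult: "polyfun F \<Longrightarrow> polyfun G \<Longrightarrow> polyfun (\<lambda>l. F l * G l)"

lemma polyfun_diff:
  assumes "polyfun F" "polyfun G"
  shows "polyfun (\<lambda>l. F l - G l)"
  using polyfun.add[OF assms(1) polyfun.mult[OF polyfun.const[of "- 1"] assms(2)]] by simp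

lemma polyfun_compose:
  assumes "polyfun F" "\<And>i. polyfun (\<lambda>l. fst (E l i))" "\<And>i. polyfun (\<lambda>l. fst (snd (E l i)))"
    "\<And>i. polyfun (\<lambda>l. snd (snd (E l i)))"
  shows "polyfun (\<lambda>l. F (E l))"
  using assms(1) by induction (auto intro: polyfun.intros assms)

lemma polyfun_line:
  assumes "polyfun F"
  shows "\<exists>p. \<forall>t. F (\<lambda>i. (fst (x i) + t * fst (y i), fst (snd (x i)) + t * fst (snd (y i)),
    snd (snd (x i)) + t * snd (snd (y i)))) = poly p t"
    (is "\<exists>p. \<forall>t. F (?L t) = poly p t")
  using assms
proof induction
  case (const c)
  show ?case by (rule exI[of _ "[:c:]"]) simp
next
  case (c1 i)
  show ?case by (rule exI[of _ "[:fst (x i), fst (y i):]"]) simp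
next
  case (c2 i)
  show ?case by (rule exI[of _ "[:fst (snd (x i)), fst (snd (y i)):]"]) simp
next
  case (c3 i)
  show ?case by (rule exI[of _ "[:snd (snd (x i)), snd (snd (y i)):]"]) simp
next
  case (add F G)
  then obtain p q where "\<And>t. F (?L t) = poly p t" "\<And>t. G (?L t) = poly q t" by blast
  then show ?case by (intro exI[of _ "p + q"]) simp
next
  case (mult F G)
  then obtain p q where "\<And>t. F (?L t) = poly p t" "\<And>t. G (?L t) = poly q t" by blast
  then show ?case by (intro exI[of _ "p * q"]) simp
qed

lemma polyfun_tendsto:
  assumes "polyfun F" "\<And>i. ((\<lambda>u. x u i) \<longlongrightarrow> y i) G"
  shows "((\<lambda>u. F (x u)) \<longlongrightarrow> F y) G"
  using assms(1) by induction (intro tendsto_intros assms(2); assumption)+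

definition creal :: "real \<times> real \<times> real \<Rightarrow> ctriple" where
  "creal = (\<lambda>(a, b, c). (of_real a, of_real b, of_real c))"

lemma creal_sel [simp]: "fst (creal y) = of_real (fst y)" "fst (snd (creal y)) = of_real (fst (snd y))"
  "snd (snd (creal y)) = of_real (snd (snd y))"
  by (auto simp: creal_def split: prod.splits)

lemma tendsto_creal: "(f \<longlongrightarrow> y) F \<Longrightarrow> ((\<lambda>u. creal (f u)) \<longlongrightarrow> creal y) F"
  unfolding creal_def case_prod_beta by (intro tendsto_intros)

lemma polyfun_real_line:
  assumes "polyfun F"
  shows "\<exists>p. \<forall>t. F (\<lambda>i. creal (x i + t *\<^sub>R y i)) = poly p (of_real t)"
proof -
  obtain p where p: "\<And>t. F (\<lambda>i. (fst (creal (x i)) + t * fst (creal (y i)),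
    fst (snd (creal (x i))) + t * fst (snd (creal (y i))),
    snd (snd (creal (x i))) + t * snd (snd (creal (y i))))) = poly p t"
    using polyfun_line[OF assms, of "\<lambda>i. creal (x i)" "\<lambda>i. creal (y i)"] by blast
  have "creal (x i + t *\<^sub>R y i) = (fst (creal (x i)) + of_real t * fst (creal (y i)),
    fst (snd (creal (x i))) + of_real t * fst (snd (creal (y i))),
    snd (snd (creal (x i))) + of_real t * snd (snd (creal (y i))))" for i t
    by (simp add: creal_def case_prod_beta)
  then have "F (\<lambda>i. creal (x i + t *\<^sub>R y i)) = poly p (of_real t)" for t
    using p[of "of_real t"] by simp
  then show ?thesis by blast
qed

lemma finite_real_roots:
  fixes p :: "complex poly"
  assumes "p \<noteq> 0"
  shows "finite {t :: real. poly p (of_real t) = 0}"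
proof (rule finite_imageD)
  show "finite (complex_of_real ` {t. poly p (of_real t) = 0})"
    by (rule finite_subset[OF _ poly_roots_finite[OF assms]]) auto
qed (simp add: inj_on_def)

text \<open>A complex witness \<open>x + \<i> y\<close> lies on the complexification of the real line through \<open>x\<close> in
  direction \<open>y\<close>.\<close>

lemma polyfun_real_witness:
  assumes "polyfun F" "F w \<noteq> 0"
  shows "\<exists>r. F (\<lambda>i. creal (r i)) \<noteq> 0"
proof -
  define R where "R = (\<lambda>(f :: complex \<Rightarrow> real) (i::nat). (f (fst (w i)), f (fst (snd (w i))), f (snd (snd (w i)))))"
  obtain p where p: "\<And>t. F (\<lambda>i. (fst (creal (R Re i)) + t * fst (creal (R Im i)),
    fst (snd (creal (R Re i))) + t * fst (snd (creal (R Im i))),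
    snd (snd (creal (R Re i))) + t * snd (snd (creal (R Im i))))) = poly p t"
    using polyfun_line[OF assms(1), of "\<lambda>i. creal (R Re i)" "\<lambda>i. creal (R Im i)"] by blast
  have "w = (\<lambda>i. (fst (creal (R Re i)) + \<i> * fst (creal (R Im i)),
    fst (snd (creal (R Re i))) + \<i> * fst (snd (creal (R Im i))),
    snd (snd (creal (R Re i))) + \<i> * snd (snd (creal (R Im i)))))"
    by (simp add: R_def fun_eq_iff prod_eq_iff complex_eq_iff)
  then have "poly p \<i> \<noteq> 0" using p[of \<i>] assms(2) by simp
  then have "finite {t :: real. poly p (of_real t) = 0}" by (intro finite_real_roots) auto
  then obtain t :: real where t: "poly p (of_real t) \<noteq> 0"
    using ex_new_if_finite[OF infinite_UNIV_char_0] by blast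
  have "(\<lambda>i. creal (R Re i + t *\<^sub>R R Im i)) = (\<lambda>i. (fst (creal (R Re i)) + of_real t * fst (creal (R Im i)),
    fst (snd (creal (R Re i))) + of_real t * fst (snd (creal (R Im i))),
    snd (snd (creal (R Re i))) + of_real t * snd (snd (creal (R Im i)))))"
    by (simp add: creal_def case_prod_beta)
  then have "F (\<lambda>i. creal (R Re i + t *\<^sub>R R Im i)) \<noteq> 0" using p[of "of_real t"] t by simp
  then show ?thesis by (rule exI[where x = "\<lambda>i. R Re i + t *\<^sub>R R Im i"])
qed

section \<open>Tracking a point along an itinerary\<close>

fun meet3 :: "ctriple \<Rightarrow> ctriple \<Rightarrow> ctriple" where
  "meet3 (a, b, c) (a', b', c') = (b * c' - b' * c, c * a' - c' * a, a * b' - a' * b)"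

text \<open>For \<open>z = 1\<close>, a point \<open>X\<close> leaves the line \<open>l\<close>
  along its normal \<open>(a, b)\<close> and reaches the line \<open>m\<close> at
  \<open>X + r (a, b)\<close>, where \<open>r = - dot3 X m / dotn l m\<close>. Clearing the
  denominator by \<open>- dotn l m\<close> gives this formula. The orientation of the ray and the
  order of the hits are not recorded; the itinerary prescribes the line that is reached.\<close>

fun slap_step :: "ctriple \<Rightarrow> ctriple \<Rightarrow> ctriple \<Rightarrow> ctriple" where
  "slap_step (a, b, c) (a', b', c') (x, y, z) =
    ((x * a' + y * b' + z * c') * a - (a * a' + b * b') * x,
     (x * a' + y * b' + z * c') * b - (a * a' + b * b') * y,
     - (a * a' + b * b') * z)"

fun dot3 :: "ctriple \<Rightarrow> ctriple \<Rightarrow> complex" where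
  "dot3 (a, b, c) (x, y, z) = a * x + b * y + c * z"

fun dotn :: "ctriple \<Rightarrow> ctriple \<Rightarrow> complex" where
  "dotn (a, b, c) (x, y, z) = a * x + b * y"

text \<open>The start is the vertex where the lines \<open>is 0\<close> and \<open>b\<close> meet.
  Homogeneous coordinates spare a case distinction: a slap between orthogonal lines just gives the
  third coordinate 0.\<close>

fun track :: "(nat \<Rightarrow> ctriple) \<Rightarrow> nat \<Rightarrow> (nat \<Rightarrow> nat) \<Rightarrow> nat \<Rightarrow> ctriple" where
  "track l b is 0 = meet3 (l (is 0)) (l b)"
| "track l b is (Suc k) = slap_step (l (is k)) (l (is (Suc k))) (track l b is k)"

lemma meet3_sel: "meet3 l m = (fst (snd l) * snd (snd m) - fst (snd m) * snd (snd l),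
    snd (snd l) * fst m - snd (snd m) * fst l, fst l * fst (snd m) - fst m * fst (snd l))"
  by (cases l; cases m) auto

lemma slap_step_sel: "slap_step l m X = (dot3 X m * fst l - dotn l m * fst X,
     dot3 X m * fst (snd l) - dotn l m * fst (snd X), - dotn l m * snd (snd X))"
  by (cases l; cases m; cases X) auto

lemma dot3_sel: "dot3 l X = fst l * fst X + fst (snd l) * fst (snd X) + snd (snd l) * snd (snd X)"
  and dotn_sel: "dotn l X = fst l * fst X + fst (snd l) * fst (snd X)"
  by (cases l; cases X; auto)+

lemma polyfun_uminus: "polyfun F \<Longrightarrow> polyfun (\<lambda>l. - F l)"
  using polyfun.mult[OF polyfun.const[of "- 1"]] by simp

lemmas polyfun_intros = polyfun.intros polyfun_diff polyfun_uminus

lemma polyfun_track: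
  "polyfun (\<lambda>l. fst (track l b is k)) \<and> polyfun (\<lambda>l. fst (snd (track l b is k))) \<and>
   polyfun (\<lambda>l. snd (snd (track l b is k)))"
proof (induction k)
  case 0
  show ?case by (auto simp: meet3_sel intro!: polyfun_intros)
next
  case (Suc k)
  then show ?case by (auto simp: slap_step_sel dot3_sel dotn_sel intro!: polyfun_intros)
qed

fun scale3 :: "complex \<Rightarrow> ctriple \<Rightarrow> ctriple" where
  "scale3 c (x, y, z) = (c * x, c * y, c * z)"

lemma scale3_sel [simp]: "fst (scale3 c X) = c * fst X" "fst (snd (scale3 c X)) = c * fst (snd X)"
  "snd (snd (scale3 c X)) = c * snd (snd X)"
  by (cases X; simp)+

text \<open>All three coordinates have the same degree in each single line, so rescaling the lines
  rescales the whole point. This gives the zero sets a meaning for projective line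
  coordinates.\<close>

lemma track_scale:
  assumes "\<And>i. c i \<noteq> 0"
  shows "\<exists>d. d \<noteq> 0 \<and> track (\<lambda>i. scale3 (c i) (l i)) b is k = scale3 d (track l b is k)"
proof (induction k)
  case 0
  show ?case using assms
    by (intro exI[of _ "c (is 0) * c b"]) (auto simp: meet3_sel prod_eq_iff algebra_simps)
next
  case (Suc k)
  then obtain d where "d \<noteq> 0" "track (\<lambda>i. scale3 (c i) (l i)) b is k = scale3 d (track l b is k)" by blast
  then show ?case using assms
    by (intro exI[of _ "c (is k) * c (is (Suc k)) * d"])
      (auto simp: slap_step_sel dot3_sel dotn_sel prod_eq_iff algebra_simps)
qed

text \<open>The effect of the homothety \<open>p \<mapsto> \<lambda> p + (t, s)\<close> on lines and on points.\<close>

definition hom_line :: "complex \<Rightarrow> complex \<Rightarrow> complex \<Rightarrow> ctriple \<Rightarrow> ctriple" where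
  "hom_line lam t s l = (fst l, fst (snd l), lam * snd (snd l) - fst l * t - fst (snd l) * s)"

definition hom_point :: "complex \<Rightarrow> complex \<Rightarrow> complex \<Rightarrow> ctriple \<Rightarrow> ctriple" where
  "hom_point lam t s X = (lam * fst X + snd (snd X) * t, lam * fst (snd X) + snd (snd X) * s, snd (snd X))"

text \<open>A homothety keeps all normals, so their determinants and products are unchanged and no
  scalar factor appears, in contrast to \<open>track_scale\<close>.\<close>

lemma track_hom: "track (\<lambda>i. hom_line lam t s (l i)) b is k = hom_point lam t s (track l b is k)"
proof (induction k)
  case 0
  show ?case by (simp add: meet3_sel prod_eq_iff hom_line_def hom_point_def algebra_simps)
next
  case (Suc k)
  then show ?case
    by (simp add: slap_step_sel dot3_sel dotn_sel prod_eq_iff hom_line_def hom_point_def algebra_simps)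
qed

lemma track_cong:
  assumes "\<And>m. m \<le> k \<Longrightarrow> is m = is' m"
  shows "track l b is k = track l b is' k"
  using assms by (induction k) auto

section \<open>Nonvanishing at a configuration with imaginary angles\<close>

text \<open>In hyperbolic parameters \<open>h = exp y\<close>: lines tangent to a conic, with imaginary angles.\<close>

definition wline :: "real \<Rightarrow> ctriple" where
  "wline h = (- \<i> * of_real ((1 - h\<^sup>2) / 2), of_real ((1 + h\<^sup>2) / 2), of_real h)"

text \<open>With \<open>h = exp y\<close>, \<open>wline h\<close> is \<open>h\<close> times the line
  with normal \<open>(\<i> sinh y, cosh y)\<close> and constant 1, a tangent of the unit circle. The
  point is that of tangency plus \<open>- \<i> r\<close> times the unit tangent
  \<open>(cosh y, - \<i> sinh y)\<close>; the factor \<open>- \<i>\<close> keeps positions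
  real.\<close>

definition wpoint :: "real \<Rightarrow> real \<Rightarrow> ctriple" where
  "wpoint h r = (\<i> * of_real (((1 - h\<^sup>2) / 2 - r * ((1 + h\<^sup>2) / 2)) / h),
     of_real ((r * ((1 - h\<^sup>2) / 2) - (1 + h\<^sup>2) / 2) / h), 1)"

lemma slap_step_scale: "slap_step l m (scale3 z X) = scale3 z (slap_step l m X)"
  by (simp add: slap_step_sel dot3_sel dotn_sel prod_eq_iff algebra_simps)

lemma scale3_scale3: "scale3 x (scale3 y X) = scale3 (x * y) X"
  by (simp add: prod_eq_iff)

lemma dotn_wline: "dotn (wline h) (wline k) = of_real ((h\<^sup>2 + k\<^sup>2) / 2)"
  by (simp add: wline_def complex_eq_iff field_simps)

text \<open>Two tangents of the unit circle whose normals differ by \<alpha> meet at distance tan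
  (\<alpha> / 2) from the points of tangency. The position here is the tanh of half the difference
  of the logarithms of \<open>k\<close> and \<open>h\<close>.\<close>

lemma meet3_wline:
  assumes "0 < h" "0 < k"  "h \<noteq> k"
  shows "meet3 (wline h) (wline k) = scale3 (\<i> * of_real ((h\<^sup>2 - k\<^sup>2) / 2)) (wpoint h ((k - h) / (h + k)))"
proof -
  have "h + k \<noteq> 0" using assms by simp
  then show ?thesis using assms(1)
    by (simp add: wline_def wpoint_def complex_eq_iff divide_simps) algebra
qed

text \<open>With \<open>\<delta> = ln (k / h)\<close> the new position is
  \<open>r / cosh \<delta> - tanh \<delta>\<close>. The scalar in front is \<open>- dotn\<close>,
  the denominator that \<open>slap_step\<close> clears.\<close>

lemma slap_step_wline:
  assumes "0 < h" "0 < k"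
  shows "slap_step (wline h) (wline k) (wpoint h r) = scale3 (- of_real ((h\<^sup>2 + k\<^sup>2) / 2))
    (wpoint k (r * (2 * h * k / (h\<^sup>2 + k\<^sup>2)) + (h\<^sup>2 - k\<^sup>2) / (h\<^sup>2 + k\<^sup>2)))"
proof -
  define D r' where "D = (h\<^sup>2 + k\<^sup>2) / 2"
    and "r' = r * (2 * h * k / (h\<^sup>2 + k\<^sup>2)) + (h\<^sup>2 - k\<^sup>2) / (h\<^sup>2 + k\<^sup>2)"
  define s where "s = (((1 - h\<^sup>2) / 2 - r * ((1 + h\<^sup>2) / 2)) * ((1 - k\<^sup>2) / 2)
    + (r * ((1 - h\<^sup>2) / 2) - (1 + h\<^sup>2) / 2) * ((1 + k\<^sup>2) / 2)) / h + k"
  have "h\<^sup>2 + k\<^sup>2 \<noteq> 0" using assms by (simp add: sum_power2_eq_zero_iff)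
  then have "q / 2 * (r * (2 * h * k / q) + (h\<^sup>2 - k\<^sup>2) / q) = h * k * r + (h\<^sup>2 - k\<^sup>2) / 2"
    if "q = h\<^sup>2 + k\<^sup>2" for q
    using that[symmetric] by (simp add: field_simps)
  \<comment> \<open>\<open>r'\<close> is needed only through \<open>D * r'\<close>, and
    \<open>s\<close> only through \<open>h * s\<close>. Both are polynomials in \<open>h\<close>,
    \<open>k\<close> and \<open>r\<close>, which reduces the two coordinate identities to ring
    arithmetic.\<close>
  then have Dr: "D * r' = h * k * r + (h\<^sup>2 - k\<^sup>2) / 2"
    unfolding D_def r'_def by blast
  have dot: "dot3 (wpoint h r) (wline k) = of_real s"
    using assms by (simp add: wline_def wpoint_def s_def complex_eq_iff add_divide_distrib)
  have hs: "h * s = ((1 - h\<^sup>2) / 2 - r * ((1 + h\<^sup>2) / 2)) * ((1 - k\<^sup>2) / 2)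
    + (r * ((1 - h\<^sup>2) / 2) - (1 + h\<^sup>2) / 2) * ((1 + k\<^sup>2) / 2) + h * k"
  proof -
    have "h * (q / h + k) = q + h * k" for q using assms by (simp add: distrib_left)
    then show ?thesis unfolding s_def .
  qed
  have 1: "s * ((1 - h\<^sup>2) / 2) + D * (((1 - h\<^sup>2) / 2 - r * ((1 + h\<^sup>2) / 2)) / h)
      = D * (((1 - k\<^sup>2) / 2 - r' * ((1 + k\<^sup>2) / 2)) / k)"
  proof -
    have "k * ((h * s) * ((1 - h\<^sup>2) / 2)) + k * D * ((1 - h\<^sup>2) / 2 - r * ((1 + h\<^sup>2) / 2))
      = h * (D * ((1 - k\<^sup>2) / 2) - (D * r') * ((1 + k\<^sup>2) / 2))"
      unfolding hs Dr unfolding D_def by (simp add: field_simps power2_eq_square)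
    then show ?thesis using assms by (simp add: field_simps)
  qed
  have 2: "s * ((1 + h\<^sup>2) / 2) - D * ((r * ((1 - h\<^sup>2) / 2) - (1 + h\<^sup>2) / 2) / h)
      = - (D * ((r' * ((1 - k\<^sup>2) / 2) - (1 + k\<^sup>2) / 2) / k))"
  proof -
    have "k * ((h * s) * ((1 + h\<^sup>2) / 2)) - k * D * (r * ((1 - h\<^sup>2) / 2) - (1 + h\<^sup>2) / 2)
      = - (h * ((D * r') * ((1 - k\<^sup>2) / 2) - D * ((1 + k\<^sup>2) / 2)))"
      unfolding hs Dr unfolding D_def by (simp add: field_simps power2_eq_square)
    then show ?thesis using assms by (simp add: field_simps)
  qed
  have "fst (slap_step (wline h) (wline k) (wpoint h r)) = - \<i> * of_real (s * ((1 - h\<^sup>2) / 2)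
      + D * (((1 - h\<^sup>2) / 2 - r * ((1 + h\<^sup>2) / 2)) / h))"
    unfolding slap_step_sel dot dotn_wline D_def[symmetric]
    by (simp add: wline_def wpoint_def complex_eq_iff)
  moreover have "fst (snd (slap_step (wline h) (wline k) (wpoint h r))) = of_real (s * ((1 + h\<^sup>2) / 2)
      - D * ((r * ((1 - h\<^sup>2) / 2) - (1 + h\<^sup>2) / 2) / h))"
    unfolding slap_step_sel dot dotn_wline D_def[symmetric]
    by (simp add: wline_def wpoint_def complex_eq_iff)
  moreover have "snd (snd (slap_step (wline h) (wline k) (wpoint h r))) = - of_real D"
    unfolding slap_step_sel dot dotn_wline D_def[symmetric] by (simp add: wpoint_def)
  ultimately show ?thesis
    unfolding 1 2 D_def[symmetric] r'_def[symmetric] by (simp add: prod_eq_iff wpoint_def)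
qed

text \<open>Apart from \<open>k = h\<close>, the zero is at \<open>r = (k - h) / (k + h)\<close>,
  the intersection found in \<open>meet3_wline\<close>. It is positive for \<open>h < k\<close>, so
  a point with negative \<open>r\<close> is then off line \<open>k\<close>.\<close>

lemma dot3_wline:
  assumes "0 < h"
  shows "dot3 (wline k) (wpoint h r) = of_real ((k - h) * (r * (k + h) - (k - h)) / (2 * h))"
  using assms by (simp add: wline_def wpoint_def complex_eq_iff field_simps power2_eq_square)

text \<open>The ratio 8 makes \<open>1 / cosh \<delta>\<close> at most 1/4 and
  \<open>tanh \<delta>\<close> larger than 1/2 in absolute value. For positions bounded by 2 the
  first term of a slap has size at most 1/2, so the second one decides the sign.\<close>

definition separated :: "nat \<Rightarrow> (nat \<Rightarrow> real) \<Rightarrow> bool" where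
  "separated n h \<longleftrightarrow> (\<forall>i. 0 < h i) \<and> (\<forall>i<n. \<forall>j<n. i \<noteq> j \<longrightarrow> 8 * h i \<le> h j \<or> 8 * h j \<le> h i)"

lemma sep_bounds:
  fixes h k :: real
  assumes "0 < h" "0 < k" "8 * h \<le> k \<or> 8 * k \<le> h"
  shows "0 \<le> 2 * h * k / (h\<^sup>2 + k\<^sup>2)" "2 * h * k / (h\<^sup>2 + k\<^sup>2) \<le> 1/4"
    "h < k \<Longrightarrow> (h\<^sup>2 - k\<^sup>2) / (h\<^sup>2 + k\<^sup>2) < - 1/2" "k < h \<Longrightarrow> 1/2 < (h\<^sup>2 - k\<^sup>2) / (h\<^sup>2 + k\<^sup>2)"
    "\<bar>(h\<^sup>2 - k\<^sup>2) / (h\<^sup>2 + k\<^sup>2)\<bar> \<le> 1"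
proof -
  have pos: "0 < h\<^sup>2 + k\<^sup>2" using assms by (simp add: add_pos_pos)
  show "0 \<le> 2 * h * k / (h\<^sup>2 + k\<^sup>2)" using assms pos by simp
  have "8 * h * k \<le> h\<^sup>2 + k\<^sup>2"
  proof (cases "8 * h \<le> k")
    case True
    then have "8 * h * k \<le> k * k" using assms by (intro mult_right_mono) auto
    then show ?thesis by (simp add: power2_eq_square) (use zero_le_square[of h] in linarith)
  next
    case False
    then have "8 * k * h \<le> h * h" using assms by (intro mult_right_mono) auto
    then show ?thesis by (simp add: power2_eq_square mult_ac) (use zero_le_square[of k] in linarith)
  qed
  then show "2 * h * k / (h\<^sup>2 + k\<^sup>2) \<le> 1/4" using pos by (simp add: divide_simps)
  show "(h\<^sup>2 - k\<^sup>2) / (h\<^sup>2 + k\<^sup>2) < - 1/2" if "h < k"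
  proof -
    have "8 * h \<le> k" using assms that by auto
    then have "(8 * h) * (8 * h) \<le> k * k" using assms by (intro mult_mono) auto
    then show ?thesis using pos assms zero_less_mult_iff[of h h] by (simp add: divide_simps power2_eq_square)
  qed
  show "1/2 < (h\<^sup>2 - k\<^sup>2) / (h\<^sup>2 + k\<^sup>2)" if "k < h"
  proof -
    have "8 * k \<le> h" using assms that by auto
    then have "(8 * k) * (8 * k) \<le> h * h" using assms by (intro mult_mono) auto
    then show ?thesis using pos assms zero_less_mult_iff[of k k] by (simp add: divide_simps power2_eq_square)
  qed
  show "\<bar>(h\<^sup>2 - k\<^sup>2) / (h\<^sup>2 + k\<^sup>2)\<bar> \<le> 1" using pos by (simp add: abs_le_iff divide_simps)
qed

text \<open>The bound 2 is preserved because 2 * 1/4 + 1 \<le> 2, and the starting position is even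
  bounded by 1. The sign is claimed only from the first slap on. The scalars stay nonzero because
  \<open>dotn\<close> is half a sum of squares.\<close>

lemma track_wline:
  assumes h: "separated n h" and b: "b < n" "b \<noteq> is 0" and lt: "\<And>m. m \<le> k \<Longrightarrow> is m < n"
    and ne: "\<And>m. m < k \<Longrightarrow> is m \<noteq> is (Suc m)"
  shows "\<exists>z r. z \<noteq> 0 \<and> track (\<lambda>i. wline (h i)) b is k = scale3 z (wpoint (h (is k)) r) \<and> \<bar>r\<bar> \<le> 2 \<and>
    (0 < k \<longrightarrow> (if h (is (k - 1)) < h (is k) then r < 0 else 0 < r))"
  using lt ne
proof (induction k)
  case 0
  have p: "0 < h (is 0)" "0 < h b" using h by (auto simp: separated_def)
  have ne: "h (is 0) \<noteq> h b" using h b 0(1)[of 0] p by (force simp: separated_def)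
  let ?r = "(h b - h (is 0)) / (h (is 0) + h b)"
  have "\<bar>?r\<bar> \<le> 2" using p by (simp add: abs_le_iff divide_simps)
  moreover have "(h (is 0))\<^sup>2 - (h b)\<^sup>2 \<noteq> 0" using ne p by (simp add: power2_eq_iff)
  then have "\<i> * of_real (((h (is 0))\<^sup>2 - (h b)\<^sup>2) / 2) \<noteq> 0" by (simp del: of_real_diff of_real_divide)
  ultimately show ?case unfolding track.simps meet3_wline[OF p ne] by blast
next
  case (Suc k)
  let ?h = "h (is k)" and ?k = "h (is (Suc k))"
  obtain z r where zr: "z \<noteq> 0" "track (\<lambda>i. wline (h i)) b is k = scale3 z (wpoint ?h r)" "\<bar>r\<bar> \<le> 2"
    using Suc by (metis le_SucI less_SucI)
  have p: "0 < ?h" "0 < ?k" using h by (auto simp: separated_def)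
  have sep: "8 * ?h \<le> ?k \<or> 8 * ?k \<le> ?h"
    using h Suc(2)[of k] Suc(2)[of "Suc k"] Suc(3)[of k] by (simp add: separated_def)
  note sb = sep_bounds[OF p sep]
  define e t where "e = 2 * ?h * ?k / (?h\<^sup>2 + ?k\<^sup>2)" and "t = (?h\<^sup>2 - ?k\<^sup>2) / (?h\<^sup>2 + ?k\<^sup>2)"
  define r' where "r' = r * e + t"
  have e: "0 \<le> e" "e \<le> 1/4" using sb by (auto simp: e_def)
  have re: "\<bar>r * e\<bar> \<le> 1/2" unfolding abs_mult using mult_mono[OF zr(3), of "\<bar>e\<bar>" "1/4"] e by simp
  define z' where "z' = z * - of_real ((?h\<^sup>2 + ?k\<^sup>2) / 2)"
  have "?h\<^sup>2 + ?k\<^sup>2 \<noteq> 0" using p by (simp add: sum_power2_eq_zero_iff)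
  then have z': "z' \<noteq> 0" using zr(1) by (simp add: z'_def del: of_real_add of_real_power of_real_divide)
  have tr: "track (\<lambda>i. wline (h i)) b is (Suc k) = scale3 z' (wpoint ?k r')"
    unfolding track.simps zr(2) slap_step_scale slap_step_wline[OF p] scale3_scale3 z'_def r'_def e_def t_def ..
  have "\<bar>r'\<bar> \<le> 2" using re sb(5) unfolding r'_def t_def[symmetric] by linarith
  moreover have "if ?h < ?k then r' < 0 else 0 < r'"
  proof (cases "?h < ?k")
    case True
    then show ?thesis using sb(3)[OF True] re unfolding r'_def t_def[symmetric] by auto
  next
    case False
    then have "?k < ?h" using sep p by linarith
    then show ?thesis using sb(4) re False unfolding r'_def t_def[symmetric] by auto
  qed
  ultimately show ?case using z' by (intro exI[of _ z'] exI[of _ r'] conjI tr) auto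
qed

section \<open>The countable family of polynomials to be avoided\<close>

definition itinerary :: "nat \<Rightarrow> nat \<Rightarrow> (nat \<Rightarrow> nat) \<Rightarrow> nat \<Rightarrow> bool" where
  "itinerary n b is k \<longleftrightarrow> b < n \<and> b \<noteq> is 0 \<and> (\<forall>m\<le>k. is m < n) \<and> (\<forall>m<k. is m \<noteq> is (Suc m))"

definition orth_fun where
  "orth_fun i j = (\<lambda>l. dotn (l i) (l j))"

definition hit_fun where
  "hit_fun b is k e = (\<lambda>l. dot3 (l e) (track l b is k))"

text \<open>Comparing first coordinates is enough: where this is nonzero the points differ, and a
  single polynomial expresses it.\<close>

definition coll_fun where
  "coll_fun b is k m = (\<lambda>l. fst (track l b is k) * snd (snd (track l b is m))
      - fst (track l b is m) * snd (snd (track l b is k)))"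

text \<open>Itineraries are lists here, which makes the family countable. In \<open>hit\<close> the
  final line \<open>js ! Suc k\<close> is left out because it contains the point. The line
  \<open>js ! k\<close> just left, and collisions of points that come from the same side, are ruled
  out geometrically in \<open>trace_extend\<close> and \<open>trace_neq\<close>.\<close>

inductive nondeg :: "nat \<Rightarrow> ((nat \<Rightarrow> ctriple) \<Rightarrow> complex) \<Rightarrow> bool" for n where
  orth: "i < n \<Longrightarrow> j < n \<Longrightarrow> i \<noteq> j \<Longrightarrow> nondeg n (orth_fun i j)"
| hit: "itinerary n b ((!) js) (Suc k) \<Longrightarrow> e < n \<Longrightarrow> e \<noteq> js ! Suc k \<Longrightarrow> e \<noteq> js ! k \<Longrightarrow>
    nondeg n (hit_fun b ((!) js) (Suc k) e)"
| coll: "itinerary n b ((!) js) (Suc k) \<Longrightarrow> m < k \<Longrightarrow> js ! Suc m = js ! Suc k \<Longrightarrow> js ! m \<noteq> js ! k \<Longrightarrow>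
    nondeg n (coll_fun b ((!) js) (Suc k) (Suc m))"

lemma countable_nondeg: "countable {F. nondeg n F}"
proof -
  let ?A = "range (\<lambda>(i, j). orth_fun i j)" and ?B = "range (\<lambda>(b, js, k, e). hit_fun b ((!) js) k e)"
    and ?C = "range (\<lambda>(b, js, k, m). coll_fun b ((!) js) k m)"
  have "F \<in> ?A \<union> ?B \<union> ?C" if "nondeg n F" for F
    using that
  proof cases
    case (orth i j)
    have "F \<in> ?A" unfolding orth by (rule range_eqI[of _ _ "(i, j)"]) simp
    then show ?thesis by (rule UnI1[OF UnI1])
  next
    case (hit b js k e)
    have "F \<in> ?B" unfolding hit by (rule range_eqI[of _ _ "(b, js, Suc k, e)"]) simp
    then show ?thesis by (rule UnI1[OF UnI2])
  next
    case (coll b js k m)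
    have "F \<in> ?C" unfolding coll by (rule range_eqI[of _ _ "(b, js, Suc k, Suc m)"]) simp
    then show ?thesis by (rule UnI2)
  qed
  then have "{F. nondeg n F} \<subseteq> ?A \<union> ?B \<union> ?C" by blast
  then show ?thesis by (rule countable_subset) (intro countable_Un countable_image countableI_type)
qed

lemma polyfun_nondeg:
  assumes "nondeg n F"
  shows "polyfun F"
  using assms polyfun_track
  by cases (auto simp: orth_fun_def hit_fun_def coll_fun_def dot3_sel dotn_sel simp del: track.simps intro!: polyfun_intros)

lemma nondeg_scale:
  assumes "nondeg n F" "\<And>i. c i \<noteq> 0"
  shows "F (\<lambda>i. scale3 (c i) (l i)) = 0 \<longleftrightarrow> F l = 0"
  using assms(1)
proof cases
  case (orth i j)
  have "F (\<lambda>i. scale3 (c i) (l i)) = c i * c j * F l"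
    by (simp add: orth orth_fun_def dotn_sel algebra_simps)
  then show ?thesis using assms by simp
next
  case (hit b js k e)
  obtain d where d: "d \<noteq> 0" "track (\<lambda>i. scale3 (c i) (l i)) b ((!) js) (Suc k) = scale3 d (track l b ((!) js) (Suc k))"
    using track_scale[of c] assms(2) by blast
  have "F (\<lambda>i. scale3 (c i) (l i)) = c e * d * F l"
    by (simp add: hit hit_fun_def d dot3_sel algebra_simps del: track.simps)
  then show ?thesis using assms d by simp
next
  case (coll b js k m)
  obtain d where d: "d \<noteq> 0" "track (\<lambda>i. scale3 (c i) (l i)) b ((!) js) (Suc k) = scale3 d (track l b ((!) js) (Suc k))"
    using track_scale[of c] assms(2) by blast
  obtain d' where d': "d' \<noteq> 0" "track (\<lambda>i. scale3 (c i) (l i)) b ((!) js) (Suc m) = scale3 d' (track l b ((!) js) (Suc m))"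
    using track_scale[of c] assms(2) by blast
  have "F (\<lambda>i. scale3 (c i) (l i)) = d * d' * F l"
    by (simp add: coll coll_fun_def d d' algebra_simps del: track.simps)
  then show ?thesis using d d' by simp
qed

lemma nondeg_hom:
  assumes "nondeg n F" "lam \<noteq> 0"
  shows "F (\<lambda>i. hom_line lam t s (l i)) = 0 \<longleftrightarrow> F l = 0"
  using assms(1)
proof cases
  case (orth i j)
  then show ?thesis by (simp add: orth_fun_def dotn_sel hom_line_def)
next
  case (hit b js k e)
  have "F (\<lambda>i. hom_line lam t s (l i)) = lam * F l"
    unfolding hit hit_fun_def track_hom
    by (simp add: dot3_sel hom_line_def hom_point_def algebra_simps del: track.simps)
  then show ?thesis using assms by simp
next
  case (coll b js k m)
  have "F (\<lambda>i. hom_line lam t s (l i)) = lam * F l"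
    unfolding coll coll_fun_def track_hom
    by (simp add: hom_point_def algebra_simps del: track.simps)
  then show ?thesis using assms by simp
qed

section \<open>Complex witnesses in normalised position\<close>

lemma separated_neq:
  assumes "separated n h" "i < n" "j < n" "i \<noteq> j"
  shows "h i \<noteq> h j"
proof -
  have "0 < h i" "8 * h i \<le> h j \<or> 8 * h j \<le> h i" using assms by (auto simp: separated_def)
  then show ?thesis by auto
qed

lemma separated_exists:
  assumes "q \<noteq> p" "q \<noteq> e" "p \<noteq> e" "p < n" "q < n" "e < n"
  obtains h where "separated n h" "h 0 = 1" "\<And>i. n \<le> i \<Longrightarrow> h i = 1" "h p < h q" "h q < h e"
proof -
  define rk where "rk i = (if i = p then 0 else if i = q then 1 else if i = e then 2 else i + 3)" for i
  have rk: "rk i \<noteq> rk j" if "i \<noteq> j" for i j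
    using that assms by (auto simp: rk_def split: if_splits)
  define h where "h i = (if i < n then 8 ^ rk i / 8 ^ rk 0 else (1::real))" for i
  have mono: "8 * 8 ^ x \<le> (8::real) ^ y" if "x < y" for x y :: nat
    using power_increasing[of "Suc x" y "8::real"] that by simp
  have pos: "0 < h i" for i by (simp add: h_def)
  have "separated n h" unfolding separated_def
  proof (intro conjI allI impI pos)
    fix i j assume ij: "i < n" "j < n" "i \<noteq> j"
    from rk[OF ij(3)] consider "rk i < rk j" | "rk j < rk i" by linarith
    then show "8 * h i \<le> h j \<or> 8 * h j \<le> h i"
      using mono ij by cases (auto simp: h_def divide_simps)
  qed
  moreover have "h p < h q" "h q < h e" using assms by (simp_all add: h_def rk_def divide_simps)
  moreover have "h 0 = 1" "\<And>i. n \<le> i \<Longrightarrow> h i = 1" by (auto simp: h_def)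
  ultimately show thesis using that by blast
qed

lemma nondeg_wline:
  assumes "nondeg n F" "3 \<le> n"
  obtains h where "separated n h" "h 0 = 1" "\<And>i. n \<le> i \<Longrightarrow> h i = 1" "F (\<lambda>i. wline (h i)) \<noteq> 0"
  using assms(1)
proof cases
  case (orth i j)
  obtain h where h: "separated n h" "h 0 = 1" "\<And>i. n \<le> i \<Longrightarrow> h i = 1"
    using separated_exists[of 1 0 2 n] assms by auto
  have "F (\<lambda>i. wline (h i)) = of_real (((h i)\<^sup>2 + (h j)\<^sup>2) / 2)" by (simp only: orth orth_fun_def dotn_wline)
  moreover have "((h i)\<^sup>2 + (h j)\<^sup>2) / 2 \<noteq> 0"
    using h(1) by (simp add: separated_def sum_power2_eq_zero_iff) (metis less_irrefl)
  ultimately have "F (\<lambda>i. wline (h i)) \<noteq> 0" by (metis of_real_eq_0_iff)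
  then show thesis using that h by blast
next
  case (hit b js k e)
  note I = hit(2)[unfolded itinerary_def]
  \<comment> \<open>A last step to a larger parameter gives \<open>r < 0\<close>, while line
    \<open>e\<close>, with a still larger parameter, is met at a positive position.\<close>
  obtain h where h: "separated n h" "h 0 = 1" "\<And>i. n \<le> i \<Longrightarrow> h i = 1"
    "h (js ! k) < h (js ! Suc k)" "h (js ! Suc k) < h e"
    using separated_exists[of "js ! Suc k" "js ! k" e n] hit I by (metis lessI less_imp_le order_refl)
  obtain z r where zr: "z \<noteq> 0" "track (\<lambda>i. wline (h i)) b ((!) js) (Suc k) = scale3 z (wpoint (h (js ! Suc k)) r)"
    "r < 0"
    using track_wline[OF h(1), of b "(!) js" "Suc k"] I h(4) by auto
  have p: "0 < h (js ! Suc k)" "0 < h e" using h by (auto simp: separated_def)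
  have "r * (h e + h (js ! Suc k)) < 0" using zr(3) p by (simp add: mult_less_0_iff)
  then have "r * (h e + h (js ! Suc k)) - (h e - h (js ! Suc k)) \<noteq> 0" using h by linarith
  moreover have "F (\<lambda>i. wline (h i)) = z * of_real ((h e - h (js ! Suc k)) * (r * (h e + h (js ! Suc k)) - (h e - h (js ! Suc k))) / (2 * h (js ! Suc k)))"
    unfolding hit hit_fun_def zr(2) dot3_wline[OF p(1), symmetric] by (simp add: dot3_sel algebra_simps)
  ultimately have "F (\<lambda>i. wline (h i)) \<noteq> 0"
    using zr(1) p h(5) by (simp del: of_real_mult of_real_diff of_real_divide of_real_add)
  then show thesis using that h by blast
next
  case (coll b js k m)
  note I = coll(2)[unfolded itinerary_def]
  \<comment> \<open>The last steps go up from \<open>js ! k\<close> and down from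
    \<open>js ! m\<close>, so the two positions on the common line are negative and
    positive.\<close>
  obtain h where h: "separated n h" "h 0 = 1" "\<And>i. n \<le> i \<Longrightarrow> h i = 1"
    "h (js ! k) < h (js ! Suc k)" "h (js ! Suc k) < h (js ! m)"
  proof -
    have "js ! Suc k \<noteq> js ! k" "js ! Suc k \<noteq> js ! m" "js ! k \<noteq> js ! m" "js ! k < n" "js ! Suc k < n" "js ! m < n"
      using I coll by (metis lessI less_SucI less_imp_le order_refl)+
    then show thesis using separated_exists[of "js ! Suc k" "js ! k" "js ! m" n] that by metis
  qed
  obtain z r where zr: "z \<noteq> 0" "track (\<lambda>i. wline (h i)) b ((!) js) (Suc k) = scale3 z (wpoint (h (js ! Suc k)) r)"
    "r < 0"
    using track_wline[OF h(1), of b "(!) js" "Suc k"] I h(4) by auto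
  obtain y s where ys: "y \<noteq> 0" "track (\<lambda>i. wline (h i)) b ((!) js) (Suc m) = scale3 y (wpoint (h (js ! Suc k)) s)"
    "0 < s"
    using track_wline[OF h(1), of b "(!) js" "Suc m"] I h(5) coll by (auto simp: less_Suc_eq_le)
  have p: "0 < h (js ! Suc k)" using h by (auto simp: separated_def)
  \<comment> \<open>The factor \<open>1 + h^2\<close> comes from the second entry of the normal: the
    line is not vertical, so its points are told apart by their first coordinates.\<close>
  have "F (\<lambda>i. wline (h i)) = z * y * \<i> * of_real ((s - r) * (1 + (h (js ! Suc k))\<^sup>2) / (2 * h (js ! Suc k)))"
    unfolding coll coll_fun_def zr(2) ys(2) using p
    by (simp add: wpoint_def field_simps)
  moreover have "1 + (h (js ! Suc k))\<^sup>2 \<noteq> 0" by (smt (verit) zero_le_power2)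
  ultimately have "F (\<lambda>i. wline (h i)) \<noteq> 0"
    using zr ys p by (simp del: of_real_mult of_real_diff of_real_divide of_real_add of_real_power)
  then show thesis using that h by blast
qed

text \<open>Line \<open>0\<close> is the real axis, line \<open>1\<close> passes through \<open>1\<close> and line \<open>n - 1\<close> through \<open>0\<close>; the
  superfluous lines \<open>i \<ge> n\<close> are set to the real axis.\<close>

definition norm_lines :: "nat \<Rightarrow> (nat \<Rightarrow> 'a::ring_1 \<times> 'a \<times> 'a) \<Rightarrow> nat \<Rightarrow> 'a \<times> 'a \<times> 'a" where
  "norm_lines n u i = (if i = 0 \<or> n \<le> i then (0, 1, 0)
     else if i = 1 then (fst (u i), fst (snd (u i)), - fst (u i))
     else if i = n - 1 then (fst (u i), fst (snd (u i)), 0) else u i)"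

lemma nondeg_norm_witness:
  assumes "nondeg n F" "3 \<le> n"
  shows "\<exists>u. F (norm_lines n u) \<noteq> 0"
proof -
  obtain h where h: "separated n h" "h 0 = 1" "\<And>i. n \<le> i \<Longrightarrow> h i = 1" "F (\<lambda>i. wline (h i)) \<noteq> 0"
    using nondeg_wline[OF assms] by blast
  have pos: "0 < h i" for i using h by (simp add: separated_def)
  define x y where "x = h (n - 1)" and "y = h 1"
  have ne: "x \<noteq> 1" "y \<noteq> 1" "x \<noteq> y"
    using separated_neq[OF h(1), of "n - 1" 0] separated_neq[OF h(1), of 1 0] separated_neq[OF h(1), of "n - 1" 1] assms(2) h(2)
    unfolding x_def y_def by simp_all
  have xy: "0 < x" "0 < y" using pos by (simp_all add: x_def y_def)
  \<comment> \<open>\<open>P\<close> is the point where lines \<open>0\<close> and \<open>n - 1\<close> meet, up to sign\<close>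
  define P where "P = - \<i> * of_real ((1 - x) / (1 + x))"
  define g where "g = (1 - y) * (y - x) / (1 + x)"
  define a1 where "a1 = - \<i> * of_real ((1 - y\<^sup>2) / 2)"
  define lam where "lam = - a1 / of_real g"
  have g: "g \<noteq> 0" using ne xy by (simp add: g_def)
  have "1 - y\<^sup>2 \<noteq> 0" using ne xy by (simp add: power2_eq_1_iff)
  then have "a1 \<noteq> 0" by (simp add: a1_def del: of_real_diff of_real_divide)
  then have lam: "lam \<noteq> 0" using g by (simp add: lam_def)
  define u where "u i = hom_line lam (lam * P) lam (wline (h i))" for i
  have 0: "hom_line lam (lam * P) lam (wline 1) = (0, 1, 0)"
    by (simp add: hom_line_def wline_def)
  have 1: "snd (snd (hom_line lam (lam * P) lam (wline y))) = - fst (wline y)"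
  proof -
    have "1 + x \<noteq> 0" using xy by simp
    then have "of_real y - a1 * P - of_real ((1 + y\<^sup>2) / 2) = complex_of_real g"
      by (simp add: a1_def P_def g_def complex_eq_iff divide_simps) algebra
    then have "lam * (of_real y - a1 * P - of_real ((1 + y\<^sup>2) / 2)) = - a1"
      using g by (simp add: lam_def)
    then show ?thesis by (simp add: hom_line_def wline_def a1_def algebra_simps)
  qed
  have 2: "snd (snd (hom_line lam (lam * P) lam (wline x))) = 0"
  proof -
    have "1 + x \<noteq> 0" using xy by simp
    then have "of_real x - (- \<i> * of_real ((1 - x\<^sup>2) / 2)) * P - of_real ((1 + x\<^sup>2) / 2) = (0::complex)"
      by (simp add: P_def complex_eq_iff divide_simps) algebra
    then have "lam * (of_real x - (- \<i> * of_real ((1 - x\<^sup>2) / 2)) * P - of_real ((1 + x\<^sup>2) / 2)) = 0" by simp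
    then show ?thesis by (simp add: hom_line_def wline_def algebra_simps)
  qed
  have "norm_lines n u = u"
  proof
    fix i
    consider "i = 0 \<or> n \<le> i" | "i = 1" "i < n" | "i = n - 1" "i \<noteq> 0" "i \<noteq> 1" "i < n" | "i \<noteq> 0" "i < n" "i \<noteq> 1" "i \<noteq> n - 1"
      by linarith
    then show "norm_lines n u i = u i"
    proof cases
      case 1
      then have "h i = 1" using h by auto
      then show ?thesis using 1 0 by (auto simp: norm_lines_def u_def)
    next
      case 2
      then show ?thesis using \<open>snd (snd (hom_line lam (lam * P) lam (wline y))) = - fst (wline y)\<close>
        by (auto simp: norm_lines_def u_def y_def prod_eq_iff) (simp_all add: hom_line_def)
    next
      case 3
      then show ?thesis using 2
        by (auto simp: norm_lines_def u_def x_def prod_eq_iff)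
    next
      case 4
      then show ?thesis by (auto simp: norm_lines_def)
    qed
  qed
  then have "F (norm_lines n u) \<noteq> 0"
    using nondeg_hom[OF assms(1) lam] h(4) unfolding u_def by simp
  then show ?thesis by blast
qed

section \<open>Zero sets are null\<close>

text \<open>The part of being polynomial that Fubini needs: it passes to the slices of a product
  and, on the real line, leaves only finitely many zeros unless all values are 0.\<close>

definition linepoly :: "('a::euclidean_space \<Rightarrow> complex) \<Rightarrow> bool" where
  "linepoly g \<longleftrightarrow> continuous_on UNIV g \<and> (\<forall>x d. \<exists>p. \<forall>t. g (x + t *\<^sub>R d) = poly p (of_real t))"

lemma AE_linepoly_real:
  fixes g :: "real \<Rightarrow> complex"
  assumes "linepoly g" "g a \<noteq> 0"
  shows "AE x in lborel. g x \<noteq> 0"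
proof -
  obtain p where p: "\<And>t. g t = poly p (of_real t)"
    using assms(1) unfolding linepoly_def by (metis add_0 mult.right_neutral real_scaleR_def)
  then have "finite {t :: real. poly p (of_real t) = 0}" using assms(2) by (intro finite_real_roots) auto
  then have "AE x in lborel. \<forall>t \<in> {t :: real. poly p (of_real t) = 0}. x \<noteq> t"
    by (rule AE_finite_allI) (rule AE_lborel_singleton)
  then show ?thesis by eventually_elim (auto simp: p)
qed

text \<open>The slice at height \<open>snd a\<close> does not vanish identically, so almost every
  \<open>x\<close> has \<open>g (x, snd a) \<noteq> 0\<close>. For each such \<open>x\<close> the
  slice in \<open>y\<close> does not vanish identically either, and Fubini combines the two.\<close>

lemma AE_linepoly_prod:
  fixes g :: "'a::euclidean_space \<times> 'b::euclidean_space \<Rightarrow> complex"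
  assumes g: "linepoly g" "g a \<noteq> 0"
    and A: "\<And>(g :: 'a \<Rightarrow> complex) a. linepoly g \<Longrightarrow> g a \<noteq> 0 \<Longrightarrow> AE x in lborel. g x \<noteq> 0"
    and B: "\<And>(g :: 'b \<Rightarrow> complex) a. linepoly g \<Longrightarrow> g a \<noteq> 0 \<Longrightarrow> AE x in lborel. g x \<noteq> 0"
  shows "AE x in lborel. g x \<noteq> 0"
proof -
  have cont: "continuous_on UNIV g" using g by (simp add: linepoly_def)
  have l1: "linepoly (\<lambda>x. g (x, y))" for y
    unfolding linepoly_def
  proof (intro conjI allI)
    show "continuous_on UNIV (\<lambda>x. g (x, y))"
      by (rule continuous_on_compose2[OF cont]) (auto intro!: continuous_intros)
    fix x d
    obtain p where "\<And>t. g ((x, y) + t *\<^sub>R (d, 0)) = poly p (of_real t)"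
      using g unfolding linepoly_def by blast
    then show "\<exists>p. \<forall>t. g (x + t *\<^sub>R d, y) = poly p (of_real t)" by auto
  qed
  have l2: "linepoly (\<lambda>y. g (x, y))" for x
    unfolding linepoly_def
  proof (intro conjI allI)
    show "continuous_on UNIV (\<lambda>y. g (x, y))"
      by (rule continuous_on_compose2[OF cont]) (auto intro!: continuous_intros)
    fix y d
    obtain p where "\<And>t. g ((x, y) + t *\<^sub>R (0, d)) = poly p (of_real t)"
      using g unfolding linepoly_def by blast
    then show "\<exists>p. \<forall>t. g (x, y + t *\<^sub>R d) = poly p (of_real t)" by auto
  qed
  have "AE x in lborel. g (x, snd a) \<noteq> 0" using A[OF l1, of "fst a" "snd a"] g by simp
  then have "AE x in lborel. AE y in lborel. g (x, y) \<noteq> 0"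
    by eventually_elim (rule B[OF l2])
  moreover have m: "g \<in> borel_measurable borel" using cont by (rule borel_measurable_continuous_onI)
  then have "{x \<in> space (lborel \<Otimes>\<^sub>M lborel). g x \<noteq> 0} \<in> sets (lborel \<Otimes>\<^sub>M lborel)"
    unfolding lborel_prod by simp measurable
  ultimately have "AE x in lborel \<Otimes>\<^sub>M lborel. g x \<noteq> 0"
    by (intro pair_sigma_finite.AE_pair_measure lborel_pair.pair_sigma_finite_axioms)
  then show ?thesis unfolding lborel_prod .
qed

lemma AE_linepoly_2:
  fixes g :: "real \<times> real \<Rightarrow> complex"
  shows "linepoly g \<Longrightarrow> g a \<noteq> 0 \<Longrightarrow> AE x in lborel. g x \<noteq> 0"
  by (rule AE_linepoly_prod) (auto intro: AE_linepoly_real)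

lemma AE_linepoly_3:
  fixes g :: "real \<times> real \<times> real \<Rightarrow> complex"
  shows "linepoly g \<Longrightarrow> g a \<noteq> 0 \<Longrightarrow> AE x in lborel. g x \<noteq> 0"
  by (rule AE_linepoly_prod) (auto intro: AE_linepoly_real AE_linepoly_2)

text \<open>\<open>proj_measure\<close> is a multiple of the Lebesgue measure of the part of the
  ball that the lines fill. By homogeneity this part lies in the zero set of \<open>g\<close>,
  whichever representative \<open>proj_rep\<close> picks.\<close>

lemma AE_proj:
  fixes g :: "'a::euclidean_space \<Rightarrow> complex"
  assumes g: "linepoly g" and hom: "\<And>c y. c \<noteq> 0 \<Longrightarrow> g (c *\<^sub>R y) = 0 \<longleftrightarrow> g y = 0"
    and AE: "AE x in lborel. g x \<noteq> 0"
  shows "AE q in proj_measure. g (proj_rep q) \<noteq> 0"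
proof -
  have m: "g \<in> borel_measurable borel"
    using g unfolding linepoly_def by (intro borel_measurable_continuous_onI) auto
  have zero: "{x. g x = 0} \<in> sets borel"
    using measurable_sets[OF m, of "{0}"] by (simp add: vimage_def)
  have m': "(\<lambda>q. g (proj_rep q)) \<in> borel_measurable borel"
    by (rule measurable_compose[OF borel_measurable_proj_rep m])
  then have A: "{q. g (proj_rep q) = 0} \<in> sets borel" by simp
  have "emeasure proj_measure {q. g (proj_rep q) = 0} = ennreal (real DIM('a) / 2) *
      emeasure lborel {x \<in> ball 0 1 - {0}. abs_proj x \<in> {q. g (proj_rep q) = 0}}"
    by (rule emeasure_proj_measure[OF A])
  also have "emeasure lborel {x \<in> ball 0 1 - {0}. abs_proj x \<in> {q. g (proj_rep q) = 0}} \<le>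
      emeasure lborel {x. g x = 0}"
  proof (rule emeasure_mono)
    show "{x. g x = 0} \<in> sets lborel" unfolding sets_lborel by (rule zero)
    show "{x \<in> ball 0 1 - {0}. abs_proj x \<in> {q. g (proj_rep q) = 0}} \<subseteq> {x. g x = 0}"
    proof
      fix x assume x: "x \<in> {x \<in> ball 0 1 - {0}. abs_proj x \<in> {q. g (proj_rep q) = 0}}"
      then obtain c where "c \<noteq> 0" "proj_rep (abs_proj x) = c *\<^sub>R x" using proj_rep_abs[of x] by auto
      then show "x \<in> {x. g x = 0}" using x hom by simp
    qed
  qed
  also have "emeasure lborel {x. g x = 0} = 0"
    using AE zero by (subst (asm) AE_iff_measurable[OF _ refl]) (auto simp: set_eq_iff)
  finally have "emeasure proj_measure {q. g (proj_rep q) = 0} = 0"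
    by (auto simp: mult_left_mono)
  then show ?thesis using A by (subst AE_iff_measurable[OF _ refl]) auto
qed

section \<open>Almost sure nonvanishing on the chart\<close>

lemma sigma_finite_proj_measure: "sigma_finite_measure (proj_measure :: 'a::euclidean_space proj measure)"
  by (rule finite_measure.axioms(1)[OF finite_measure_proj_measure])

lemma (in product_sigma_finite) AE_PiM_insert:
  assumes I: "finite I" "i \<notin> I"
    and P: "{x \<in> space (Pi\<^sub>M (insert i I) M). P x} \<in> sets (Pi\<^sub>M (insert i I) M)"
    and AE: "AE x in Pi\<^sub>M I M. AE y in M i. P (x(i := y))"
  shows "AE x in Pi\<^sub>M (insert i I) M. P x"
proof -
  let ?M = "Pi\<^sub>M (insert i I) M"
  define N where "N = {x \<in> space ?M. \<not> P x}"
  have N: "N \<in> sets ?M" unfolding N_def using P by (rule sets.sets_Collect)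
  have "emeasure ?M N = (\<integral>\<^sup>+ x. indicator N x \<partial>?M)" using N by simp
  also have "\<dots> = (\<integral>\<^sup>+ x. (\<integral>\<^sup>+ y. indicator N (x(i := y)) \<partial>(M i)) \<partial>(Pi\<^sub>M I M))"
    using N by (intro product_nn_integral_insert I) auto
  also have "\<dots> = (\<integral>\<^sup>+ x. 0 \<partial>(Pi\<^sub>M I M))"
  proof (rule nn_integral_cong_AE, use AE in eventually_elim)
    fix x assume "AE y in M i. P (x(i := y))"
    then have "(\<integral>\<^sup>+ y. indicator N (x(i := y)) \<partial>(M i)) = (\<integral>\<^sup>+ y. 0 \<partial>(M i))"
      by (intro nn_integral_cong_AE) (auto simp: N_def indicator_def elim!: eventually_mono)
    then show "(\<integral>\<^sup>+ y. indicator N (x(i := y)) \<partial>(M i)) = 0" by simp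
  qed
  finally have "emeasure ?M N = 0" by simp
  then show ?thesis using N unfolding N_def by (subst AE_iff_measurable[OF _ refl]) auto
qed

lemma polyfun_measurable:
  assumes "polyfun F" "\<And>i. (\<lambda>w. fst (x w i)) \<in> borel_measurable M"
    "\<And>i. (\<lambda>w. fst (snd (x w i))) \<in> borel_measurable M" "\<And>i. (\<lambda>w. snd (snd (x w i))) \<in> borel_measurable M"
  shows "(\<lambda>w. F (x w)) \<in> borel_measurable M"
  using assms(1) by induction (auto intro: assms(2-) borel_measurable_add borel_measurable_times)

lemma linepoly_polyfun:
  assumes "polyfun H" "\<And>y d t. T (y + t *\<^sub>R d) = (\<lambda>i. x i y + t *\<^sub>R z i d)"
    and "\<And>i. continuous_on UNIV (\<lambda>y. T y i)"
  shows "linepoly (\<lambda>y. H (\<lambda>i. creal (T y i)))"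
  unfolding linepoly_def
proof (intro conjI allI)
  show "continuous_on UNIV (\<lambda>y. H (\<lambda>i. creal (T y i)))"
    unfolding continuous_on_def
  proof
    fix y :: 'a
    show "((\<lambda>y. H (\<lambda>i. creal (T y i))) \<longlongrightarrow> H (\<lambda>i. creal (T y i))) (at y within UNIV)"
      using assms(3) by (intro polyfun_tendsto[OF assms(1)] tendsto_creal) (simp add: continuous_on_def)
  qed
  fix y d
  show "\<exists>p. \<forall>t. H (\<lambda>i. creal (T (y + t *\<^sub>R d) i)) = poly p (of_real t)"
    unfolding assms(2) by (rule polyfun_real_line[OF assms(1)])
qed

text \<open>Whether \<open>H\<close> vanishes depends on the lines and not on the triples that
  represent them, so any representatives of the projective chart coordinates may be
  inserted.\<close>

locale scale_invariant_polyfun =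
  fixes H :: "(nat \<Rightarrow> ctriple) \<Rightarrow> complex"
  assumes poly: "polyfun H"
    and scale: "(\<And>i. c i \<noteq> 0) \<Longrightarrow> H (\<lambda>i. scale3 (c i) (u i)) = 0 \<longleftrightarrow> H u = 0"
begin

abbreviation HR :: "(nat \<Rightarrow> real \<times> real \<times> real) \<Rightarrow> complex" where
  "HR u \<equiv> H (\<lambda>i. creal (u i))"

lemma HR_scale:
  assumes "\<And>i. c i \<noteq> 0"
  shows "HR (\<lambda>i. c i *\<^sub>R u i) = 0 \<longleftrightarrow> HR u = 0"
proof -
  have "(\<lambda>i. creal (c i *\<^sub>R u i)) = (\<lambda>i. scale3 (of_real (c i)) (creal (u i)))"
    by (simp add: fun_eq_iff prod_eq_iff)
  then show ?thesis using scale[of "\<lambda>i. of_real (c i)"] assms by simp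
qed

text \<open>One line varies while the others stay at \<open>u\<close>. The map \<open>T\<close> is
  the identity for a free line and \<open>pad\<close> for a line through a fixed point, which has
  one projective parameter less.\<close>

lemma AE_factor:
  assumes "HR (u(i := T y0)) \<noteq> 0" and T: "bounded_linear (T :: 'a::euclidean_space \<Rightarrow> real \<times> real \<times> real)"
    and E: "\<And>(g :: 'a \<Rightarrow> complex) a. linepoly g \<Longrightarrow> g a \<noteq> 0 \<Longrightarrow> AE x in lborel. g x \<noteq> 0"
  shows "AE q in proj_measure. HR (u(i := T (proj_rep q))) \<noteq> 0"
proof -
  interpret T: bounded_linear T by fact
  have lp: "linepoly (\<lambda>y. HR (u(i := T y)))"
  proof (rule linepoly_polyfun[OF poly, where x = "\<lambda>j y. (u(i := T y)) j" and z = "\<lambda>j d. if j = i then T d else 0"])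
    show "u(i := T (y + t *\<^sub>R d)) = (\<lambda>j. (u(i := T y)) j + t *\<^sub>R (if j = i then T d else 0))" for y d t
      by (auto simp: T.add T.scaleR)
    show "continuous_on UNIV (\<lambda>y. (u(i := T y)) j)" for j
      by (cases "j = i") (auto intro!: continuous_intros T.continuous_on)
  qed
  have hom: "HR (u(i := T (c *\<^sub>R y))) = 0 \<longleftrightarrow> HR (u(i := T y)) = 0" if "c \<noteq> 0" for c y
  proof -
    have "u(i := T (c *\<^sub>R y)) = (\<lambda>j. (if j = i then c else 1) *\<^sub>R (u(i := T y)) j)"
      by (auto simp: T.scaleR)
    then show ?thesis using HR_scale[of "\<lambda>j. if j = i then c else 1" "u(i := T y)"] that by auto
  qed
  show ?thesis by (rule AE_proj[OF lp hom E[OF lp assms(1)]])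
qed

lemma measurable_HR:
  assumes [measurable]: "\<And>i. (\<lambda>w. u w i) \<in> borel_measurable M"
  shows "(\<lambda>w. HR (u w)) \<in> borel_measurable M"
proof -
  have [measurable]: "(fst :: real \<times> real \<times> real \<Rightarrow> real) \<in> borel_measurable borel"
    "(snd :: real \<times> real \<times> real \<Rightarrow> real \<times> real) \<in> borel_measurable borel"
    "(fst :: real \<times> real \<Rightarrow> real) \<in> borel_measurable borel"
    "(snd :: real \<times> real \<Rightarrow> real) \<in> borel_measurable borel"
    by (intro borel_measurable_continuous_onI continuous_intros)+
  show ?thesis by (rule polyfun_measurable[OF poly]) (simp_all, measurable)
qed

text \<open>The lines of the witness \<open>u\<close> are made generic one after the other: after
  each replacement almost every choice is again a witness, from which the next line can be
  varied.\<close>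

lemma AE_PiM:
  assumes "finite I" "HR u \<noteq> 0"
  shows "AE f in Pi\<^sub>M I (\<lambda>_. proj_measure). HR (\<lambda>i. if i \<in> I then proj_rep (f i) else u i) \<noteq> 0"
  using assms
proof (induction I)
  case empty
  then show ?case by simp
next
  case (insert i I)
  interpret product_sigma_finite "\<lambda>_ :: nat. proj_measure :: (real \<times> real \<times> real) proj measure"
    by (simp add: product_sigma_finite_def sigma_finite_proj_measure)
  let ?u = "\<lambda>J f j. if j \<in> J then proj_rep (f j) else u j"
  show ?case
  proof (rule AE_PiM_insert[OF insert(1,2)])
    have "(\<lambda>f. ?u (insert i I) f j) \<in> borel_measurable (Pi\<^sub>M (insert i I) (\<lambda>_. proj_measure))" for j
    proof (cases "j \<in> insert i I")
      case True
      then have "(\<lambda>f. f j) \<in> borel_measurable (Pi\<^sub>M (insert i I) (\<lambda>_. proj_measure))" by measurable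
      then show ?thesis using True by simp
    qed simp
    then have "(\<lambda>f. HR (?u (insert i I) f)) \<in> borel_measurable (Pi\<^sub>M (insert i I) (\<lambda>_. proj_measure))"
      by (rule measurable_HR)
    then show "{f \<in> space (Pi\<^sub>M (insert i I) (\<lambda>_. proj_measure)). HR (?u (insert i I) f) \<noteq> 0}
      \<in> sets (Pi\<^sub>M (insert i I) (\<lambda>_. proj_measure))" by measurable
    show "AE f in Pi\<^sub>M I (\<lambda>_. proj_measure). AE y in proj_measure. HR (?u (insert i I) (f(i := y))) \<noteq> 0"
      using insert(3)[OF insert(4)]
    proof eventually_elim
      case (elim f)
      have "(?u I f)(i := u i) = ?u I f" using insert(2) by auto
      then have "AE y in proj_measure. HR ((?u I f)(i := proj_rep y)) \<noteq> 0"
        using AE_factor[of "?u I f" i "\<lambda>x. x" "u i"] elim AE_linepoly_3 by (simp add: bounded_linear_ident)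
      moreover have "?u (insert i I) (f(i := y)) = (?u I f)(i := proj_rep y)" for y
        using insert(2) by auto
      then have "HR (?u (insert i I) (f(i := y))) = HR ((?u I f)(i := proj_rep y))" for y
        by (rule arg_cong[of _ _ "\<lambda>v. HR v"])
      ultimately show ?case by (simp only:)
    qed
  qed
qed

end

definition pad :: "real \<times> real \<Rightarrow> real \<times> real \<times> real" where
  "pad y = (fst y, snd y, 0)"

lemma bounded_linear_pad: "bounded_linear pad"
  unfolding pad_def by (intro bounded_linear_Pair bounded_linear_fst bounded_linear_snd bounded_linear_zero)

definition chart_rep :: "nat \<Rightarrow> chart_point \<Rightarrow> nat \<Rightarrow> real \<times> real \<times> real" where
  "chart_rep n = (\<lambda>(p, f, q) i. if i = 1 then pad (proj_rep p) else if i = n - 1 then pad (proj_rep q)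
     else if i \<in> {2..<n - 1} then proj_rep (f i) else 0)"

lemma (in scale_invariant_polyfun) AE_chart_measure:
  assumes n: "3 \<le> n"
    and cong: "\<And>u v. (\<And>i. 1 \<le> i \<Longrightarrow> i < n \<Longrightarrow> fst (u i) = fst (v i) \<and> fst (snd (u i)) = fst (snd (v i))) \<Longrightarrow>
      (\<And>i. 2 \<le> i \<Longrightarrow> i < n - 1 \<Longrightarrow> u i = v i) \<Longrightarrow> H u = H v"
    and w: "HR w \<noteq> 0"
  shows "{x \<in> space (chart_measure n). HR (chart_rep n x) \<noteq> 0} \<in> sets (chart_measure n)"
    and "AE x in chart_measure n. HR (chart_rep n x) \<noteq> 0"
proof -
  have meas: "(\<lambda>x. chart_rep n x i) \<in> borel_measurable (chart_measure n)" for i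
  proof -
    have [measurable]: "(\<lambda>x. fst x) \<in> borel_measurable (chart_measure n)"
      "(\<lambda>x. snd (snd x)) \<in> borel_measurable (chart_measure n)"
      unfolding chart_measure_def by measurable
    have [measurable]: "pad \<in> borel_measurable borel"
      by (intro borel_measurable_continuous_onI linear_continuous_on bounded_linear_pad)
    have f: "(\<lambda>x. fst (snd x) i) \<in> borel_measurable (chart_measure n)" if "i \<in> {2..<n - 1}"
      using that unfolding chart_measure_def by measurable
    consider "i = 1" | "i \<noteq> 1" "i = n - 1" | "i \<noteq> 1" "i \<noteq> n - 1" "i \<in> {2..<n - 1}" | "i \<noteq> 1" "i \<noteq> n - 1" "i \<notin> {2..<n - 1}"
      by blast
    then show ?thesis
    proof cases
      case 1
      then show ?thesis by (simp add: chart_rep_def case_prod_beta)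
    next
      case 2
      then show ?thesis by (simp add: chart_rep_def case_prod_beta)
    next
      case 3
      note [measurable] = f[OF 3(3)]
      show ?thesis using 3 by (simp add: chart_rep_def case_prod_beta)
    next
      case 4
      then have "(\<lambda>x. chart_rep n x i) = (\<lambda>x. 0)" by (auto simp: chart_rep_def case_prod_beta)
      then show ?thesis by simp
    qed
  qed
  have mHR: "(\<lambda>x. HR (chart_rep n x)) \<in> borel_measurable (chart_measure n)"
    by (rule measurable_HR[OF meas])
  then show sets: "{x \<in> space (chart_measure n). HR (chart_rep n x) \<noteq> 0} \<in> sets (chart_measure n)"
    by measurable
  let ?I = "{2..<n - 1}"
  let ?P = "Pi\<^sub>M ?I (\<lambda>_. proj_measure :: (real \<times> real \<times> real) proj measure)"
  let ?M = "proj_measure :: (real \<times> real) proj measure"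
  interpret product_sigma_finite "\<lambda>_ :: nat. proj_measure :: (real \<times> real \<times> real) proj measure"
    by (simp add: product_sigma_finite_def sigma_finite_proj_measure)
  interpret P: sigma_finite_measure ?P by (rule sigma_finite) simp
  interpret M: sigma_finite_measure ?M by (rule sigma_finite_proj_measure)
  interpret PM: pair_sigma_finite ?P ?M ..
  interpret MPM: pair_sigma_finite ?M "?P \<Otimes>\<^sub>M ?M"
    unfolding pair_sigma_finite_def using PM.sigma_finite_measure_axioms M.sigma_finite_measure_axioms by simp
  have eq: "HR (w(1 := pad (fst (w 1), fst (snd (w 1))))) = HR w"
    by (intro cong) (auto simp: pad_def)
  have "HR (w(1 := pad (fst (w 1), fst (snd (w 1))))) \<noteq> 0" unfolding eq by (rule w)
  then have "AE p in ?M. HR (w(1 := pad (proj_rep p))) \<noteq> 0"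
    by (rule AE_factor[OF _ bounded_linear_pad AE_linepoly_2])
  then have "AE p in ?M. AE z in ?P \<Otimes>\<^sub>M ?M. HR (chart_rep n (p, z)) \<noteq> 0"
  proof eventually_elim
    case p: (elim p)
    have "AE f in ?P. AE q in ?M. HR (chart_rep n (p, f, q)) \<noteq> 0"
      using AE_PiM[OF finite_atLeastLessThan p]
    proof eventually_elim
      case (elim f)
      let ?v = "\<lambda>i. if i \<in> ?I then proj_rep (f i) else (w(1 := pad (proj_rep p))) i"
      have eq: "HR (?v(n - 1 := pad (fst (?v (n - 1)), fst (snd (?v (n - 1)))))) = HR ?v"
        by (intro cong) (auto simp: pad_def)
      have "HR (?v(n - 1 := pad (fst (?v (n - 1)), fst (snd (?v (n - 1)))))) \<noteq> 0"
        unfolding eq by (rule elim)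
      then have "AE q in ?M. HR (?v(n - 1 := pad (proj_rep q))) \<noteq> 0"
        by (rule AE_factor[OF _ bounded_linear_pad AE_linepoly_2])
      moreover have "HR (?v(n - 1 := pad (proj_rep q))) = HR (chart_rep n (p, f, q))" for q
        using n by (intro cong) (auto simp: chart_rep_def)
      ultimately show ?case by simp
    qed
    moreover have "(\<lambda>z. HR (chart_rep n (p, z))) \<in> borel_measurable (?P \<Otimes>\<^sub>M ?M)"
      by (rule measurable_compose[OF _ mHR[unfolded chart_measure_def]]) measurable
    then have "{z \<in> space (?P \<Otimes>\<^sub>M ?M). HR (chart_rep n (p, z)) \<noteq> 0} \<in> sets (?P \<Otimes>\<^sub>M ?M)"
      by measurable
    ultimately show ?case by (rule PM.AE_pair_measure[rotated])
  qed
  then show "AE x in chart_measure n. HR (chart_rep n x) \<noteq> 0"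
    using sets unfolding chart_measure_def by (rule MPM.AE_pair_measure[rotated])
qed

section \<open>Nonvanishing loci in the moduli space\<close>

lemma norm_lines_creal: "norm_lines n (\<lambda>i. creal (u i)) = (\<lambda>i. creal (norm_lines n u i))"
  by (rule ext) (simp add: norm_lines_def prod_eq_iff)

lemma normalise_id:
  assumes "vtx ws 0 = 0" "vtx ws 1 = 1" "3 \<le> length ws"
  shows "normalise ws = ws"
proof -
  have "ws ! 0 = 0" "ws ! 1 = 1" using assms by (simp_all add: vtx_def)
  then show ?thesis by (simp add: normalise_def)
qed

lemma moduli_normalised:
  assumes "C \<in> moduli n"
  obtains ws where "ws \<in> C" "ws \<in> polygons n" "vtx ws 0 = 0" "vtx ws 1 = 1" "normalise ws = ws"
    "\<And>vs. vs \<in> C \<Longrightarrow> vs \<in> polygons n \<and> normalise vs = ws"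
proof -
  obtain vs where vs: "vs \<in> C" "vs \<in> polygons n" using moduli_nonempty_class[OF assms] by blast
  note nn = normalise_nth[OF vs(2)]
  have C: "C \<in> polygons n // similar_polygons n" using assms by (simp add: moduli_def)
  have "normalise vs \<in> C"
    using C vs similar_normalise[OF vs(2)] quotient_eq_iff[OF equiv_similar_polygons C C vs(1)]
    by (metis in_quotient_imp_closed equiv_similar_polygons)
  moreover have "normalise (normalise vs) = normalise vs"
    using nn by (intro normalise_id) (auto simp: polygons_def convex_polygon_def)
  moreover have "us \<in> polygons n \<and> normalise us = normalise vs" if "us \<in> C" for us
  proof -
    have "(vs, us) \<in> similar_polygons n"
      using that vs C equiv_similar_polygons by (metis quotient_eq_iff)
    then obtain a b where "us \<in> polygons n" "a \<noteq> 0" "us = map (\<lambda>z. a * z + b) vs"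
      by (auto simp: similar_polygons_def)
    moreover have "3 \<le> length vs" using vs by (simp add: polygons_def convex_polygon_def)
    ultimately show ?thesis using normalise_similar by blast
  qed
  ultimately show thesis using that nn by blast
qed

lemma moduli_class:
  assumes "ws \<in> polygons n"
  shows "similar_polygons n `` {ws} \<in> moduli n" "ws \<in> similar_polygons n `` {ws}"
  using assms equiv_class_self[OF equiv_similar_polygons] by (auto simp: moduli_def quotientI)

text \<open>The values at 0 and beyond the last side follow the convention of
  \<open>norm_lines\<close>, so the lines of a normalised polygon are a fixed point of
  \<open>norm_lines\<close>.\<close>

definition poly_lines :: "complex list \<Rightarrow> nat \<Rightarrow> real \<times> real \<times> real" where
  "poly_lines ws i = (if i = 0 \<or> length ws \<le> i then (0, 1, 0) else line_coords (vtx ws i) (vtx ws (Suc i)))"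

lemma pad_scaleR: "pad (c *\<^sub>R y) = c *\<^sub>R pad y"
  by (simp add: pad_def)

text \<open>Side 1 starts at 1 and side \<open>n - 1\<close> ends at 0, so the constant coefficients
  that \<open>norm_lines\<close> restores there are the true ones. What remains free is a nonzero
  factor on each line.\<close>

lemma norm_lines_chart_rep:
  assumes ws: "ws \<in> polygons n" "vtx ws 0 = 0" "vtx ws 1 = 1"
  shows "\<exists>c. (\<forall>i. c i \<noteq> 0) \<and> norm_lines n (chart_rep n (side_lines ws)) = (\<lambda>i. c i *\<^sub>R poly_lines ws i)"
proof -
  let ?W = "vtx ws" and ?x = "side_lines ws"
  have conv: "convex_polygon ws" and n: "3 \<le> n" "length ws = n"
    using ws by (auto simp: polygons_def convex_polygon_def)
  have nid: "normalise ws = ws" using ws n by (intro normalise_id) auto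
  have ne: "?W i \<noteq> ?W (Suc i)" for i
    using convex_polygon_side_nz[OF conv, of i] by (simp add: side_def)
  have Wn: "?W n = 0" using ws n by (simp add: vtx_def)
  have "\<exists>c. c \<noteq> 0 \<and> norm_lines n (chart_rep n ?x) i = c *\<^sub>R poly_lines ws i" for i
  proof -
    consider "i = 0 \<or> n \<le> i" | "i = 1" | "i = n - 1" "i \<noteq> 0" "i \<noteq> 1" | "i \<in> {2..<n - 1}" by force
    then show ?thesis
    proof cases
      case 1
      then show ?thesis using n by (intro exI[of _ 1]) (auto simp: norm_lines_def poly_lines_def)
    next
      case 2
      obtain c where c: "c \<noteq> 0" "proj_rep (abs_proj (line_normal (?W 1) (?W 2))) = c *\<^sub>R line_normal (?W 1) (?W 2)"
        using proj_rep_abs line_normal_nz ne[of 1] by (metis Suc_1)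
      have "chart_rep n ?x 1 = c *\<^sub>R pad (line_normal (?W 1) (?W 2))"
        using c by (simp add: chart_rep_def side_lines_def Let_def nid pad_scaleR)
      then have "norm_lines n (chart_rep n ?x) 1 = c *\<^sub>R poly_lines ws 1"
        using n ws by (simp add: norm_lines_def poly_lines_def line_coords_def line_normal_def pad_def numeral_2_eq_2)
      then show ?thesis using 2 c by blast
    next
      case 3
      have nn: "Suc (n - 1) = n" using n by simp
      obtain c where c: "c \<noteq> 0" "proj_rep (abs_proj (line_normal (?W (n - 1)) (?W 0))) = c *\<^sub>R line_normal (?W (n - 1)) (?W 0)"
        using proj_rep_abs line_normal_nz ne[of "n - 1"] Wn nn ws(2) by metis
      have "chart_rep n ?x (n - 1) = c *\<^sub>R pad (line_normal (?W (n - 1)) (?W 0))"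
        using c 3 n by (simp add: chart_rep_def side_lines_def Let_def nid pad_scaleR)
      then have "norm_lines n (chart_rep n ?x) (n - 1) = c *\<^sub>R poly_lines ws (n - 1)"
        using n ws Wn nn 3 by (simp add: norm_lines_def poly_lines_def line_coords_def line_normal_def pad_def)
      then show ?thesis using 3 c by blast
    next
      case 4
      obtain c where c: "c \<noteq> 0" "proj_rep (abs_proj (line_coords (?W i) (?W (Suc i)))) = c *\<^sub>R line_coords (?W i) (?W (Suc i))"
        using proj_rep_abs line_coords_nz ne by blast
      have "norm_lines n (chart_rep n ?x) i = c *\<^sub>R poly_lines ws i"
        using c 4 n by (auto simp: norm_lines_def chart_rep_def side_lines_def Let_def nid poly_lines_def)
      then show ?thesis using c by blast
    qed
  qed
  then have "\<exists>c. \<forall>i. c i \<noteq> 0 \<and> norm_lines n (chart_rep n ?x) i = c i *\<^sub>R poly_lines ws i" by (rule choice[OF allI])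
  then show ?thesis by (auto simp: fun_eq_iff)
qed

lemma norm_lines_poly_lines:
  assumes ws: "ws \<in> polygons n" "vtx ws 0 = 0" "vtx ws 1 = 1"
  shows "norm_lines n (poly_lines ws) = poly_lines ws"
proof
  fix i
  have n: "3 \<le> n" "length ws = n" using ws by (auto simp: polygons_def convex_polygon_def)
  have Wn: "vtx ws n = 0" using ws n by (simp add: vtx_def)
  show "norm_lines n (poly_lines ws) i = poly_lines ws i"
    using n ws Wn by (auto simp: norm_lines_def poly_lines_def line_coords_def)
qed

locale avoidance =
  fixes n :: nat and F :: "(nat \<Rightarrow> ctriple) \<Rightarrow> complex"
  assumes nd: "nondeg n F" and n: "3 \<le> n"
begin

text \<open>With the normalisation made part of the function, \<open>H\<close> is defined on the
  vector space of all configurations, where single lines can be varied and segments can be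
  drawn.\<close>

definition H where "H u = F (norm_lines n u)"

lemma F_scale: "(\<And>i. c i \<noteq> 0) \<Longrightarrow> F (\<lambda>i. scale3 (c i) (l i)) = 0 \<longleftrightarrow> F l = 0"
  by (rule nondeg_scale[OF nd])

sublocale scale_invariant_polyfun H
proof
  show "polyfun H"
    unfolding H_def
  proof (rule polyfun_compose[OF polyfun_nondeg[OF nd]])
    fix i
    consider "i = 0 \<or> n \<le> i" | "i = 1" "i < n" | "i = n - 1" "i \<noteq> 0" "i \<noteq> 1" "i < n" | "i \<noteq> 0" "i < n" "i \<noteq> 1" "i \<noteq> n - 1"
      by linarith
    then have "polyfun (\<lambda>l. fst (norm_lines n l i)) \<and> polyfun (\<lambda>l. fst (snd (norm_lines n l i))) \<and>
      polyfun (\<lambda>l. snd (snd (norm_lines n l i)))"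
    proof cases
      case 1
      then have "norm_lines n l i = (0, 1, 0)" for l :: "nat \<Rightarrow> ctriple" by (auto simp: norm_lines_def)
      then show ?thesis by (simp add: polyfun.const)
    next
      case 2
      then have "norm_lines n l i = (fst (l i), fst (snd (l i)), - fst (l i))" for l :: "nat \<Rightarrow> ctriple"
        by (auto simp: norm_lines_def)
      then show ?thesis by (simp add: polyfun_intros)
    next
      case 3
      then have "norm_lines n l i = (fst (l i), fst (snd (l i)), 0)" for l :: "nat \<Rightarrow> ctriple"
        using n by (auto simp: norm_lines_def)
      then show ?thesis by (simp add: polyfun_intros)
    next
      case 4
      then have "norm_lines n l i = l i" for l :: "nat \<Rightarrow> ctriple" by (auto simp: norm_lines_def)
      then show ?thesis by (simp add: polyfun_intros)
    qed
    then show "polyfun (\<lambda>l. fst (norm_lines n l i))" "polyfun (\<lambda>l. fst (snd (norm_lines n l i)))"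
      "polyfun (\<lambda>l. snd (snd (norm_lines n l i)))" by auto
  qed
  fix c u assume c: "\<And>i :: nat. c i \<noteq> (0::complex)"
  \<comment> \<open>\<open>norm_lines\<close> resets some lines to \<open>(0, 1, 0)\<close> whatever
    their factors are; these lines get the factor 1.\<close>
  have "norm_lines n (\<lambda>i. scale3 (c i) (u i)) =
      (\<lambda>i. scale3 (if i = 0 \<or> n \<le> i then 1 else c i) (norm_lines n u i))"
    by (rule ext) (simp add: norm_lines_def prod_eq_iff)
  then show "H (\<lambda>i. scale3 (c i) (u i)) = 0 \<longleftrightarrow> H u = 0"
    unfolding H_def using c by (simp add: F_scale)
qed

definition good :: "complex list set set" where
  "good = {C \<in> moduli n. HR (chart_rep n (moduli_chart C)) \<noteq> 0}"

lemma HR_norm: "HR u = F (\<lambda>i. creal (norm_lines n u i))"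
  by (simp add: H_def norm_lines_creal)

lemma F_real_scale:
  assumes "\<And>i. c i \<noteq> 0"
  shows "F (\<lambda>i. creal (c i *\<^sub>R u i)) = 0 \<longleftrightarrow> F (\<lambda>i. creal (u i)) = 0"
proof -
  have "(\<lambda>i. creal (c i *\<^sub>R u i)) = (\<lambda>i. scale3 (of_real (c i)) (creal (u i)))"
    by (simp add: fun_eq_iff prod_eq_iff)
  then show ?thesis using F_scale[of "\<lambda>i. of_real (c i)"] assms by simp
qed

lemma HR_poly_lines:
  assumes ws: "ws \<in> polygons n" "vtx ws 0 = 0" "vtx ws 1 = 1"
  shows "HR (chart_rep n (side_lines ws)) = 0 \<longleftrightarrow> F (\<lambda>i. creal (poly_lines ws i)) = 0"
proof -
  obtain c where c: "\<And>i. c i \<noteq> 0" "norm_lines n (chart_rep n (side_lines ws)) = (\<lambda>i. c i *\<^sub>R poly_lines ws i)"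
    using norm_lines_chart_rep[OF ws] by blast
  show ?thesis unfolding HR_norm c(2) by (rule F_real_scale[OF c(1)])
qed

lemma goodD:
  assumes "C \<in> good" "vs \<in> C"
  shows "F (\<lambda>i. creal (poly_lines (normalise vs) i)) \<noteq> 0"
proof -
  have C: "C \<in> moduli n" using assms by (simp add: good_def)
  obtain ws where ws: "ws \<in> C" "ws \<in> polygons n" "vtx ws 0 = 0" "vtx ws 1 = 1" "normalise vs = ws"
    using moduli_normalised[OF C] assms(2) by metis
  show ?thesis
    using assms(1)[unfolded good_def mem_Collect_eq moduli_chart_eq[OF C ws(1)]] HR_poly_lines[OF ws(2-4)]
    unfolding ws(5) by simp
qed

lemma real_witness: "\<exists>r. HR r \<noteq> 0"
proof -
  obtain u where "H u \<noteq> 0" using nondeg_norm_witness[OF nd n] by (auto simp: H_def)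
  then show ?thesis using polyfun_real_witness[OF poly] by blast
qed

lemma AE_good: "AE C in moduli_measure n. C \<in> good"
proof -
  obtain r where r: "HR r \<noteq> 0" using real_witness by blast
  have cong: "H u = H v" if "\<And>i. 1 \<le> i \<Longrightarrow> i < n \<Longrightarrow> fst (u i) = fst (v i) \<and> fst (snd (u i)) = fst (snd (v i))"
    "\<And>i. 2 \<le> i \<Longrightarrow> i < n - 1 \<Longrightarrow> u i = v i" for u v
  proof -
    have "norm_lines n u = norm_lines n v"
    proof
      fix i
      show "norm_lines n u i = norm_lines n v i"
      proof -
        consider "i = 0 \<or> n \<le> i" | "i = 1 \<or> i = n - 1" "1 \<le> i" "i < n" | "2 \<le> i" "i < n - 1"
          by linarith
        then show ?thesis
        proof cases
          case 2
          then show ?thesis using that(1)[OF 2(2,3)] by (auto simp: norm_lines_def)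
        next
          case 3
          then show ?thesis using that(2)[OF 3] by (simp add: norm_lines_def)
        qed (auto simp: norm_lines_def)
      qed
    qed
    then show ?thesis by (simp add: H_def)
  qed
  have ae: "{x \<in> space (chart_measure n). HR (chart_rep n x) \<noteq> 0} \<in> sets (chart_measure n)"
    "AE x in chart_measure n. HR (chart_rep n x) \<noteq> 0"
    using cong by (rule AE_chart_measure[OF n _ r]; blast)+
  define N where "N = {x \<in> space (chart_measure n). HR (chart_rep n x) = 0}"
  have N: "N \<in> sets (chart_measure n)"
    using sets.compl_sets[OF ae(1)]
    by (rule back_subst[of "\<lambda>A. A \<in> sets (chart_measure n)"]) (auto simp: N_def)
  have N0: "emeasure (chart_measure n) N = 0"
    using ae(2) N by (subst (asm) AE_iff_measurable[OF N]) (auto simp: N_def)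
  define T where "T = moduli_chart -` N \<inter> moduli n"
  have T: "T \<in> sets (moduli_measure n)"
    unfolding sets_moduli_measure using N by (auto simp: T_def)
  have "emeasure (moduli_measure n) T = emeasure (chart_measure n) (moduli_chart ` T)"
    by (rule emeasure_moduli_measure[OF n T])
  also have "\<dots> \<le> emeasure (chart_measure n) N"
    using N by (intro emeasure_mono) (auto simp: T_def)
  finally have T0: "emeasure (moduli_measure n) T = 0" using N0 by simp
  show ?thesis
  proof (rule AE_I[OF _ T0 T], rule subsetI)
    fix C assume C: "C \<in> {C \<in> space (moduli_measure n). C \<notin> good}"
    then have C': "C \<in> moduli n" by (simp add: space_moduli_measure)
    moreover from this have "moduli_chart C \<in> space (chart_measure n)"
      using moduli_chart_image[OF n] by blast
    ultimately show "C \<in> T" using C by (auto simp: T_def N_def good_def)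
  qed
qed

end

section \<open>Openness and density in the moduli space\<close>

text \<open>The chord \<open>2 * sin (d / 2)\<close> is at most the angle \<open>d\<close>. With a
  suitable choice of sign, convergence in projective space therefore lifts to convergence of unit
  vectors.\<close>

lemma near_unit_rep:
  fixes p q :: "'a::euclidean_space proj"
  assumes v: "norm v = 1" "p = abs_proj v"
  shows "\<exists>u. norm u = 1 \<and> q = abs_proj u \<and> dist u v \<le> dist q p"
proof -
  obtain u where u: "norm u = 1" "q = abs_proj u" "u \<bullet> v \<ge> 0" "proj_angle q p = arccos (u \<bullet> v)"
    using proj_unit_reps[OF v] by blast
  define d where "d = dist q p"
  have d: "u \<bullet> v = cos d"
    using u inner_unit_bounds[OF u(1) v(1)] by (simp add: d_def dist_proj_def)
  have "(norm (u - v))\<^sup>2 = 2 - 2 * cos d"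
    unfolding power2_norm_eq_inner inner_diff_left inner_diff_right
    using u v by (simp add: inner_commute d[symmetric] dot_square_norm)
  also have "\<dots> = (2 * sin (d / 2))\<^sup>2"
    using cos_double_sin[of "d / 2"] by (simp add: power2_eq_square)
  also have "\<dots> \<le> d\<^sup>2"
    using abs_sin_x_le_abs_x[of "d / 2"] by (intro abs_le_square_iff[THEN iffD1]) simp
  finally have "norm (u - v) \<le> d" by (rule power2_le_imp_le) (simp add: d_def)
  then show ?thesis using u by (auto simp: dist_norm d_def)
qed

lemma proj_rep_scale:
  assumes "v \<noteq> 0" "q = abs_proj v"
  shows "\<exists>c. c \<noteq> 0 \<and> proj_rep q = c *\<^sub>R v"
  using proj_rep_abs[OF assms(1)] assms(2) by simp

lemma tendsto_abs_proj:
  fixes f :: "'b \<Rightarrow> 'a::euclidean_space"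
  assumes "(f \<longlongrightarrow> y) G" "y \<noteq> 0"
  shows "((\<lambda>t. abs_proj (f t)) \<longlongrightarrow> abs_proj y) G"
proof -
  have "isCont (abs_proj :: 'a \<Rightarrow> 'a proj) y"
    using continuous_on_abs_proj continuous_on_eq_continuous_at[of "- {0 :: 'a}" abs_proj] assms(2) by auto
  then show ?thesis using assms(1) by (rule isCont_tendsto_compose)
qed

lemma tendsto_meet:
  assumes "(f \<longlongrightarrow> l) G" "(g \<longlongrightarrow> m) G" "fst l * fst (snd m) - fst m * fst (snd l) \<noteq> 0"
  shows "((\<lambda>t. meet (f t) (g t)) \<longlongrightarrow> meet l m) G"
  unfolding meet_def case_prod_beta by (intro tendsto_intros assms)

lemma tendsto_line_normal:
  assumes "(f \<longlongrightarrow> p) G" "(g \<longlongrightarrow> q) G"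
  shows "((\<lambda>t. line_normal (f t) (g t)) \<longlongrightarrow> line_normal p q) G"
  unfolding line_normal_def by (intro tendsto_intros assms)

lemma tendsto_line_coords:
  assumes "(f \<longlongrightarrow> p) G" "(g \<longlongrightarrow> q) G"
  shows "((\<lambda>t. line_coords (f t) (g t)) \<longlongrightarrow> line_coords p q) G"
  unfolding line_coords_def by (intro tendsto_intros assms)

lemma tendsto_norm_lines:
  fixes u :: "'b \<Rightarrow> nat \<Rightarrow> real \<times> real \<times> real"
  assumes "((\<lambda>t. u t i) \<longlongrightarrow> l i) G"
  shows "((\<lambda>t. norm_lines n (u t) i) \<longlongrightarrow> norm_lines n l i) G"
  unfolding norm_lines_def using assms by (auto intro!: tendsto_intros)

lemma side_lines_normalised:
  assumes "vtx ws 0 = 0" "vtx ws 1 = 1" "3 \<le> length ws"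
  shows "side_lines ws = (abs_proj (line_normal (vtx ws 1) (vtx ws 2)),
      (\<lambda>i\<in>{2..<length ws - 1}. abs_proj (line_coords (vtx ws i) (vtx ws (Suc i)))),
      abs_proj (line_normal (vtx ws (length ws - 1)) (vtx ws 0)))"
  using normalise_id[OF assms] by (simp add: side_lines_def Let_def)

lemma chart_dist_bounds:
  assumes "chart_dist n (p, f, q) (p', f', q') \<le> e"
  shows "dist p p' \<le> e" "dist q q' \<le> e" "i \<in> {2..<n - 1} \<Longrightarrow> dist (f i) (f' i) \<le> e"
proof -
  have S: "0 \<le> (\<Sum>i\<in>{2..<n - 1}. (dist (f i) (f' i))\<^sup>2)" by (simp add: sum_nonneg)
  have c: "x \<le> e" if "x\<^sup>2 \<le> (dist p p')\<^sup>2 + (\<Sum>i\<in>{2..<n - 1}. (dist (f i) (f' i))\<^sup>2) + (dist q q')\<^sup>2" for x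
    using real_le_rsqrt[OF that] assms by (simp add: chart_dist_def)
  show "dist p p' \<le> e" "dist q q' \<le> e" by (rule c, use S in simp)+
  show "dist (f i) (f' i) \<le> e" if "i \<in> {2..<n - 1}"
  proof (rule c)
    have "(dist (f i) (f' i))\<^sup>2 \<le> (\<Sum>i\<in>{2..<n - 1}. (dist (f i) (f' i))\<^sup>2)"
      using member_le_sum[OF that, of "\<lambda>i. (dist (f i) (f' i))\<^sup>2"] by simp
    then show "(dist (f i) (f' i))\<^sup>2 \<le> (dist p p')\<^sup>2 + (\<Sum>i\<in>{2..<n - 1}. (dist (f i) (f' i))\<^sup>2) + (dist q q')\<^sup>2"
      by (smt (verit) zero_le_power2)
  qed
qed

lemma line_coords_proportional:
  fixes l :: "real \<times> real \<times> real"
  assumes "P \<noteq> Q" "(fst l, fst (snd l)) \<noteq> (0, 0)"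
    "fst l * Re P + fst (snd l) * Im P + snd (snd l) = 0" "fst l * Re Q + fst (snd l) * Im Q + snd (snd l) = 0"
  shows "\<exists>k. k \<noteq> 0 \<and> line_coords P Q = k *\<^sub>R l"
proof -
  define a b c where "a = fst l" "b = fst (snd l)" "c = snd (snd l)"
  define x y where "x = Re (Q - P)" "y = Im (Q - P)"
  have l: "l = (a, b, c)" by (simp add: a_b_c_def)
  have N: "a\<^sup>2 + b\<^sup>2 \<noteq> 0" using assms(2) by (simp add: a_b_c_def sum_power2_eq_zero_iff)
  have 0: "a * x + b * y = 0" using assms(3,4) by (simp add: a_b_c_def x_y_def algebra_simps)
  have c: "c = - (a * Re P + b * Im P)" using assms(3) by (simp add: a_b_c_def)
  \<comment> \<open>The direction \<open>(x, y)\<close> is orthogonal to \<open>(a, b)\<close>, so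
    \<open>(- y, x)\<close> is a multiple of \<open>(a, b)\<close>; this is the factor.\<close>
  define k where "k = (b * x - a * y) / (a\<^sup>2 + b\<^sup>2)"
  have ka: "k * a = - y"
  proof -
    have "(b * x - a * y) * a = b * (a * x) - a\<^sup>2 * y" by (simp add: algebra_simps power2_eq_square)
    also have "a * x = - (b * y)" using 0 by simp
    finally have "(b * x - a * y) * a = - y * (a\<^sup>2 + b\<^sup>2)" by (simp add: algebra_simps power2_eq_square)
    then show ?thesis using N by (simp add: k_def field_simps)
  qed
  have kb: "k * b = x"
  proof -
    have "(b * x - a * y) * b = b\<^sup>2 * x - a * (b * y)" by (simp add: algebra_simps power2_eq_square)
    also have "b * y = - (a * x)" using 0 by simp
    finally have "(b * x - a * y) * b = x * (a\<^sup>2 + b\<^sup>2)" by (simp add: algebra_simps power2_eq_square)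
    then show ?thesis using N by (simp add: k_def field_simps)
  qed
  have "x \<noteq> 0 \<or> y \<noteq> 0" using assms(1) by (auto simp: x_y_def complex_eq_iff)
  then have "k \<noteq> 0" using ka kb by auto
  moreover have "line_coords P Q = (- y, x, y * Re P - x * Im P)" by (simp add: line_coords_def x_y_def)
  moreover have "k * c = y * Re P - x * Im P"
  proof -
    have "k * c = - ((k * a) * Re P + (k * b) * Im P)" unfolding c by (simp add: algebra_simps)
    then show ?thesis unfolding ka kb by simp
  qed
  ultimately show ?thesis using ka kb unfolding l by (intro exI[of _ k]) simp
qed

context avoidance
begin

text \<open>This is \<open>chart_rep\<close> with representatives of choice. Only measurability is
  known of \<open>proj_rep\<close>, so limits are taken along unit vectors that are chosen to
  converge.\<close>

definition rep_config :: "real \<times> real \<Rightarrow> (nat \<Rightarrow> real \<times> real \<times> real) \<Rightarrow> real \<times> real \<Rightarrow> nat \<Rightarrow> real \<times> real \<times> real" where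
  "rep_config u v w i = (if i = 1 then pad u else if i = n - 1 then pad w else if i \<in> {2..<n - 1} then v i else 0)"

lemma HR_rep_config:
  assumes "u \<noteq> 0" "w \<noteq> 0" "\<And>i. v i \<noteq> 0" "p = abs_proj u" "q = abs_proj w"
    "\<And>i. f i = abs_proj (v i)"
  shows "HR (chart_rep n (p, f, q)) = 0 \<longleftrightarrow> HR (rep_config u v w) = 0"
proof -
  obtain cu where cu: "cu \<noteq> 0" "proj_rep p = cu *\<^sub>R u" using proj_rep_scale[OF assms(1,4)] by blast
  obtain cw where cw: "cw \<noteq> 0" "proj_rep q = cw *\<^sub>R w" using proj_rep_scale[OF assms(2,5)] by blast
  have "\<forall>i. \<exists>c. c \<noteq> 0 \<and> proj_rep (f i) = c *\<^sub>R v i" using proj_rep_scale[OF assms(3,6)] by blast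
  then obtain cv where cv: "\<And>i. cv i \<noteq> 0" "\<And>i. proj_rep (f i) = cv i *\<^sub>R v i" by metis
  define c where "c i = (if i = 1 then cu else if i = n - 1 then cw else cv i)" for i
  have "chart_rep n (p, f, q) = (\<lambda>i. c i *\<^sub>R rep_config u v w i)"
    by (rule ext) (simp add: chart_rep_def c_def rep_config_def cu cw cv pad_scaleR)
  moreover have "c i \<noteq> 0" for i using cu cw cv by (simp add: c_def)
  ultimately show ?thesis using HR_scale[of c] by simp
qed

text \<open>Classes outside \<open>good\<close> that converge to \<open>C\<close> have unit
  representatives converging to those of \<open>C\<close>. The polynomial vanishes along the
  sequence, hence at the limit.\<close>

lemma openin_good: "openin (moduli_topology n) good"
proof -
  interpret M: Metric_space "moduli n" "moduli_dist n" by (rule Metric_space_moduli)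
  show ?thesis
    unfolding moduli_topology_def M.openin_mtopology
  proof (intro conjI allI impI)
    show "good \<subseteq> moduli n" by (auto simp: good_def)
    fix C assume C: "C \<in> good"
    show "\<exists>r>0. M.mball C r \<subseteq> good"
    proof (rule ccontr)
      assume "\<not> ?thesis"
      then have "\<exists>D. D \<in> M.mball C (inverse (real (Suc k))) \<and> D \<notin> good" for k
        by (metis inverse_positive_iff_positive of_nat_0_less_iff subsetI zero_less_Suc)
      then obtain D where D: "\<And>k. D k \<in> M.mball C (inverse (real (Suc k)))" "\<And>k. D k \<notin> good" by metis
      obtain p f q where x: "moduli_chart C = (p, f, q)" by (cases "moduli_chart C")
      define p' f' q' where "p' k = fst (moduli_chart (D k))" "f' k = fst (snd (moduli_chart (D k)))"
        "q' k = snd (snd (moduli_chart (D k)))" for k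
      have x': "moduli_chart (D k) = (p' k, f' k, q' k)" for k by (simp add: p'_f'_q'_def)
      have le: "chart_dist n (p, f, q) (p' k, f' k, q' k) \<le> inverse (real (Suc k))" for k
        using D(1)[of k] x x' by (simp add: moduli_dist_def)
      obtain u where u: "norm u = 1" "p = abs_proj u" using proj_unit_rep by blast
      obtain w where w: "norm w = 1" "q = abs_proj w" using proj_unit_rep by blast
      have "\<forall>i. \<exists>v. norm v = 1 \<and> f i = abs_proj v" using proj_unit_rep by metis
      then obtain v where v: "\<And>i. norm (v i) = 1" "\<And>i. f i = abs_proj (v i)" by metis
      have "\<forall>k. \<exists>y. norm y = 1 \<and> p' k = abs_proj y \<and> dist y u \<le> dist (p' k) p"
        using near_unit_rep[OF u] by blast
      from choice[OF this] obtain u' where u': "\<And>k. norm (u' k) = 1" "\<And>k. p' k = abs_proj (u' k)" "\<And>k. dist (u' k) u \<le> dist (p' k) p"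
        by blast
      have "\<forall>k. \<exists>y. norm y = 1 \<and> q' k = abs_proj y \<and> dist y w \<le> dist (q' k) q"
        using near_unit_rep[OF w] by blast
      from choice[OF this] obtain w' where w': "\<And>k. norm (w' k) = 1" "\<And>k. q' k = abs_proj (w' k)" "\<And>k. dist (w' k) w \<le> dist (q' k) q"
        by blast
      have "\<forall>k i. \<exists>y. norm y = 1 \<and> f' k i = abs_proj y \<and> dist y (v i) \<le> dist (f' k i) (f i)"
        using near_unit_rep[OF v] by blast
      then obtain v' where v': "\<And>k i. norm (v' k i) = 1" "\<And>k i. f' k i = abs_proj (v' k i)"
        "\<And>k i. dist (v' k i) (v i) \<le> dist (f' k i) (f i)" by metis
      have lim: "g \<longlonglongrightarrow> y" if "\<And>k. dist (g k) y \<le> inverse (real (Suc k))" for g :: "nat \<Rightarrow> 'z::metric_space" and y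
        unfolding tendsto_dist_iff[of g]
        by (rule tendsto_sandwich[OF _ _ tendsto_const LIMSEQ_inverse_real_of_nat]) (use that in auto)
      have "u' \<longlonglongrightarrow> u"
        using u'(3) chart_dist_bounds(1)[OF le] by (intro lim) (metis dist_commute order_trans)
      then have u1: "(\<lambda>k. pad (u' k)) \<longlonglongrightarrow> pad u" unfolding pad_def by (intro tendsto_intros)
      have "w' \<longlonglongrightarrow> w"
        using w'(3) chart_dist_bounds(2)[OF le] by (intro lim) (metis dist_commute order_trans)
      then have w1: "(\<lambda>k. pad (w' k)) \<longlonglongrightarrow> pad w" unfolding pad_def by (intro tendsto_intros)
      have v1: "(\<lambda>k. v' k i) \<longlonglongrightarrow> v i" if "i \<in> {2..<n - 1}" for i
        using v'(3) chart_dist_bounds(3)[OF le that] by (intro lim) (metis dist_commute order_trans)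
      have "(\<lambda>k. rep_config (u' k) (v' k) (w' k) i) \<longlonglongrightarrow> rep_config u v w i" for i
        unfolding rep_config_def using u1 w1 v1[of i] by (cases "i \<in> {2..<n - 1}") auto
      then have "(\<lambda>k. HR (rep_config (u' k) (v' k) (w' k))) \<longlonglongrightarrow> HR (rep_config u v w)"
        by (intro polyfun_tendsto[OF poly] tendsto_creal)
      moreover have "HR (rep_config (u' k) (v' k) (w' k)) = 0" for k
      proof -
        have "D k \<in> moduli n" using D(1) by auto
        then have "HR (chart_rep n (p' k, f' k, q' k)) = 0" using D(2)[of k] x' by (simp add: good_def)
        moreover have "u' k \<noteq> 0" "w' k \<noteq> 0" "\<And>i. v' k i \<noteq> 0" using u' v' w' by (metis norm_zero zero_neq_one)+
        ultimately show ?thesis using HR_rep_config u'(2) v'(2) w'(2) by metis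
      qed
      ultimately have "HR (rep_config u v w) = 0" by (simp add: LIMSEQ_const_iff)
      moreover have "u \<noteq> 0" "w \<noteq> 0" "\<And>i. v i \<noteq> 0" using u v w by (metis norm_zero zero_neq_one)+
      ultimately have "HR (chart_rep n (p, f, q)) = 0" using HR_rep_config u(2) v(2) w(2) by metis
      then show False using C x by (simp add: good_def)
    qed
  qed
qed

text \<open>The lines of the polygon move along a segment towards a real witness, and
  \<open>H\<close> is a nonzero polynomial on this segment. The moved lines do not come as a
  polygon: the vertices are rebuilt by intersecting neighbours, and for small parameters the result
  is convex, is close to \<open>C\<close>, and has the prescribed lines.\<close>

lemma good_dense:
  assumes C: "C \<in> moduli n" and e: "0 < e"
  shows "\<exists>D\<in>good. moduli_dist n C D < e"
proof -
  obtain ws where ws: "ws \<in> C" "ws \<in> polygons n" "vtx ws 0 = 0" "vtx ws 1 = 1"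
    using moduli_normalised[OF C] by metis
  have conv: "convex_polygon ws" and len: "length ws = n" using ws by (auto simp: polygons_def)
  let ?W = "vtx ws" and ?l = "poly_lines ws"
  have mod: "?W i = ?W (i mod n)" for i by (simp add: vtx_def len)
  obtain r where r: "HR r \<noteq> 0" using real_witness by blast
  define u where "u t i = ?l i + t *\<^sub>R (r i - ?l i)" for t i
  define L where "L t = norm_lines n (u t)" for t
  obtain p where p: "\<And>t. HR (u t) = poly p (of_real t)"
    using polyfun_real_line[OF poly, of ?l "\<lambda>i. r i - ?l i"] unfolding u_def by blast
  have "u 1 = r" by (rule ext) (simp add: u_def)
  then have "poly p 1 \<noteq> 0" using p[of 1] r by simp
  then have fin: "finite {t :: real. poly p (of_real t) = 0}" by (intro finite_real_roots) auto
  have "\<forall>\<^sub>F t in nhds 0. t \<in> - ({t. poly p (of_real t) = 0} - {0})"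
    using fin by (intro eventually_nhds_in_open open_Compl finite_imp_closed) auto
  \<comment> \<open>The neighbourhood is punctured: the parameter 0 gives the polygon itself, which
    may be a zero.\<close>
  then have ev1: "\<forall>\<^sub>F t in at 0. HR (u t) \<noteq> 0"
    unfolding eventually_at_filter by eventually_elim (auto simp: p)
  have Ll: "((\<lambda>t. L t i) \<longlongrightarrow> ?l i) (at 0)" for i
  proof -
    have "((\<lambda>t. u t i) \<longlongrightarrow> ?l i + 0 *\<^sub>R (r i - ?l i)) (at 0)"
      unfolding u_def by (intro tendsto_intros)
    then have "((\<lambda>t. norm_lines n (u t) i) \<longlongrightarrow> norm_lines n ?l i) (at 0)"
      by (intro tendsto_norm_lines) simp
    then show ?thesis unfolding L_def norm_lines_poly_lines[OF ws(2-4)] .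
  qed
  define det :: "real \<times> real \<times> real \<Rightarrow> real \<times> real \<times> real \<Rightarrow> real"
    where "det l m = fst l * fst (snd m) - fst m * fst (snd l)" for l m
  have li: "?l i = line_coords (?W i) (?W (Suc i))" if "1 \<le> i" "i < n" for i
    using that by (simp add: poly_lines_def len)
  have cross: "Im (cnj (?W (Suc i) - ?W i) * (?W (Suc (Suc i)) - ?W (Suc i))) > 0" for i
    using convex_polygon_side_cross[OF conv, of i] by (simp add: side_def)
  have det: "det (?l i) (?l (Suc i)) \<noteq> 0" if "1 \<le> i" "Suc i < n" for i
    using cross[of i] that by (simp add: li det_def line_coords_def algebra_simps)
  have ev2: "\<forall>\<^sub>F t in at 0. \<forall>i\<in>{1..<n-1}. det (L t i) (L t (Suc i)) \<noteq> 0"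
  proof (intro eventually_ball_finite ballI)
    fix i assume i: "i \<in> {1..<n-1}"
    have "((\<lambda>t. det (L t i) (L t (Suc i))) \<longlongrightarrow> det (?l i) (?l (Suc i))) (at 0)"
      unfolding det_def by (intro tendsto_intros Ll)
    then show "\<forall>\<^sub>F t in at 0. det (L t i) (L t (Suc i)) \<noteq> 0"
      by (rule tendsto_imp_eventually_ne) (use i det in auto)
  qed simp
  define V where "V t i = (if i = 0 then 0 else if i = 1 then 1 else meet (L t (i - 1)) (L t i))" for t i
  have Vl: "((\<lambda>t. V t i) \<longlongrightarrow> ?W i) (at 0)" if i: "i < n" for i
  proof -
    consider "i = 0" | "i = 1" | k where "i = Suc k" "1 \<le> k" by (cases i) force+
    then show ?thesis
    proof cases
      case 3
      have "((\<lambda>t. meet (L t k) (L t (Suc k))) \<longlongrightarrow> meet (?l k) (?l (Suc k))) (at 0)"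
        using det[of k] i 3 by (intro tendsto_meet Ll) (auto simp: det_def)
      also have "meet (?l k) (?l (Suc k)) = ?W (Suc k)"
        using meet_line_coords[where c = 1 and d = 1 and p = "?W k" and q = "?W (Suc k)" and r = "?W (Suc (Suc k))"]
          less_imp_neq[OF cross[of k]] i 3 by (simp only: li scaleR_one) simp
      finally show ?thesis using 3 by (simp add: V_def)
    qed (use ws in \<open>auto simp: V_def\<close>)
  qed
  define wt where "wt t = map (V t) [0..<n]" for t
  have vwt: "vtx (wt t) i = V t (i mod n)" for t i using n by (simp add: wt_def vtx_def)
  have lwt: "length (wt t) = n" for t by (simp add: wt_def)
  have wt01: "vtx (wt t) 0 = 0" "vtx (wt t) 1 = 1" for t using n by (simp_all add: vwt V_def)
  have wl: "((\<lambda>t. vtx (wt t) i) \<longlongrightarrow> ?W i) (at 0)" for i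
    unfolding vwt mod[of i] using n by (intro Vl) simp
  have ev3: "\<forall>\<^sub>F t in at 0. wt t \<in> polygons n"
  proof -
    have "\<forall>\<^sub>F t in at 0. \<forall>i\<in>{..<n}. \<forall>j\<in>{..<n}. j \<noteq> i \<and> j \<noteq> Suc i mod n \<longrightarrow>
        0 < Im (cnj (side (wt t) i) * (vtx (wt t) j - vtx (wt t) i))"
    proof (intro eventually_ball_finite ballI finite_lessThan)
      fix i j assume ij: "i \<in> {..<n}" "j \<in> {..<n}"
      have "((\<lambda>t. Im (cnj (side (wt t) i) * (vtx (wt t) j - vtx (wt t) i))) \<longlongrightarrow>
          Im (cnj (side ws i) * (?W j - ?W i))) (at 0)"
        unfolding side_def by (intro tendsto_intros wl)
      note lim = order_tendstoD(1)[OF this]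
      have pos: "0 < Im (cnj (side ws i) * (?W j - ?W i))" if "j \<noteq> i \<and> j \<noteq> Suc i mod n"
        using conv ij that by (simp add: convex_polygon_def len)
      show "\<forall>\<^sub>F t in at 0. j \<noteq> i \<and> j \<noteq> Suc i mod n \<longrightarrow>
          0 < Im (cnj (side (wt t) i) * (vtx (wt t) j - vtx (wt t) i))"
      proof (cases "j \<noteq> i \<and> j \<noteq> Suc i mod n")
        case True
        show ?thesis by (rule eventually_mono[OF lim[OF pos[OF True]]]) blast
      qed auto
    qed
    then show ?thesis
      by (rule eventually_mono) (use n in \<open>auto simp: polygons_def convex_polygon_def lwt\<close>)
  qed
  have ne: "?W i \<noteq> ?W (Suc i)" for i
    using convex_polygon_side_nz[OF conv, of i] by (simp add: side_def)
  have Wn: "?W 0 = ?W n" by (simp add: vtx_def len)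
  have "((\<lambda>t. chart_dist n (side_lines ws) (side_lines (wt t))) \<longlongrightarrow> sqrt (0\<^sup>2 + (\<Sum>i\<in>{2..<n - 1}. 0\<^sup>2) + 0\<^sup>2)) (at 0)"
  proof -
    have d: "((\<lambda>t. dist y (g t)) \<longlongrightarrow> 0) (at 0)" if "(g \<longlongrightarrow> y) (at 0)"
      for g :: "real \<Rightarrow> 'z::metric_space" and y
      using that by (subst dist_commute) (rule tendsto_dist_iff[THEN iffD1])
    have ne1: "line_normal (?W 1) (?W 2) \<noteq> 0" using ne[of 1] by (intro line_normal_nz) (simp add: numeral_2_eq_2)
    have ne2: "line_normal (?W (n - 1)) (?W 0) \<noteq> 0"
      using ne[of "n - 1"] Wn n by (intro line_normal_nz) simp
    have len3: "3 \<le> length ws" "\<And>t. 3 \<le> length (wt t)" using n len lwt by auto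
    have 1: "((\<lambda>t. dist (abs_proj (line_normal (?W 1) (?W 2))) (abs_proj (line_normal (vtx (wt t) 1) (vtx (wt t) 2)))) \<longlongrightarrow> 0) (at 0)"
      by (intro d tendsto_abs_proj[OF _ ne1] tendsto_line_normal wl)
    have 2: "((\<lambda>t. dist (abs_proj (line_normal (?W (n - 1)) (?W 0))) (abs_proj (line_normal (vtx (wt t) (n - 1)) (vtx (wt t) 0)))) \<longlongrightarrow> 0) (at 0)"
      by (intro d tendsto_abs_proj[OF _ ne2] tendsto_line_normal wl)
    have 3: "((\<lambda>t. dist (abs_proj (line_coords (?W i) (?W (Suc i)))) (abs_proj (line_coords (vtx (wt t) i) (vtx (wt t) (Suc i))))) \<longlongrightarrow> 0) (at 0)" for i
      by (intro d tendsto_abs_proj[OF _ line_coords_nz[OF ne]] tendsto_line_coords wl)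
    show ?thesis
      unfolding side_lines_normalised[OF ws(3,4) len3(1)] side_lines_normalised[OF wt01 len3(2)] chart_dist_def
        prod.case len lwt
      by (intro tendsto_intros 1 2) (use 3 in simp)
  qed
  then have ev4: "\<forall>\<^sub>F t in at 0. chart_dist n (side_lines ws) (side_lines (wt t)) < e"
    using e by (intro order_tendstoD(2)) auto
  have "\<forall>\<^sub>F t in at (0::real). HR (u t) \<noteq> 0 \<and> (\<forall>i\<in>{1..<n-1}. det (L t i) (L t (Suc i)) \<noteq> 0) \<and>
      wt t \<in> polygons n \<and> chart_dist n (side_lines ws) (side_lines (wt t)) < e"
    using ev1 ev2 ev3 ev4 by eventually_elim auto
  from eventually_happens'[OF trivial_limit_at this]
  obtain t where t: "HR (u t) \<noteq> 0" "\<And>i. i\<in>{1..<n-1} \<Longrightarrow> det (L t i) (L t (Suc i)) \<noteq> 0"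
      "wt t \<in> polygons n" "chart_dist n (side_lines ws) (side_lines (wt t)) < e"
    by blast
  define D where "D = similar_polygons n `` {wt t}"
  have D: "D \<in> moduli n" "wt t \<in> D" using moduli_class[OF t(3)] by (auto simp: D_def)
  have chart: "moduli_chart D = side_lines (wt t)" by (rule moduli_chart_eq[OF D])
  have meet_on: "fst l * Re (meet l m) + fst (snd l) * Im (meet l m) + snd (snd l) = 0 \<and>
      fst m * Re (meet l m) + fst (snd m) * Im (meet l m) + snd (snd m) = 0"
    if d: "det l m \<noteq> 0" for l m
  proof -
    obtain a b c a' b' c' where lm: "l = (a, b, c)" "m = (a', b', c')" by (cases l; cases m)
    have d: "a * b' - a' * b \<noteq> 0" using d by (simp add: det_def lm)
    have "a * (b * c' - b' * c) + b * (c * a' - c' * a) + c * (a * b' - a' * b) = 0"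
      "a' * (b * c' - b' * c) + b' * (c * a' - c' * a) + c' * (a * b' - a' * b) = 0" by algebra+
    then show ?thesis using d by (simp add: lm meet_def divide_simps)
  qed
  \<comment> \<open>Both ends of side \<open>i\<close> lie on \<open>L t i\<close>, by the
    intersections or, at the vertices 0 and 1, by the normalisation. So the rebuilt polygon has the
    lines that it was built from.\<close>
  have propn: "\<exists>c. c \<noteq> 0 \<and> poly_lines (wt t) i = c *\<^sub>R L t i" for i
  proof (cases "i = 0 \<or> n \<le> i")
    case True
    then show ?thesis by (intro exI[of _ 1]) (auto simp: poly_lines_def L_def norm_lines_def lwt)
  next
    case False
    then have i: "1 \<le> i" "i < n" by auto
    have "(fst (L t i), fst (snd (L t i))) \<noteq> (0, 0)"
    proof (cases "i = 1")
      case True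
      have "1 \<in> {1..<n - 1}" using n by auto
      then show ?thesis using t(2)[of 1] True by (auto simp: det_def)
    next
      case False
      then have "i - 1 \<in> {1..<n - 1}" using i by auto
      then show ?thesis using t(2)[of "i - 1"] i by (auto simp: det_def)
    qed
    moreover have "vtx (wt t) i \<noteq> vtx (wt t) (Suc i)"
      using convex_polygon_side_nz[of "wt t" i] t(3) by (simp add: polygons_def side_def)
    moreover have "fst (L t i) * Re (vtx (wt t) i) + fst (snd (L t i)) * Im (vtx (wt t) i) + snd (snd (L t i)) = 0"
    proof (cases "i = 1")
      case True
      then show ?thesis using n wt01 by (simp add: L_def norm_lines_def)
    next
      case False
      then have "i - 1 \<in> {1..<n - 1}" "Suc (i - 1) = i" using i by auto
      then have d: "det (L t (i - 1)) (L t i) \<noteq> 0" using t(2)[of "i - 1"] by simp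
      have "vtx (wt t) i = meet (L t (i - 1)) (L t i)" using i False by (simp add: vwt V_def)
      then show ?thesis using meet_on[OF d] by simp
    qed
    moreover have "fst (L t i) * Re (vtx (wt t) (Suc i)) + fst (snd (L t i)) * Im (vtx (wt t) (Suc i)) + snd (snd (L t i)) = 0"
    proof (cases "i = n - 1")
      case True
      then have "vtx (wt t) (Suc i) = 0" using n by (simp add: vwt V_def)
      then show ?thesis using n True by (simp add: L_def norm_lines_def)
    next
      case False
      then have d: "det (L t i) (L t (Suc i)) \<noteq> 0" using t(2)[of i] i by simp
      have "vtx (wt t) (Suc i) = meet (L t i) (L t (Suc i))" using i False by (simp add: vwt V_def)
      then show ?thesis using meet_on[OF d] by simp
    qed
    ultimately show ?thesis
      using line_coords_proportional[of "vtx (wt t) i" "vtx (wt t) (Suc i)" "L t i"] i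
      by (simp add: poly_lines_def lwt)
  qed
  then obtain c where c: "\<And>i. c i \<noteq> 0" "\<And>i. poly_lines (wt t) i = c i *\<^sub>R L t i" by metis
  have "F (\<lambda>i. creal (poly_lines (wt t) i)) = 0 \<longleftrightarrow> HR (u t) = 0"
    unfolding c(2) HR_norm using F_real_scale[OF c(1)] by (simp add: L_def)
  then have "D \<in> good"
    using D t(1) HR_poly_lines[OF t(3) wt01] chart by (simp add: good_def)
  moreover have "moduli_dist n C D < e"
    using t(4) by (simp add: moduli_dist_def chart moduli_chart_eq[OF C ws(1)])
  ultimately show ?thesis by blast
qed

lemma closure_good: "moduli_topology n closure_of good = topspace (moduli_topology n)"
proof -
  interpret M: Metric_space "moduli n" "moduli_dist n" by (rule Metric_space_moduli)
  have "good \<subseteq> moduli n" by (auto simp: good_def)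
  then show ?thesis
    unfolding moduli_topology_def M.metric_closure_of M.topspace_mtopology
    using good_dense by (fastforce simp: M.in_mball)
qed

end

section \<open>The slap map of a convex polygon\<close>

definition left_det :: "complex list \<Rightarrow> nat \<Rightarrow> complex \<Rightarrow> real" where
  "left_det vs i p = Im (cnj (side vs i) * (p - vtx vs i))"

text \<open>The algebraic part of a slap orbit: \<open>r\<close> may have any sign and the points
  need not lie within the sides. The nonvanishing conditions ensure that the lines determine the
  start and every step, so that \<open>track\<close> computes these points.\<close>

definition slap_trace :: "complex list \<Rightarrow> nat \<Rightarrow> (nat \<Rightarrow> nat) \<Rightarrow> (nat \<Rightarrow> complex) \<Rightarrow> nat \<Rightarrow> bool" where
  "slap_trace vs b is xs k \<longleftrightarrow> itinerary (length vs) b is k \<and> Im (cnj (side vs (is 0)) * side vs b) \<noteq> 0 \<and>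
     left_det vs (is 0) (xs 0) = 0 \<and> left_det vs b (xs 0) = 0 \<and>
     (\<forall>m<k. Re (cnj (side vs (is m)) * side vs (is (Suc m))) \<noteq> 0 \<and> left_det vs (is (Suc m)) (xs (Suc m)) = 0 \<and>
        (\<exists>r. xs (Suc m) = xs m + of_real r * (\<i> * side vs (is m))))"

lemma tendsto_Min:
  fixes f :: "'a \<Rightarrow> 'b \<Rightarrow> real"
  assumes "finite J" "J \<noteq> {}" "\<And>j. j \<in> J \<Longrightarrow> ((\<lambda>u. f j u) \<longlongrightarrow> l j) G"
  shows "((\<lambda>u. Min ((\<lambda>j. f j u) ` J)) \<longlongrightarrow> Min (l ` J)) G"
  using assms
proof (induction J rule: finite_ne_induct)
  case (insert x J)
  have "((\<lambda>u. min (f x u) (Min ((\<lambda>j. f j u) ` J))) \<longlongrightarrow> min (l x) (Min (l ` J))) G"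
    using insert by (intro tendsto_min) auto
  then show ?case using insert by simp
qed simp

lemma left_det_normal: "left_det vs i (p + of_real r * (\<i> * side vs j)) = left_det vs i p + r * Re (cnj (side vs i) * side vs j)"
  by (simp add: left_det_def algebra_simps)

locale convex_poly =
  fixes vs :: "complex list"
  assumes conv: "convex_polygon vs"
begin

abbreviation "n \<equiv> length vs"
abbreviation "V \<equiv> vtx vs"
abbreviation "S \<equiv> side vs"
abbreviation "d \<equiv> left_det vs"

definition pred where "pred i = (if i = 0 then n - 1 else (i - 1) mod n)"
definition succ where "succ i = Suc i mod n"

definition pt where "pt i t = V i + of_real t * S i"
definition oseg where "oseg i = {pt i t | t. 0 < t \<and> t < 1}"
definition region where "region = {p. \<forall>j<n. 0 \<le> d j p}"
text \<open>Along the inner normal \<open>\<i> * S i\<close> the function \<open>d j\<close> changes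
  at the rate \<open>Re (cnj (S j) * S i)\<close>; from inside, only lines on which it decreases can
  be met.\<close>

definition facing where "facing i = {j. j < n \<and> Re (cnj (S j) * S i) < 0}"
definition hit_dist where "hit_dist i p = Min ((\<lambda>j. d j p / - Re (cnj (S j) * S i)) ` facing i)"
text \<open>The side is a parameter, so no case distinction arises at vertices:
  \<open>hit i (V i)\<close> and \<open>hit (pred i) (V i)\<close> are the two one-sided limits of
  the slap map at \<open>V i\<close>.\<close>

definition hit where "hit i p = p + of_real (hit_dist i p) * (\<i> * S i)"

lemma n3: "3 \<le> n" using conv by (simp add: convex_polygon_def)

lemma V_mod: "V (i mod n) = V i"
  by (simp add: vtx_def)

lemma V_succ: "V (succ i) = V (Suc i)"
  unfolding succ_def by (rule V_mod)

lemma pred_lt: "pred i < n" and succ_lt: "succ i < n"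
proof -
  have "0 < n" using n3 by linarith
  then show "pred i < n" "succ i < n" by (auto simp: pred_def succ_def)
qed

lemma pred_eq: "i < n \<Longrightarrow> pred i = (if i = 0 then n - 1 else i - 1)"
  and succ_eq: "i < n \<Longrightarrow> succ i = (if Suc i = n then 0 else Suc i)"
  by (auto simp: pred_def succ_def)

lemma succ_pred: "i < n \<Longrightarrow> succ (pred i) = i"
  using succ_eq[OF pred_lt[of i]] pred_eq[of i] n3 by (auto split: if_splits)

lemma pred_neq: "i < n \<Longrightarrow> pred i \<noteq> i" and succ_neq: "i < n \<Longrightarrow> succ i \<noteq> i"
  using n3 pred_eq[of i] succ_eq[of i] by (auto split: if_splits)

lemma succ_succ_neq: "i < n \<Longrightarrow> succ (succ i) \<noteq> i"
  using n3 succ_eq[of i] succ_eq[OF succ_lt[of i]] by (auto split: if_splits)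

lemma succ_inj: "i < n \<Longrightarrow> j < n \<Longrightarrow> succ i = succ j \<Longrightarrow> i = j"
  using succ_eq[of i] succ_eq[of j] by (auto split: if_splits)

lemma V_Suc_pred: "i < n \<Longrightarrow> V (Suc (pred i)) = V i"
  using V_succ[of "pred i"] succ_pred by simp

lemma S_nz: "S i \<noteq> 0" using convex_polygon_side_nz[OF conv] .

lemma d_V0: "d i (V i) = 0" "d i (V (Suc i)) = 0"
proof -
  show "d i (V i) = 0" unfolding left_det_def by simp
  have *: "Im (cnj z * z) = 0" for z by simp
  show "d i (V (Suc i)) = 0" unfolding left_det_def side_def[of vs i] by (rule *)
qed

lemma d_V_pos: "i < n \<Longrightarrow> j < n \<Longrightarrow> j \<noteq> i \<Longrightarrow> j \<noteq> succ i \<Longrightarrow> 0 < d i (V j)"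
  using conv unfolding convex_polygon_def left_det_def succ_def by blast

lemma d_V_nonneg: "i < n \<Longrightarrow> 0 \<le> d i (V j)"
proof -
  assume i: "i < n"
  have "j mod n < n" using n3 by (intro mod_less_divisor) linarith
  then have "0 \<le> d i (V (j mod n))"
    using d_V_pos[OF i, of "j mod n"] d_V0[of i] V_succ[of i] by (metis less_imp_le order_refl)
  then show ?thesis by (simp add: V_mod)
qed

lemma d_pt: "d j (pt i t) = (1 - t) * d j (V i) + t * d j (V (Suc i))"
  by (simp add: left_det_def pt_def side_def algebra_simps)

lemma d_pt_self: "d i (pt i t) = 0"
  by (simp add: d_pt d_V0)

text \<open>The ends of side \<open>i\<close> are not both on another side line, so
  \<open>d j\<close> is nonnegative at both and positive at one of them.\<close>

lemma d_pt_pos: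
  assumes "i < n" "j < n" "j \<noteq> i" "0 < t" "t < 1"
  shows "0 < d j (pt i t)"
proof -
  have "0 < d j (V i) \<or> 0 < d j (V (Suc i))"
  proof (cases "i = succ j")
    case True
    have "succ i \<noteq> j" "succ i \<noteq> succ j" using assms succ_succ_neq succ_inj True by auto
    then show ?thesis using d_V_pos[of j "succ i"] assms succ_lt V_succ by auto
  next
    case False
    then show ?thesis using d_V_pos[of j i] assms by auto
  qed
  then show ?thesis
    unfolding d_pt using assms d_V_nonneg[of j i] d_V_nonneg[of j "Suc i"]
    by (elim disjE) (simp_all add: add_pos_nonneg add_nonneg_pos)
qed

lemma oseg_d: "i < n \<Longrightarrow> p \<in> oseg i \<Longrightarrow> d i p = 0"
  and oseg_d_pos: "i < n \<Longrightarrow> p \<in> oseg i \<Longrightarrow> j < n \<Longrightarrow> j \<noteq> i \<Longrightarrow> 0 < d j p"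
  by (auto simp: oseg_def d_pt_self d_pt_pos)

lemma oseg_region: "i < n \<Longrightarrow> p \<in> oseg i \<Longrightarrow> p \<in> region"
proof -
  assume p: "i < n" "p \<in> oseg i"
  have "0 \<le> d j p" if "j < n" for j
    using oseg_d[OF p] oseg_d_pos[OF p that] by (cases "j = i") auto
  then show "p \<in> region" by (simp add: region_def)
qed

lemma oseg_unique: "i < n \<Longrightarrow> j < n \<Longrightarrow> p \<in> oseg i \<Longrightarrow> p \<in> oseg j \<Longrightarrow> i = j"
  using oseg_d oseg_d_pos by (metis less_irrefl)

lemma set_vs: "set vs = V ` {..<n}"
  by (auto simp: set_conv_nth vtx_def)

lemma d_pred_V: "i < n \<Longrightarrow> d (pred i) (V i) = 0"
  using d_V0(2)[of "pred i"] V_Suc_pred by simp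

lemma oseg_not_vertex: "i < n \<Longrightarrow> p \<in> oseg i \<Longrightarrow> p \<notin> set vs"
proof
  assume p: "i < n" "p \<in> oseg i" "p \<in> set vs"
  then obtain j where j: "j < n" "p = V j" by (auto simp: set_vs)
  have "j = i" using oseg_d_pos[OF p(1,2) j(1)] d_V0(1)[of j] j by auto
  moreover have "pred j = i" using oseg_d_pos[OF p(1,2) pred_lt[of j]] d_pred_V[OF j(1)] j by auto
  ultimately show False using pred_neq[OF j(1)] by simp
qed

lemma open_segment_oseg: "open_segment (V i) (V (Suc i)) = oseg i"
proof -
  have "V i \<noteq> V (Suc i)" using S_nz[of i] by (auto simp: side_def)
  moreover have "(1 - u) *\<^sub>R V i + u *\<^sub>R V (Suc i) = pt i u" for u
    by (simp add: pt_def side_def scaleR_conv_of_real algebra_simps)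
  ultimately show ?thesis by (auto simp: in_segment oseg_def)
qed

lemma closed_segment_pt: "closed_segment (V i) (V (Suc i)) = {pt i t | t. 0 \<le> t \<and> t \<le> 1}"
proof -
  have "(1 - u) *\<^sub>R V i + u *\<^sub>R V (Suc i) = pt i u" for u
    by (simp add: pt_def side_def scaleR_conv_of_real algebra_simps)
  then show ?thesis by (auto simp: in_segment)
qed

text \<open>The neighbouring sides bound the parameter: along line \<open>i\<close>,
  \<open>d (pred i)\<close> is a positive multiple of \<open>t\<close>, and
  \<open>d (succ i)\<close> one of \<open>1 - t\<close>.\<close>

lemma on_side:
  assumes "p \<in> region" "i < n" "d i p = 0"
  obtains t where "0 \<le> t" "t \<le> 1" "p = pt i t"
proof -
  define z where "z = (p - V i) / S i"
  have "Im z = Im (cnj (S i) * (p - V i)) / (norm (S i))\<^sup>2"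
    by (simp add: z_def complex_div_cnj[of _ "S i"] mult.commute Im_divide_of_real flip: of_real_power)
  then have "Im z = 0" using assms by (simp add: left_det_def)
  then have "z = of_real (Re z)" by (simp add: complex_eq_iff)
  then have p: "p = pt i (Re z)" using S_nz[of i] by (simp add: pt_def z_def field_simps)
  have "succ i \<noteq> pred i" using succ_succ_neq[OF assms(2)] succ_pred[OF assms(2)] succ_succ_neq[OF pred_lt[of i]] by metis
  then have "0 < d (pred i) (V (Suc i))"
    using d_V_pos[OF pred_lt[of i] succ_lt[of i]] succ_pred[OF assms(2)] succ_neq[OF assms(2)] by (simp add: V_succ)
  moreover have "0 \<le> d (pred i) p" using assms pred_lt by (auto simp: region_def)
  moreover have "d (pred i) p = Re z * d (pred i) (V (Suc i))"
    unfolding p d_pt by (simp add: d_pred_V[OF assms(2)])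
  ultimately have 0: "0 \<le> Re z" by (simp add: zero_le_mult_iff)
  have "0 < d (succ i) (V i)"
    using d_V_pos[OF succ_lt[of i] assms(2)] succ_neq[OF assms(2)] succ_succ_neq[OF assms(2)] by simp
  moreover have "0 \<le> d (succ i) p" using assms succ_lt by (auto simp: region_def)
  moreover have "d (succ i) p = (1 - Re z) * d (succ i) (V i)"
    using d_V0(1)[of "succ i"] unfolding p d_pt V_succ by simp
  ultimately have "Re z \<le> 1" by (simp add: zero_le_mult_iff)
  then show thesis using that 0 p by blast
qed

lemma in_osegI:
  assumes "p \<in> region" "i < n" "d i p = 0" "\<And>j. j < n \<Longrightarrow> j \<noteq> i \<Longrightarrow> d j p \<noteq> 0"
  shows "p \<in> oseg i"
proof -
  obtain t where t: "0 \<le> t" "t \<le> 1" "p = pt i t" using on_side[OF assms(1-3)] by blast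
  have "t \<noteq> 0"
  proof
    assume "t = 0"
    then have "p = V i" using t by (simp add: pt_def)
    then show False using assms(4)[OF pred_lt pred_neq[OF assms(2)]] d_pred_V[OF assms(2)] by simp
  qed
  moreover have "t \<noteq> 1"
  proof
    assume "t = 1"
    then have "p = V (succ i)" using t by (simp add: pt_def side_def V_succ)
    then show False using assms(4)[OF succ_lt succ_neq[OF assms(2)]] d_V0(1)[of "succ i"] by simp
  qed
  ultimately show ?thesis using t by (auto simp: oseg_def)
qed

lemma pt_region: "i < n \<Longrightarrow> 0 \<le> t \<Longrightarrow> t \<le> 1 \<Longrightarrow> pt i t \<in> region"
  unfolding region_def by (auto simp: d_pt d_V_nonneg)

lemma bdry_iff: "p \<in> bdry vs \<longleftrightarrow> p \<in> region \<and> (\<exists>i<n. d i p = 0)"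
proof
  assume "p \<in> bdry vs"
  then obtain i t where "i < n" "0 \<le> t" "t \<le> 1" "p = pt i t"
    by (auto simp: bdry_def closed_segment_pt)
  then show "p \<in> region \<and> (\<exists>i<n. d i p = 0)" using pt_region d_pt_self by auto
next
  assume "p \<in> region \<and> (\<exists>i<n. d i p = 0)"
  then obtain i where i: "p \<in> region" "i < n" "d i p = 0" by blast
  then obtain t where "0 \<le> t" "t \<le> 1" "p = pt i t" using on_side by blast
  then show "p \<in> bdry vs" using i by (auto simp: bdry_def closed_segment_pt)
qed

section \<open>The first hit of the inner normal\<close>

lemma sum_side: "(\<Sum>j<n. S j) = 0"
proof -
  have "(\<Sum>j<m. S j) = V m - V 0" for m by (induction m) (auto simp: side_def)
  then show ?thesis by (simp add: vtx_def)
qed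

lemma finite_facing: "finite (facing i)" by (simp add: facing_def)

lemma Re_cnj_self: "Re (cnj z * z) = (norm z)\<^sup>2"
  unfolding cmod_power2 by (simp add: power2_eq_square)

text \<open>The sides sum to 0, hence so do the numbers \<open>Re (cnj (S j) * S i)\<close>. The one
  for \<open>j = i\<close> is positive, so another one is negative.\<close>

lemma facing_nonempty:
  assumes "i < n"
  shows "facing i \<noteq> {}"
proof
  assume "facing i = {}"
  then have nn: "0 \<le> Re (cnj (S j) * S i)" if "j < n" for j using that by (force simp: facing_def)
  have "(\<Sum>j<n. Re (cnj (S j) * S i)) = Re (cnj (\<Sum>j<n. S j) * S i)"
    by (simp only: Re_sum[symmetric] sum_distrib_right[symmetric] cnj_sum)
  then have "(\<Sum>j<n. Re (cnj (S j) * S i)) = 0" by (simp add: sum_side)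
  then have "Re (cnj (S i) * S i) = 0" using nn assms by (subst (asm) sum_nonneg_eq_0_iff) auto
  then show False using S_nz[of i] unfolding Re_cnj_self by simp
qed

lemma d_hit: "d j (hit i p) = d j p + hit_dist i p * Re (cnj (S j) * S i)"
  unfolding hit_def by (rule left_det_normal)

lemma hit_dist_le: "j \<in> facing i \<Longrightarrow> hit_dist i p \<le> d j p / - Re (cnj (S j) * S i)"
  unfolding hit_dist_def using finite_facing by (intro Min_le) auto

lemma hit_dist_attained:
  assumes "i < n"
  obtains j where "j \<in> facing i" "hit_dist i p = d j p / - Re (cnj (S j) * S i)"
proof -
  have "hit_dist i p \<in> (\<lambda>j. d j p / - Re (cnj (S j) * S i)) ` facing i"
    unfolding hit_dist_def using finite_facing facing_nonempty[OF assms] by (intro Min_in) auto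
  then show thesis using that by blast
qed

lemma hit_dist_nonneg: "i < n \<Longrightarrow> p \<in> region \<Longrightarrow> 0 \<le> hit_dist i p"
  by (rule hit_dist_attained[of i p]) (auto simp: facing_def region_def divide_nonneg_neg divide_nonpos_pos)

lemma hit_dist_pos: "i < n \<Longrightarrow> (\<And>j. j \<in> facing i \<Longrightarrow> 0 < d j p) \<Longrightarrow> 0 < hit_dist i p"
  by (rule hit_dist_attained[of i p]) (auto simp: facing_def divide_pos_neg)

lemma hit_on_side:
  assumes "i < n"
  obtains j where "j \<in> facing i" "d j (hit i p) = 0"
proof -
  obtain j where j: "j \<in> facing i" "hit_dist i p = d j p / - Re (cnj (S j) * S i)" using hit_dist_attained[OF assms] .
  then have "d j (hit i p) = 0" unfolding d_hit by (simp add: facing_def field_simps)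
  then show thesis using that j by blast
qed

lemma d_normal_nonneg:
  assumes "i < n" "j < n" "p \<in> region" "0 \<le> r" "r \<le> hit_dist i p"
  shows "0 \<le> d j p + r * Re (cnj (S j) * S i)"
proof (cases "j \<in> facing i")
  case True
  then have c: "Re (cnj (S j) * S i) < 0" by (simp add: facing_def)
  have "r \<le> d j p / - Re (cnj (S j) * S i)" using hit_dist_le[OF True, of p] assms(5) by (rule order_trans[rotated])
  then have "r * - Re (cnj (S j) * S i) \<le> d j p" using c by (subst (asm) pos_le_divide_eq) auto
  then show ?thesis by (simp only: mult_minus_right)
next
  case False
  then have "0 \<le> Re (cnj (S j) * S i)" using assms by (metis (mono_tags, lifting) facing_def mem_Collect_eq not_less)
  moreover have "0 \<le> d j p" using assms by (simp add: region_def)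
  ultimately show ?thesis using assms(4) by (intro add_nonneg_nonneg mult_nonneg_nonneg)
qed

lemma hit_region: "i < n \<Longrightarrow> p \<in> region \<Longrightarrow> hit i p \<in> region"
  unfolding region_def mem_Collect_eq d_hit
  using d_normal_nonneg hit_dist_nonneg by (auto simp: region_def simp del: times_complex.sel)

lemma before_hit_interior:
  assumes "i < n" "p \<in> oseg i" "0 < r" "r < hit_dist i p" "j < n"
  shows "0 < d j (p + of_real r * (\<i> * S i))"
proof (cases "j = i")
  case True
  have "0 < Re (cnj (S i) * S i)" using S_nz[of i] unfolding Re_cnj_self by simp
  then show ?thesis unfolding left_det_normal using oseg_d[OF assms(1,2)] True assms(3) by simp
next
  case False
  then have dj: "0 < d j p" using oseg_d_pos assms by blast
  show ?thesis
  proof (cases "j \<in> facing i")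
    case True
    then have c: "Re (cnj (S j) * S i) < 0" by (simp add: facing_def)
    have "r < d j p / - Re (cnj (S j) * S i)" using hit_dist_le[OF True, of p] assms(4) by (rule less_le_trans[rotated])
    then have "r * - Re (cnj (S j) * S i) < d j p" using c by (subst (asm) pos_less_divide_eq) auto
    then show ?thesis unfolding left_det_normal by (simp only: mult_minus_right)
  next
    case False
    then have "0 \<le> Re (cnj (S j) * S i)" using assms by (metis (mono_tags, lifting) facing_def mem_Collect_eq not_less)
    then show ?thesis unfolding left_det_normal using dj assms(3) by (intro add_pos_nonneg mult_nonneg_nonneg) auto
  qed
qed

text \<open>Before \<open>hit_dist\<close> the ray is strictly inside, and at
  \<open>hit_dist\<close> it is on the boundary, which singles out the first hit. The normal is
  unique because open sides are disjoint.\<close>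

lemma slap_hit_eq:
  assumes "i < n" "p \<in> oseg i"
  shows "slap_hit vs p = hit i p"
  unfolding slap_hit_def
proof (rule the_equality)
  have p: "p \<in> region" using oseg_region assms by blast
  have i_notin: "i \<notin> facing i" using S_nz[of i] unfolding facing_def mem_Collect_eq Re_cnj_self by simp
  have Rp: "0 < hit_dist i p"
    using assms by (intro hit_dist_pos oseg_d_pos) (use i_notin in \<open>auto simp: facing_def\<close>)
  have hb: "hit i p \<in> bdry vs"
    unfolding bdry_iff using hit_region[OF assms(1) p] hit_on_side[OF assms(1)] by (metis (mono_tags, lifting) facing_def mem_Collect_eq)
  have nb: "p + of_real r * (\<i> * S i) \<notin> bdry vs" if "0 < r" "r < hit_dist i p" for r
    unfolding bdry_iff using before_hit_interior[OF assms that] by (metis less_irrefl)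
  show "\<exists>ia<n. p \<in> open_segment (V ia) (V (Suc ia)) \<and>
     (\<exists>r>0. hit i p = p + of_real r * (\<i> * S ia) \<and> hit i p \<in> bdry vs \<and>
        (\<forall>r'. 0 < r' \<and> r' < r \<longrightarrow> p + of_real r' * (\<i> * S ia) \<notin> bdry vs))"
    unfolding open_segment_oseg using assms Rp hb nb hit_def by blast
  fix q
  assume "\<exists>i<n. p \<in> open_segment (V i) (V (Suc i)) \<and>
     (\<exists>r>0. q = p + of_real r * (\<i> * S i) \<and> q \<in> bdry vs \<and>
        (\<forall>r'. 0 < r' \<and> r' < r \<longrightarrow> p + of_real r' * (\<i> * S i) \<notin> bdry vs))"
  then obtain i' r where q: "i' < n" "p \<in> oseg i'" "0 < r" "q = p + of_real r * (\<i> * S i')" "q \<in> bdry vs"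
    "\<And>r'. 0 < r' \<Longrightarrow> r' < r \<Longrightarrow> p + of_real r' * (\<i> * S i') \<notin> bdry vs"
    unfolding open_segment_oseg by blast
  have i': "i' = i" using oseg_unique q assms by blast
  have "r = hit_dist i p"
  proof (rule linorder_cases[of r "hit_dist i p"])
    assume "r < hit_dist i p" then show ?thesis using nb q i' by blast
  next
    assume "hit_dist i p < r" then show ?thesis using hb Rp q(6) unfolding i' hit_def by blast
  qed
  then show "q = hit i p" using q i' by (simp add: hit_def)
qed

lemma slap_oseg: "i < n \<Longrightarrow> p \<in> oseg i \<Longrightarrow> slap vs p = hit i p"
  using oseg_not_vertex slap_hit_eq by (simp add: slap_def)

text \<open>For a fixed side the facing lines do not depend on the point, and a minimum of finitely
  many affine functions is continuous, also where the side that is hit changes.\<close>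

lemma tendsto_hit:
  assumes "i < n" "(g \<longlongrightarrow> p) G"
  shows "((\<lambda>u. hit i (g u)) \<longlongrightarrow> hit i p) G"
proof -
  have "((\<lambda>u. d j (g u) / - Re (cnj (S j) * S i)) \<longlongrightarrow> d j p / - Re (cnj (S j) * S i)) G" if "j \<in> facing i" for j
    unfolding left_det_def by (rule tendsto_divide) (use that assms in \<open>auto intro!: tendsto_intros simp: facing_def\<close>)
  then have "((\<lambda>u. hit_dist i (g u)) \<longlongrightarrow> hit_dist i p) G"
    unfolding hit_dist_def using finite_facing facing_nonempty[OF assms(1)] by (intro tendsto_Min)
  then show ?thesis unfolding hit_def by (intro tendsto_intros assms)
qed

end

section \<open>One-sided limits of the slap map at the vertices\<close>

context convex_poly
begin

lemma not_facing_self: "i \<notin> facing i"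
  using S_nz[of i] unfolding facing_def mem_Collect_eq Re_cnj_self by simp

lemma arc_pos_Suc: "arc_pos vs (Suc i) = arc_pos vs i + norm (S i)"
  by (simp add: arc_pos_def)

lemma arc_pos_less: "i < j \<Longrightarrow> arc_pos vs i < arc_pos vs j"
  by (rule lift_Suc_mono_less) (use S_nz in \<open>auto simp: arc_pos_Suc\<close>)

lemma arc_pos_le: "i \<le> j \<Longrightarrow> arc_pos vs i \<le> arc_pos vs j"
  using arc_pos_less[of i j] by (cases "i = j") auto

lemma arc_pos_nonneg: "0 \<le> arc_pos vs i"
  by (simp add: arc_pos_def sum_nonneg)

lemma bdry_point_on:
  assumes "arc_pos vs i \<le> frac u" "frac u < arc_pos vs (Suc i)"
  shows "bdry_point vs u = pt i ((frac u - arc_pos vs i) / norm (S i))"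
proof -
  have "(LEAST i. frac u < arc_pos vs (Suc i)) = i"
  proof (rule Least_equality)
    show "frac u < arc_pos vs (Suc i)" by fact
    fix j assume "frac u < arc_pos vs (Suc j)"
    then show "i \<le> j" using assms arc_pos_le[of "Suc j" i] by (cases "i \<le> j") auto
  qed
  then show ?thesis
    by (simp add: bdry_point_def pt_def sgn_eq)
qed

text \<open>The quotient in \<open>internal_angle\<close> is \<open>- S (pred i) / S i\<close>, and
  an argument of at least \<open>pi / 2\<close> makes its real part at most 0. So the two sides at a
  non-acute vertex do not face each other.\<close>

lemma internal_angle_Re:
  assumes "i < n" "pi / 2 \<le> internal_angle vs i"
  shows "0 \<le> Re (cnj (S (pred i)) * S i)"
proof -
  define z where "z = (V (i + n - 1) - V i) / (V (i + 1) - V i)"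
  have "V (i + n - 1) = V (pred i)"
  proof (cases "i = 0")
    case False
    then have e: "i + n - 1 = (i - 1) + n" by simp
    have "V ((i - 1) + n) = V (i - 1)" unfolding vtx_def mod_add_self2 ..
    then show ?thesis unfolding e using False assms(1) by (simp add: pred_eq)
  next
    case True
    then show ?thesis using pred_eq[OF assms(1)] by simp
  qed
  then have z: "z = - S (pred i) / S i"
    unfolding z_def using V_Suc_pred[OF assms(1)] by (simp add: side_def)
  have "cos (Arg z) \<le> cos (pi / 2)"
    using assms(2) Arg_le_pi[of z] unfolding internal_angle_def z_def[symmetric]
    by (intro cos_monotone_0_pi_le) auto
  moreover have "Re z = norm z * cos (Arg z)"
    using rcis_cmod_Arg[of z] by (metis Re_rcis)
  ultimately have "Re z \<le> 0" by (simp add: mult_nonneg_nonpos)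
  moreover have "Re z = - Re (cnj (S (pred i)) * S i) / (norm (S i))\<^sup>2"
    unfolding z by (simp add: Re_divide cmod_power2 algebra_simps add_divide_distrib diff_divide_distrib)
  moreover have "0 < (norm (S i))\<^sup>2" using S_nz by simp
  ultimately show ?thesis by (auto simp: zero_le_divide_iff simp del: times_complex.sel)
qed

lemma V_inj: "i < n \<Longrightarrow> j < n \<Longrightarrow> V i = V j \<Longrightarrow> i = j"
proof (rule ccontr)
  assume ij: "i < n" "j < n" "V i = V j" "i \<noteq> j"
  then have "d i (V j) = 0" using d_V0[of i] by simp
  then have "j = succ i" using d_V_pos[OF ij(1,2)] ij(4) by force
  then have "V (Suc i) = V i" using ij V_succ[of i] by simp
  then show False using S_nz[of i] by (simp add: side_def)
qed

lemma oseg_slap_bdry_point: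
  assumes "i < n" "arc_pos vs i < frac u" "frac u < arc_pos vs (Suc i)"
  shows "slap vs (bdry_point vs u) = hit i (pt i ((frac u - arc_pos vs i) / norm (S i)))"
proof -
  let ?t = "(frac u - arc_pos vs i) / norm (S i)"
  have "0 < ?t" "?t < 1" using assms S_nz[of i] by (simp_all add: arc_pos_Suc divide_simps)
  then have "pt i ?t \<in> oseg i" by (auto simp: oseg_def)
  then show ?thesis using slap_oseg[OF assms(1)] bdry_point_on[of i u] assms by simp
qed

lemma slap_limits:
  assumes per: "perimeter vs = 1" and t: "bdry_point vs t \<in> set vs"
  obtains i where "i < n" "bdry_point vs t = V i"
    "Lim (at_right t) (\<lambda>u. slap vs (bdry_point vs u)) = hit i (V i)"
    "Lim (at_left t) (\<lambda>u. slap vs (bdry_point vs u)) = hit (pred i) (V i)"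
proof -
  have an: "arc_pos vs n = 1" using per by (simp add: perimeter_def arc_pos_def)
  define i where "i = (LEAST i. frac t < arc_pos vs (Suc i))"
  have "Suc (n - 1) = n" using n3 by linarith
  then have "frac t < arc_pos vs (Suc (n - 1))" using an frac_lt_1[of t] by (simp only:)
  then have i1: "frac t < arc_pos vs (Suc i)" and le: "i \<le> n - 1"
    unfolding i_def by (rule LeastI, rule Least_le)
  then have i: "i < n" using n3 by linarith
  have i2: "arc_pos vs i \<le> frac t"
  proof (cases i)
    case 0
    then show ?thesis by (simp add: arc_pos_def)
  next
    case (Suc k)
    then have "\<not> frac t < arc_pos vs (Suc k)" using not_less_Least[of k "\<lambda>i. frac t < arc_pos vs (Suc i)"] by (simp add: i_def)
    then show ?thesis using Suc by simp
  qed
  note bp = bdry_point_on[OF i2 i1]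
  \<comment> \<open>The half-open arc of side \<open>i\<close> contains no vertex except its
    starting point.\<close>
  have ft: "frac t = arc_pos vs i"
  proof (rule ccontr)
    assume "frac t \<noteq> arc_pos vs i"
    then have "0 < (frac t - arc_pos vs i) / norm (S i)" "(frac t - arc_pos vs i) / norm (S i) < 1"
      using i1 i2 S_nz[of i] by (simp_all add: arc_pos_Suc divide_simps)
    then have "bdry_point vs t \<in> oseg i" unfolding bp by (auto simp: oseg_def)
    then show False using oseg_not_vertex[OF i] t by blast
  qed
  have v: "bdry_point vs t = V i" unfolding bp ft by (simp add: pt_def)
  have fl: "t - frac t \<in> \<int>" by (simp add: frac_def)
  have "((\<lambda>u. slap vs (bdry_point vs u)) \<longlongrightarrow> hit i (V i)) (at_right t)"
  proof (rule Lim_transform_eventually)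
    have "((\<lambda>u. pt i ((u - t) / norm (S i))) \<longlongrightarrow> pt i ((t - t) / norm (S i))) (at_right t)"
      unfolding pt_def by (intro tendsto_intros) (use S_nz in auto)
    then show "((\<lambda>u. hit i (pt i ((u - t) / norm (S i)))) \<longlongrightarrow> hit i (V i)) (at_right t)"
      using tendsto_hit[OF i] by (simp add: pt_def)
    show "\<forall>\<^sub>F u in at_right t. hit i (pt i ((u - t) / norm (S i))) = slap vs (bdry_point vs u)"
    proof (rule eventually_at_rightI[of t "t + (arc_pos vs (Suc i) - arc_pos vs i)"])
      show "t < t + (arc_pos vs (Suc i) - arc_pos vs i)" using arc_pos_less[of i "Suc i"] by simp
      fix u assume u: "u \<in> {t<..<t + (arc_pos vs (Suc i) - arc_pos vs i)}"
      have "arc_pos vs (Suc i) \<le> 1" using arc_pos_le[of "Suc i" n] i an by simp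
      then have "frac u = arc_pos vs i + (u - t)"
        unfolding frac_unique_iff using u arc_pos_nonneg[of i] fl by (simp add: ft)
      then show "hit i (pt i ((u - t) / norm (S i))) = slap vs (bdry_point vs u)"
        using oseg_slap_bdry_point[OF i, of u] u by simp
    qed
  qed
  then have lim_right: "Lim (at_right t) (\<lambda>u. slap vs (bdry_point vs u)) = hit i (V i)"
    by (rule tendsto_Lim[rotated]) simp
  \<comment> \<open>\<open>E\<close> is the limit of \<open>frac\<close> from the left at
    \<open>t\<close>: it is 1 at vertex 0, where \<open>frac\<close> jumps, and
    \<open>frac t\<close> at the other vertices.\<close>
  define a E where "a = pred i" and "E = arc_pos vs (Suc a)"
  have a: "a < n" by (simp add: a_def pred_lt)
  have E: "E = (if i = 0 then 1 else frac t)"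
    using i n3 an by (auto simp: E_def a_def pred_eq ft)
  have E1: "E \<le> 1" using arc_pos_le[of "Suc a" n] a an by (simp add: E_def)
  have flE: "t - E \<in> \<int>" using fl arc_pos_Suc ft by (auto simp: E arc_pos_def Ints_diff)
  have "((\<lambda>u. slap vs (bdry_point vs u)) \<longlongrightarrow> hit a (V i)) (at_left t)"
  proof (rule Lim_transform_eventually)
    have "((\<lambda>u. pt a ((E + (u - t) - arc_pos vs a) / norm (S a))) \<longlongrightarrow> pt a ((E + (t - t) - arc_pos vs a) / norm (S a))) (at_left t)"
      unfolding pt_def by (intro tendsto_intros) (use S_nz in auto)
    moreover have "pt a ((E + (t - t) - arc_pos vs a) / norm (S a)) = V i"
      using V_Suc_pred[OF i] S_nz[of a] by (simp add: E_def arc_pos_Suc pt_def) (simp add: a_def side_def)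
    ultimately show "((\<lambda>u. hit a (pt a ((E + (u - t) - arc_pos vs a) / norm (S a)))) \<longlongrightarrow> hit a (V i)) (at_left t)"
      using tendsto_hit[OF a] by simp
    show "\<forall>\<^sub>F u in at_left t. hit a (pt a ((E + (u - t) - arc_pos vs a) / norm (S a))) = slap vs (bdry_point vs u)"
    proof (rule eventually_at_leftI[of "t - (E - arc_pos vs a)"])
      show "t - (E - arc_pos vs a) < t" using arc_pos_less[of a "Suc a"] by (simp add: E_def)
      fix u assume u: "u \<in> {t - (E - arc_pos vs a)<..<t}"
      have "frac u = E + (u - t)"
        unfolding frac_unique_iff using u arc_pos_nonneg[of a] flE E1 by simp
      then show "hit a (pt a ((E + (u - t) - arc_pos vs a) / norm (S a))) = slap vs (bdry_point vs u)"
        using oseg_slap_bdry_point[OF a, of u] u by (simp add: E_def)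
    qed
  qed
  then have lim_left: "Lim (at_left t) (\<lambda>u. slap vs (bdry_point vs u)) = hit a (V i)"
    by (rule tendsto_Lim[rotated]) simp
  show thesis using that[OF i v lim_right] lim_left by (simp add: a_def)
qed

end

section \<open>Orbits in a generic polygon\<close>

text \<open>The nonvanishing of \<open>orth_fun\<close>, \<open>hit_fun\<close> and
  \<open>coll_fun\<close>, restated for points of the plane; \<open>generic_polygonI\<close> makes
  the translation.\<close>

locale generic_polygon = convex_poly +
  assumes not_orth: "i < n \<Longrightarrow> j < n \<Longrightarrow> i \<noteq> j \<Longrightarrow> Re (cnj (S i) * S j) \<noteq> 0"
    and not_hit: "slap_trace vs b is xs (Suc k) \<Longrightarrow> e < n \<Longrightarrow> e \<noteq> is (Suc k) \<Longrightarrow> e \<noteq> is k \<Longrightarrow> d e (xs (Suc k)) \<noteq> 0"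
    and not_coll: "slap_trace vs b is xs (Suc k) \<Longrightarrow> m < k \<Longrightarrow> is (Suc m) = is (Suc k) \<Longrightarrow> is m \<noteq> is k \<Longrightarrow>
      xs (Suc m) \<noteq> xs (Suc k)"
begin

text \<open>The new point is in the open side \<open>q\<close> once it is on no other side line. For
  the side \<open>p\<close> just left, it has moved a positive distance along the normal; for a
  third side \<open>not_hit\<close> applies. Positivity on the facing lines is assumed in place of
  \<open>xs k \<in> oseg (is k)\<close> because the first point is a vertex.\<close>

lemma trace_extend:
  assumes tr: "slap_trace vs b is xs k" and reg: "xs k \<in> region" and pos: "\<And>j. j \<in> facing (is k) \<Longrightarrow> 0 < d j (xs k)"
    and x: "xs (Suc k) = hit (is k) (xs k)"
  shows "\<exists>q<n. slap_trace vs b (is(Suc k := q)) xs (Suc k) \<and> xs (Suc k) \<in> oseg q"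
proof -
  define p where "p = is k"
  have it: "itinerary n b is k" using tr by (simp add: slap_trace_def)
  then have p: "p < n" by (simp add: itinerary_def p_def)
  obtain q where q: "q \<in> facing p" "d q (hit p (xs k)) = 0" using hit_on_side[OF p] by blast
  have qn: "q < n" "q \<noteq> p" using q not_facing_self by (auto simp: facing_def)
  define is' where "is' = is(Suc k := q)"
  have ik: "is' (Suc k) = q" "is' k = p" "\<And>m. m \<le> k \<Longrightarrow> is' m = is m" by (auto simp: is'_def p_def)
  have dp: "d (is k) (xs k) = 0" using tr unfolding slap_trace_def by (cases k) auto
  have "itinerary n b is' (Suc k)"
    using it qn ik unfolding itinerary_def by (auto simp: le_Suc_eq less_Suc_eq)
  moreover have "Re (cnj (S p) * S q) \<noteq> 0" using not_orth[OF p qn(1)] qn(2) by simp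
  moreover have "\<exists>r. xs (Suc k) = xs k + of_real r * (\<i> * S p)" unfolding x hit_def p_def by blast
  moreover have "d q (xs (Suc k)) = 0" using q(2) x by (simp add: p_def)
  ultimately have tr': "slap_trace vs b is' xs (Suc k)"
    using tr ik unfolding slap_trace_def by (auto simp: less_Suc_eq simp del: times_complex.sel)
  have "xs (Suc k) \<in> region" unfolding x p_def[symmetric] by (rule hit_region[OF p reg])
  moreover have "d e (xs (Suc k)) \<noteq> 0" if e: "e < n" "e \<noteq> q" for e
  proof (cases "e = p")
    case True
    have "0 < hit_dist p (xs k)" using pos by (intro hit_dist_pos[OF p]) (simp add: p_def)
    moreover have "0 < Re (cnj (S p) * S p)" using S_nz[of p] unfolding Re_cnj_self by simp
    ultimately have "0 < hit_dist p (xs k) * Re (cnj (S p) * S p)" by (rule mult_pos_pos)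
    moreover have "d p (xs (Suc k)) = hit_dist p (xs k) * Re (cnj (S p) * S p)"
      unfolding x p_def[symmetric] d_hit using dp by (simp add: p_def del: times_complex.sel)
    ultimately show ?thesis unfolding True by (simp only:)
  next
    case False
    then show ?thesis using not_hit[OF tr' e(1)] e ik by simp
  qed
  ultimately have "xs (Suc k) \<in> oseg q"
    using qn(1) \<open>d q (xs (Suc k)) = 0\<close> by (intro in_osegI) auto
  then show ?thesis using qn(1) tr' unfolding is'_def by blast
qed

text \<open>The first step is \<open>hit a\<close> and not \<open>slap\<close>: at a vertex
  \<open>slap\<close> is the left limit, whereas orbits of both one-sided limits are
  followed.\<close>

lemma orbit_trace:
  assumes ab: "a < n" "b < n" "b \<noteq> a" "Im (cnj (S a) * S b) \<noteq> 0"
    and v: "v \<in> region" "d a v = 0" "d b v = 0" "\<And>j. j \<in> facing a \<Longrightarrow> 0 < d j v"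
    and xs: "xs 0 = v" "xs (Suc 0) = hit a v" "\<And>m. xs (Suc (Suc m)) = slap vs (xs (Suc m))"
  shows "\<exists>is. is 0 = a \<and> slap_trace vs b is xs (Suc k) \<and> (\<forall>m\<in>{1..Suc k}. xs m \<in> oseg (is m))"
proof (induction k)
  case 0
  have "slap_trace vs b (\<lambda>_. a) xs 0" using ab v xs by (auto simp: slap_trace_def itinerary_def)
  then obtain q where q: "q < n" "slap_trace vs b ((\<lambda>_. a)(Suc 0 := q)) xs (Suc 0)" "xs (Suc 0) \<in> oseg q"
    using trace_extend[of b "\<lambda>_. a" xs 0] v xs by auto
  define js where "js = (\<lambda>_. a)(Suc 0 := q)"
  have "js 0 = a" "js (Suc 0) = q" "slap_trace vs b js xs (Suc 0)" using q(2) by (simp_all add: js_def)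
  then show ?case using q(3) by (intro exI[of _ js]) auto
next
  case (Suc k)
  then obtain is' where is': "is' 0 = a" "slap_trace vs b is' xs (Suc k)" "\<And>m. m \<in> {1..Suc k} \<Longrightarrow> xs m \<in> oseg (is' m)" by blast
  have p: "is' (Suc k) < n" using is'(2) by (simp add: slap_trace_def itinerary_def)
  have o: "xs (Suc k) \<in> oseg (is' (Suc k))" using is'(3) by simp
  have "xs (Suc (Suc k)) = hit (is' (Suc k)) (xs (Suc k))" using xs(3) slap_oseg[OF p o] by simp
  moreover have "0 < d j (xs (Suc k))" if "j \<in> facing (is' (Suc k))" for j
    using that not_facing_self by (intro oseg_d_pos[OF p o]) (auto simp: facing_def)
  ultimately obtain q where q: "q < n" "slap_trace vs b (is'(Suc (Suc k) := q)) xs (Suc (Suc k))" "xs (Suc (Suc k)) \<in> oseg q"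
    using trace_extend[OF is'(2) oseg_region[OF p o]] by blast
  define js where "js = is'(Suc (Suc k) := q)"
  have js: "js 0 = a" "js (Suc (Suc k)) = q" "slap_trace vs b js xs (Suc (Suc k))" "\<And>m. m \<le> Suc k \<Longrightarrow> js m = is' m"
    using q(2) is'(1) by (simp_all add: js_def)
  have "xs m \<in> oseg (js m)" if "m \<in> {1..Suc (Suc k)}" for m
    using that js q(3) is'(3)[of m] by (cases "m = Suc (Suc k)") auto
  then show ?case using js by blast
qed

text \<open>Equal points lie in the same open side. If their preceding sides differ,
  \<open>not_coll\<close> applies; if they agree, the predecessors are equal too, since distinct
  points of a line have disjoint normals. The descent ends at the vertex \<open>xs 0\<close>, which
  is on line \<open>b\<close>, while the later point is in the open side \<open>is 0\<close>, off
  that line.\<close>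

lemma trace_neq:
  assumes tr: "slap_trace vs b is xs (Suc k)" and o: "\<And>m. m \<in> {1..Suc k} \<Longrightarrow> xs m \<in> oseg (is m)"
    and m: "m < k"
  shows "xs (Suc m) \<noteq> xs (Suc k)"
  using assms
proof (induction m arbitrary: k)
  case (0 k)
  show ?case
  proof
    assume eq: "xs (Suc 0) = xs (Suc k)"
    have it: "itinerary n b is (Suc k)" using 0 by (simp add: slap_trace_def)
    have lt: "is (Suc 0) < n" "is (Suc k) < n" "is k < n" "is 0 < n" using it by (auto simp: itinerary_def)
    have "is (Suc 0) = is (Suc k)"
      using oseg_unique[OF lt(1,2)] 0(2)[of "Suc 0"] 0(2)[of "Suc k"] eq by auto
    then have e: "is 0 = is k" using not_coll[OF 0(1,3)] eq by blast
    obtain k' where k': "k = Suc k'" using 0(3) by (cases k) auto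
    have "d (is 0) (xs 0) = 0" using 0(1) by (simp add: slap_trace_def)
    moreover have ok: "xs k \<in> oseg (is k)" using 0(2)[of k] k' by auto
    moreover obtain r r' where "xs (Suc 0) = xs 0 + of_real r * (\<i> * S (is 0))"
      "xs (Suc k) = xs k + of_real r' * (\<i> * S (is k))" using 0(1) unfolding slap_trace_def by blast
    then have x0: "xs 0 = xs k + of_real (r' - r) * (\<i> * S (is k))"
      using eq e by (simp add: algebra_simps)
    moreover have "d (is k) (xs k) = 0" using oseg_d[OF lt(3) ok] .
    moreover have "Re (cnj (S (is k)) * S (is k)) \<noteq> 0" using S_nz unfolding Re_cnj_self by simp
    ultimately have "r' - r = 0" unfolding e x0 left_det_normal by auto
    then have "xs 0 = xs k" using x0 by simp
    moreover have "d b (xs 0) = 0" using 0(1) by (simp add: slap_trace_def)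
    moreover have "b < n" "b \<noteq> is k" using it e by (auto simp: itinerary_def)
    ultimately show False using oseg_d_pos[OF lt(3) ok] by force
  qed
next
  case (Suc m k)
  show ?case
  proof
    assume eq: "xs (Suc (Suc m)) = xs (Suc k)"
    have it: "itinerary n b is (Suc k)" using Suc by (simp add: slap_trace_def)
    obtain k' where k': "k = Suc k'" "m < k'" using Suc(4) by (cases k) auto
    have lt: "is (Suc (Suc m)) < n" "is (Suc k) < n" "is k < n" "is (Suc m) < n"
      using it Suc(4) by (auto simp: itinerary_def)
    have "is (Suc (Suc m)) = is (Suc k)"
      using oseg_unique[OF lt(1,2)] Suc(3)[of "Suc (Suc m)"] Suc(3)[of "Suc k"] eq Suc(4) by auto
    then have e: "is (Suc m) = is k" using not_coll[OF Suc(2,4)] eq by blast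
    have ok: "xs k \<in> oseg (is k)" "xs (Suc m) \<in> oseg (is (Suc m))"
      using Suc(3)[of k] Suc(3)[of "Suc m"] Suc(4) by auto
    obtain r r' where "xs (Suc (Suc m)) = xs (Suc m) + of_real r * (\<i> * S (is (Suc m)))"
      "xs (Suc k) = xs k + of_real r' * (\<i> * S (is k))" using Suc(2,4) unfolding slap_trace_def by (metis less_Suc_eq lessI)
    then have x0: "xs (Suc m) = xs k + of_real (r' - r) * (\<i> * S (is k))"
      using eq e by (simp add: algebra_simps)
    moreover have "d (is k) (xs k) = 0" "d (is k) (xs (Suc m)) = 0"
      using oseg_d[OF lt(3) ok(1)] oseg_d[OF lt(4) ok(2)] e by auto
    moreover have "Re (cnj (S (is k)) * S (is k)) \<noteq> 0" using S_nz unfolding Re_cnj_self by simp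
    ultimately have "r' - r = 0" unfolding x0 left_det_normal by auto
    then have "xs (Suc m) = xs (Suc k')" using x0 k' by simp
    moreover have "slap_trace vs b is xs (Suc k')"
      using Suc(2) k' by (auto simp: slap_trace_def itinerary_def)
    ultimately show False using Suc(1)[of k'] Suc(3) k' by auto
  qed
qed

text \<open>\<open>xs\<close> is the orbit with the vertex put in front, so a return of
  \<open>y\<close> after \<open>l\<close> steps is a coincidence of \<open>xs (Suc j)\<close> and
  \<open>xs (Suc (l + j))\<close>. All vertices are avoided, acute ones included.\<close>

lemma slap_orbit_generic:
  assumes ab: "a < n" "b < n" "b \<noteq> a" "Im (cnj (S a) * S b) \<noteq> 0"
    and v: "v \<in> region" "d a v = 0" "d b v = 0" "\<And>j. j \<in> facing a \<Longrightarrow> 0 < d j v"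
    and y: "y \<in> forward_orbit (slap vs) (hit a v)"
  shows "y \<notin> set vs \<and> \<not> periodic_point (slap vs) y"
proof -
  define xs where "xs m = (case m of 0 \<Rightarrow> v | Suc m \<Rightarrow> (slap vs ^^ m) (hit a v))" for m
  have xs: "xs 0 = v" "xs (Suc 0) = hit a v" "\<And>m. xs (Suc (Suc m)) = slap vs (xs (Suc m))"
    "\<And>m. xs (Suc m) = (slap vs ^^ m) (hit a v)" by (simp_all add: xs_def)
  obtain j where j: "y = (slap vs ^^ j) (hit a v)" using y by (auto simp: forward_orbit_def)
  note ot = orbit_trace[OF ab v xs(1-3)]
  obtain js where is1: "slap_trace vs b js xs (Suc j)" "\<forall>m\<in>{1..Suc j}. xs m \<in> oseg (js m)" using ot[of j] by blast
  have "js (Suc j) < n" using is1(1) by (simp add: slap_trace_def itinerary_def)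
  moreover have "y \<in> oseg (js (Suc j))" using is1(2) unfolding j xs(4)[symmetric] by auto
  ultimately have "y \<notin> set vs" by (rule oseg_not_vertex)
  moreover have "\<not> periodic_point (slap vs) y"
  proof
    assume "periodic_point (slap vs) y"
    then obtain l where l: "0 < l" "(slap vs ^^ l) y = y" by (auto simp: periodic_point_def)
    obtain js where is2: "slap_trace vs b js xs (Suc (l + j))" "\<forall>m\<in>{1..Suc (l + j)}. xs m \<in> oseg (js m)"
      using ot[of "l + j"] by blast
    have "xs (Suc j) \<noteq> xs (Suc (l + j))" using is2 l(1) by (intro trace_neq[OF is2(1)]) auto
    moreover have "xs (Suc (l + j)) = xs (Suc j)"
      unfolding xs(4) funpow_add o_apply j[symmetric] using l(2) .
    ultimately show False by simp
  qed
  ultimately show ?thesis by blast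
qed

lemma condition_star:
  assumes per: "perimeter vs = 1"
  shows "condition_star vs"
  unfolding condition_star_def
proof (intro allI impI)
  fix t assume t: "bdry_point vs t \<in> nonacute_vertices vs"
  have sub: "nonacute_vertices vs \<subseteq> set vs" by (auto simp: nonacute_vertices_def set_vs)
  obtain i where i: "i < n" "bdry_point vs t = V i"
    "Lim (at_right t) (\<lambda>u. slap vs (bdry_point vs u)) = hit i (V i)"
    "Lim (at_left t) (\<lambda>u. slap vs (bdry_point vs u)) = hit (pred i) (V i)"
    using slap_limits[OF per] t sub by blast
  obtain i' where "i' < n" "V i = V i'" "pi / 2 \<le> internal_angle vs i'"
    using t i by (auto simp: nonacute_vertices_def)
  then have ang: "pi / 2 \<le> internal_angle vs i" using V_inj[OF i(1)] by blast
  have pn: "pred i < n" "pred i \<noteq> i" using pred_lt pred_neq i by auto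
  have pos: "0 < Re (cnj (S (pred i)) * S i)"
    using internal_angle_Re[OF i(1) ang] not_orth[OF pn(1) i(1) pn(2)] by linarith
  then have pos': "0 < Re (cnj (S i) * S (pred i))" by (simp add: mult.commute)
  have Vp: "0 < d j (V i)" if "j < n" "j \<noteq> i" "j \<noteq> pred i" for j
    using d_V_pos[OF that(1) i(1)] that succ_inj[OF that(1) pn(1)] succ_pred[OF i(1)] by auto
  have VK: "V i \<in> region" using d_V_nonneg by (simp add: region_def)
  \<comment> \<open>The angle is not acute, so neither side line through the vertex is a facing one,
    and the vertex is strictly inside all lines that its two normals can hit. Both first steps have
    positive length.\<close>
  have J1: "0 < d j (V i)" if "j \<in> facing i" for j
  proof (rule Vp)
    show "j < n" using that by (simp add: facing_def)
    show "j \<noteq> i" using that not_facing_self by blast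
    show "j \<noteq> pred i" using that pos unfolding facing_def by (auto simp del: times_complex.sel)
  qed
  have J2: "0 < d j (V i)" if "j \<in> facing (pred i)" for j
  proof (rule Vp)
    show "j < n" using that by (simp add: facing_def)
    show "j \<noteq> pred i" using that not_facing_self by blast
    show "j \<noteq> i" using that pos' unfolding facing_def by (auto simp del: times_complex.sel)
  qed
  have cr: "0 < Im (cnj (S (pred i)) * S i)"
  proof -
    have "0 < Im (cnj (S (pred i)) * S (Suc (pred i)))" by (rule convex_polygon_side_cross[OF conv])
    moreover have "S (Suc (pred i)) = S i"
      using succ_pred[OF i(1)] V_Suc_pred[OF i(1)] V_mod[of "Suc (Suc (pred i))"] V_mod[of "Suc i"]
      by (simp add: side_def succ_def) (metis mod_Suc_eq)
    ultimately show ?thesis by simp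
  qed
  then have cr': "Im (cnj (S i) * S (pred i)) \<noteq> 0" by (simp add: mult.commute)
  have "y \<notin> set vs \<and> \<not> periodic_point (slap vs) y" if "y \<in> forward_orbit (slap vs) (hit i (V i))" for y
    by (rule slap_orbit_generic[OF i(1) pn(1,2) cr' VK d_V0(1) d_pred_V[OF i(1)] J1 that])
  moreover have "y \<notin> set vs \<and> \<not> periodic_point (slap vs) y" if "y \<in> forward_orbit (slap vs) (hit (pred i) (V i))" for y
    by (rule slap_orbit_generic[OF pn(1) i(1) pn(2)[symmetric] less_imp_neq[OF cr, symmetric] VK
          d_pred_V[OF i(1)] d_V0(1) J2 that])
  ultimately show "\<forall>x\<in>{Lim (at_right t) (\<lambda>u. slap vs (bdry_point vs u)),
               Lim (at_left t) (\<lambda>u. slap vs (bdry_point vs u))}.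
           \<forall>y \<in> forward_orbit (slap vs) x.
             y \<notin> nonacute_vertices vs \<and> \<not> periodic_point (slap vs) y"
    unfolding i(3,4) using sub by blast
qed

end

section \<open>Orbits as itineraries\<close>

lemma poly_lines_side:
  assumes "ws \<in> polygons n" "vtx ws 0 = 0" "vtx ws 1 = 1" "i < n"
  shows "poly_lines ws i = line_coords (vtx ws i) (vtx ws (Suc i))"
  using assms by (auto simp: poly_lines_def line_coords_def polygons_def)

lemma left_det_line_coords: "left_det ws i p = fst (line_coords (vtx ws i) (vtx ws (Suc i))) * Re p +
    fst (snd (line_coords (vtx ws i) (vtx ws (Suc i)))) * Im p + snd (snd (line_coords (vtx ws i) (vtx ws (Suc i))))"
  by (simp add: left_det_def side_def line_coords_def algebra_simps)

lemma meet3_point: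
  assumes "fst l * x + fst (snd l) * y + snd (snd l) = 0" "fst m * x + fst (snd m) * y + snd (snd m) = 0"
  shows "meet3 l m = scale3 (fst l * fst (snd m) - fst m * fst (snd l)) (x, y, 1)"
proof -
  have c: "snd (snd l) = - (fst l * x + fst (snd l) * y)" "snd (snd m) = - (fst m * x + fst (snd m) * y)"
    using assms by (metis add_eq_0_iff)+
  show ?thesis by (simp add: meet3_sel c algebra_simps)
qed

lemma slap_step_point:
  assumes "fst m * (x + r * fst l) + fst (snd m) * (y + r * fst (snd l)) + snd (snd m) = 0"
  shows "slap_step l m (x, y, 1) = scale3 (- dotn l m) (x + r * fst l, y + r * fst (snd l), 1)"
proof -
  have c: "snd (snd m) = - (fst m * (x + r * fst l) + fst (snd m) * (y + r * fst (snd l)))"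
    using assms by (metis add_eq_0_iff)
  show ?thesis by (simp add: slap_step_sel dot3_sel dotn_sel c algebra_simps)
qed

definition cpoint :: "complex \<Rightarrow> ctriple" where
  "cpoint p = (of_real (Re p), of_real (Im p), 1)"

lemma dotn_line_coords:
  "dotn (creal (line_coords (vtx ws i) (vtx ws (Suc i)))) (creal (line_coords (vtx ws j) (vtx ws (Suc j)))) =
    of_real (Re (cnj (side ws i) * side ws j))"
  by (simp add: dotn_sel line_coords_def side_def algebra_simps)

lemma dot3_line_coords:
  "dot3 (creal (line_coords (vtx ws i) (vtx ws (Suc i)))) (cpoint p) = of_real (left_det ws i p)"
  by (simp add: dot3_sel left_det_line_coords cpoint_def)

text \<open>The scalar is a product of the determinant of the two starting normals and, for each
  step, of minus the product of successive normals. \<open>slap_trace\<close> makes all these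
  factors nonzero.\<close>

lemma track_trace:
  assumes ws: "ws \<in> polygons n" "vtx ws 0 = 0" "vtx ws 1 = 1"
    and tr: "slap_trace ws b is xs k" and m: "m \<le> k"
  shows "\<exists>z. z \<noteq> 0 \<and> track (\<lambda>i. creal (poly_lines ws i)) b is m = scale3 z (cpoint (xs m))"
  using m
proof (induction m)
  case 0
  have lt: "is 0 < n" "b < n" using tr ws by (auto simp: slap_trace_def itinerary_def polygons_def)
  let ?l = "\<lambda>i. creal (line_coords (vtx ws i) (vtx ws (Suc i)))"
  have "dot3 (?l (is 0)) (cpoint (xs 0)) = 0" "dot3 (?l b) (cpoint (xs 0)) = 0"
    unfolding dot3_line_coords using tr by (auto simp: slap_trace_def)
  then have "meet3 (?l (is 0)) (?l b) = scale3 (fst (?l (is 0)) * fst (snd (?l b)) - fst (?l b) * fst (snd (?l (is 0)))) (cpoint (xs 0))"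
    unfolding cpoint_def by (intro meet3_point) (simp_all add: dot3_sel)
  moreover have "fst (?l (is 0)) * fst (snd (?l b)) - fst (?l b) * fst (snd (?l (is 0))) = of_real (Im (cnj (side ws (is 0)) * side ws b))"
    by (simp add: line_coords_def side_def algebra_simps)
  moreover have "Im (cnj (side ws (is 0)) * side ws b) \<noteq> 0" using tr by (simp add: slap_trace_def)
  ultimately show ?case
    unfolding track.simps poly_lines_side[OF ws lt(1)] poly_lines_side[OF ws lt(2)] by (metis of_real_eq_0_iff)
next
  case (Suc m)
  then obtain z where z: "z \<noteq> 0" "track (\<lambda>i. creal (poly_lines ws i)) b is m = scale3 z (cpoint (xs m))" by auto
  have lt: "is m < n" "is (Suc m) < n" using tr ws Suc by (auto simp: slap_trace_def itinerary_def polygons_def)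
  let ?l = "\<lambda>i. creal (line_coords (vtx ws i) (vtx ws (Suc i)))"
  have "m < k" using Suc by simp
  then obtain r where r: "Re (cnj (side ws (is m)) * side ws (is (Suc m))) \<noteq> 0" "left_det ws (is (Suc m)) (xs (Suc m)) = 0"
    "xs (Suc m) = xs m + of_real r * (\<i> * side ws (is m))" using tr unfolding slap_trace_def by blast
  have cp: "cpoint (xs (Suc m)) = (of_real (Re (xs m)) + of_real r * fst (?l (is m)),
      of_real (Im (xs m)) + of_real r * fst (snd (?l (is m))), 1)"
    unfolding r(3) by (simp add: cpoint_def line_coords_def side_def algebra_simps)
  have "dot3 (?l (is (Suc m))) (cpoint (xs (Suc m))) = 0" unfolding dot3_line_coords using r by simp
  then have "slap_step (?l (is m)) (?l (is (Suc m))) (cpoint (xs m)) =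
      scale3 (- dotn (?l (is m)) (?l (is (Suc m)))) (cpoint (xs (Suc m)))"
    unfolding cp unfolding cpoint_def by (intro slap_step_point) (simp add: dot3_sel)
  then have "track (\<lambda>i. creal (poly_lines ws i)) b is (Suc m) =
      scale3 (z * (- of_real (Re (cnj (side ws (is m)) * side ws (is (Suc m)))))) (cpoint (xs (Suc m)))"
    unfolding track.simps z(2) slap_step_scale poly_lines_side[OF ws lt(1)] poly_lines_side[OF ws lt(2)] dotn_line_coords
    by (simp only: scale3_scale3)
  moreover have "z * (- of_real (Re (cnj (side ws (is m)) * side ws (is (Suc m))))) \<noteq> 0"
    using z(1) r(1) by (simp only: mult_eq_0_iff neg_equal_0_iff_equal of_real_eq_0_iff) simp
  ultimately show ?case by blast
qed

lemma Im_scale: "Im (cnj (a * u) * (a * w)) = (norm a)\<^sup>2 * Im (cnj u * w)"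
  and Re_scale: "Re (cnj (a * u) * (a * w)) = (norm a)\<^sup>2 * Re (cnj u * w)"
proof -
  have e: "cnj (a * u) * (a * w) = of_real ((norm a)\<^sup>2) * (cnj u * w)"
    by (simp only: complex_norm_square complex_cnj_mult mult_ac)
  show "Im (cnj (a * u) * (a * w)) = (norm a)\<^sup>2 * Im (cnj u * w)"
    "Re (cnj (a * u) * (a * w)) = (norm a)\<^sup>2 * Re (cnj u * w)"
    unfolding e by (simp_all del: of_real_power)
qed

lemma side_similar: "vs \<noteq> [] \<Longrightarrow> side (map (\<lambda>z. a * z + c) vs) i = a * side vs i"
  by (simp add: side_def vtx_map algebra_simps)

lemma left_det_similar: "vs \<noteq> [] \<Longrightarrow> left_det (map (\<lambda>z. a * z + c) vs) i (a * p + c) = (norm a)\<^sup>2 * left_det vs i p"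
  unfolding left_det_def side_similar vtx_map Im_scale[symmetric] by (simp add: algebra_simps)

lemma slap_trace_similar:
  assumes "vs \<noteq> []" "a \<noteq> 0" "slap_trace vs b is xs k"
  shows "slap_trace (map (\<lambda>z. a * z + c) vs) b is (\<lambda>m. a * xs m + c) k"
proof -
  have "\<exists>r. a * xs (Suc m) + c = a * xs m + c + of_real r * (\<i> * (a * side vs (is m)))" if m: "m < k" for m
  proof -
    obtain r where "xs (Suc m) = xs m + of_real r * (\<i> * side vs (is m))"
      using assms(3) m unfolding slap_trace_def by blast
    then show ?thesis by (intro exI[of _ r]) (simp add: algebra_simps)
  qed
  then show ?thesis
    using assms unfolding slap_trace_def side_similar[OF assms(1)] left_det_similar[OF assms(1)] Re_scale Im_scale length_map
    by (simp del: times_complex.sel)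
qed

text \<open>Only the first \<open>k + 1\<close> values of an itinerary matter for a trace of length
  \<open>k\<close>; cut off to a list, it belongs to the countable family.\<close>

lemma itinerary_list:
  assumes "itinerary n b is k"
  shows "itinerary n b ((!) (map is [0..<Suc k])) k" "\<And>m. m \<le> k \<Longrightarrow> map is [0..<Suc k] ! m = is m"
proof -
  show "map is [0..<Suc k] ! m = is m" if "m \<le> k" for m
    using that by (simp del: upt_Suc)
  then show "itinerary n b ((!) (map is [0..<Suc k])) k" using assms by (simp add: itinerary_def del: upt_Suc)
qed

text \<open>The polynomials are evaluated at the normalised polygon. Traces of \<open>vs\<close> are
  carried there by the normalising similarity \<open>z \<mapsto> a * z + c\<close>, which multiplies
  determinants and scalar products of sides by the square of \<open>norm a\<close>.\<close>

lemma generic_polygonI: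
  assumes vs: "vs \<in> polygons n"
    and F: "\<And>F. nondeg n F \<Longrightarrow> F (\<lambda>i. creal (poly_lines (normalise vs) i)) \<noteq> 0"
  shows "generic_polygon vs"
proof -
  have conv: "convex_polygon vs" and len: "length vs = n" using vs by (auto simp: polygons_def)
  have ne: "vs \<noteq> []" "vs ! 1 \<noteq> vs ! 0" using convex_polygon_nz01[OF conv] by auto
  define a c where "a = inverse (vs ! 1 - vs ! 0)" and "c = - vs ! 0 / (vs ! 1 - vs ! 0)"
  have a: "a \<noteq> 0" using ne by (simp add: a_def)
  define ws where "ws = normalise vs"
  have ws_eq: "ws = map (\<lambda>z. a * z + c) vs"
    by (simp add: ws_def normalise_def a_def c_def diff_divide_distrib divide_inverse algebra_simps)
  note nn = normalise_nth[OF vs, folded ws_def]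
  note F = F[folded ws_def]
  note ws = nn(4,1,2)
  let ?l = "\<lambda>i. creal (poly_lines ws i)"
  show ?thesis
  proof
    show "convex_polygon vs" by fact
  next
    fix i j assume ij: "i < length vs" "j < length vs" "i \<noteq> j"
    then have "orth_fun i j ?l \<noteq> 0" using nondeg.orth F len by blast
    then have "Re (cnj (side ws i) * side ws j) \<noteq> 0"
      using ij len unfolding orth_fun_def by (simp add: poly_lines_side[OF ws] dotn_line_coords del: times_complex.sel)
    then show "Re (cnj (side vs i) * side vs j) \<noteq> 0"
      unfolding ws_eq side_similar[OF ne(1)] Re_scale by (simp del: times_complex.sel)
  next
    fix b xs k e and js :: "nat \<Rightarrow> nat"
    assume tr: "slap_trace vs b js xs (Suc k)" and e: "e < length vs" "e \<noteq> js (Suc k)" "e \<noteq> js k"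
    have it: "itinerary n b js (Suc k)" using tr len by (simp add: slap_trace_def)
    note il = itinerary_list[OF it]
    have tr': "slap_trace ws b js (\<lambda>m. a * xs m + c) (Suc k)" unfolding ws_eq by (rule slap_trace_similar[OF ne(1) a tr])
    have "hit_fun b ((!) (map js [0..<Suc (Suc k)])) (Suc k) e ?l \<noteq> 0"
      using il e len by (intro F nondeg.hit) auto
    moreover have "track ?l b ((!) (map js [0..<Suc (Suc k)])) (Suc k) = track ?l b js (Suc k)"
      by (rule track_cong) (rule il(2))
    moreover obtain z where z: "z \<noteq> 0" "track ?l b js (Suc k) = scale3 z (cpoint (a * xs (Suc k) + c))"
      using track_trace[OF ws tr' order_refl] by blast
    ultimately have "dot3 (?l e) (scale3 z (cpoint (a * xs (Suc k) + c))) \<noteq> 0"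
      by (simp add: hit_fun_def del: track.simps upt_Suc)
    moreover have "dot3 (?l e) (scale3 z X) = z * dot3 (?l e) X" for X by (simp add: dot3_sel algebra_simps)
    ultimately have "left_det ws e (a * xs (Suc k) + c) \<noteq> 0"
      using e len by (simp add: poly_lines_side[OF ws] dot3_line_coords)
    then show "left_det vs e (xs (Suc k)) \<noteq> 0"
      unfolding ws_eq left_det_similar[OF ne(1)] by simp
  next
    fix b xs k m and js :: "nat \<Rightarrow> nat"
    assume tr: "slap_trace vs b js xs (Suc k)" and m: "m < k" "js (Suc m) = js (Suc k)" "js m \<noteq> js k"
    have it: "itinerary n b js (Suc k)" using tr len by (simp add: slap_trace_def)
    note il = itinerary_list[OF it]
    have tr': "slap_trace ws b js (\<lambda>m. a * xs m + c) (Suc k)" unfolding ws_eq by (rule slap_trace_similar[OF ne(1) a tr])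
    have "coll_fun b ((!) (map js [0..<Suc (Suc k)])) (Suc k) (Suc m) ?l \<noteq> 0"
      using il m by (intro F nondeg.coll) auto
    moreover have "track ?l b ((!) (map js [0..<Suc (Suc k)])) (Suc k) = track ?l b js (Suc k)"
      by (rule track_cong) (rule il(2))
    moreover have "track ?l b ((!) (map js [0..<Suc (Suc k)])) (Suc m) = track ?l b js (Suc m)"
      by (rule track_cong) (use m il(2) in auto)
    moreover obtain z where z: "z \<noteq> 0" "track ?l b js (Suc k) = scale3 z (cpoint (a * xs (Suc k) + c))"
      using track_trace[OF ws tr' order_refl] by blast
    moreover obtain y where y: "y \<noteq> 0" "track ?l b js (Suc m) = scale3 y (cpoint (a * xs (Suc m) + c))"
      using track_trace[OF ws tr', of "Suc m"] m by auto
    \<comment> \<open>Equal points would have proportional triples, on which \<open>coll_fun\<close>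
      vanishes.\<close>
    ultimately show "xs (Suc m) \<noteq> xs (Suc k)"
      unfolding coll_fun_def by (auto simp: cpoint_def simp del: track.simps upt_Suc)
  qed
qed

theorem theorem1p2:
  fixes n :: nat
  assumes "3 \<le> n"
  shows "residual_in (moduli_topology n) (moduli_star n) \<and>
    (AE C in moduli_measure n. C \<in> moduli_star n)"
proof -
  define \<G> where "\<G> = avoidance.good n ` {F. nondeg n F}"
  have av: "avoidance n F" if "nondeg n F" for F using that assms by (simp add: avoidance_def)
  interpret M: Metric_space "moduli n" "moduli_dist n" by (rule Metric_space_moduli)
  have top: "topspace (moduli_topology n) = moduli n" by (simp add: moduli_topology_def)
  have cG: "countable \<G>" unfolding \<G>_def by (intro countable_image countable_nondeg)
  have star: "C \<in> moduli_star n" if C: "C \<in> moduli n" "C \<in> \<Inter>\<G>" for C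
    unfolding moduli_star_def
  proof (intro CollectI conjI ballI impI)
    fix vs assume vs: "vs \<in> C" "perimeter vs = 1"
    have "F (\<lambda>i. creal (poly_lines (normalise vs) i)) \<noteq> 0" if "nondeg n F" for F
      using avoidance.goodD[OF av[OF that]] C(2) vs(1) that by (auto simp: \<G>_def)
    moreover have "vs \<in> polygons n" using moduli_normalised[OF C(1)] vs(1) by metis
    ultimately show "condition_star vs"
      using generic_polygon.condition_star[OF generic_polygonI vs(2)] by blast
  qed (rule C(1))
  have "residual_in (moduli_topology n) (moduli_star n)"
    unfolding residual_in_def
  proof (intro conjI exI[of _ \<G>] ballI cG)
    show "moduli_star n \<subseteq> topspace (moduli_topology n)" by (auto simp: moduli_star_def top)
    show "openin (moduli_topology n) U" if "U \<in> \<G>" for U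
      using that avoidance.openin_good[OF av] by (auto simp: \<G>_def)
    show "moduli_topology n closure_of U = topspace (moduli_topology n)" if "U \<in> \<G>" for U
      using that avoidance.closure_good[OF av] by (auto simp: \<G>_def)
    show "topspace (moduli_topology n) \<inter> \<Inter>\<G> \<subseteq> moduli_star n" using star by (auto simp: top)
  qed
  moreover have "AE C in moduli_measure n. C \<in> moduli_star n"
  proof -
    have "AE C in moduli_measure n. \<forall>U\<in>\<G>. C \<in> U"
      unfolding AE_ball_countable[OF cG] using avoidance.AE_good[OF av] by (auto simp: \<G>_def)
    then show ?thesis
      by (rule AE_mp) (use star in \<open>auto intro!: AE_I2 simp: space_moduli_measure\<close>)
  qed
  ultimately show ?thesis by blast
qed

end
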